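(* Let $H$ be a semisimple Hopf algebra with a grading preserving action on a connected graded algebra $A$ that is finitely generated in degree one by the left $H$-module $W=A_1$. Then the Gabriel quiver $\mathcal G(H,A)$ of the $H$-action on $A$ is isomorphic, as a directed graph, to the McKay quiver $(W)\mathcal M$.
   Context: Everything is over an algebraically closed field $\Bbbk$ of characteristic zero; $\otimes=\otimes_\Bbbk$. An algebra $A$ is connected graded if $A=\Bbbk\oplus A_1\oplus A_2\oplus\cdots$ with $A_iA_j\subseteq A_{i+j}$. $H$ acts on $A$ if $A$ is a left $H$-module with $h(ab)=\sum h_1(a)h_2(b)$ and $h(1)=\epsilon(h)1$; the action is grading preserving if each $A_i$ is an $H$-submodule. The smash product $A\# H$ is $A\otimes H$ with $(a\# h)(a'\# h')=\sum a h_1(a')\# h_2h'$, graded with $H$ in degree $0$. Let $V^{(0)},\dots,V^{(s)}$ be a complete set of nonisomorphic simple left $H$-modules, with $V^{(0)}=H/\ker\epsilon$ the trivial one. For each $j$ let $P^{(j)}=A\otimes V^{(j)}$, a graded left $A\# H$-module via $(x\# h)(a\otimes v)=\sum x h_1(a)\otimes h_2(v)$, with $V^{(j)}$ in degree $0$. $V^{(j)}$ is a simple graded left $A\# H$-module via the surjection $A\# H\to H$ killing $A_{\ge1}$; let $\cdots\to Q^{(j)}_1\to Q^{(j)}_0\to V^{(j)}\to0$ be a minimal graded projective resolution over $A\# H$. $M[-1]$ denotes the degree shift of a graded module $M$ with $M[-1]_i=M_{i-1}$. Gabriel quiver $\mathcal G(H,A)$: vertices $P^{(0)},\dots,P^{(s)}$,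 with $m_{ij}$ arrows from $P^{(i)}$ to $P^{(j)}$, where $m_{ij}$ is the multiplicity of $P^{(i)}[-1]$ as a direct summand of $Q_1^{(j)}$. McKay quiver $(W)\mathcal M$: vertices $V^{(0)},\dots,V^{(s)}$, with $n_{ij}$ arrows from $V^{(i)}$ to $V^{(j)}$, where $W\otimes V^{(j)}\cong\bigoplus_{i=0}^s (V^{(i)})^{\oplus n_{ij}}$ as left $H$-modules. *)

theory Defs
  imports
    "HOL-Library.Function_Algebras"
    "HOL-Computational_Algebra.Polynomial"
    "HOL-Algebra.Ring"
    "Graph_Theory.Digraph_Isomorphism"
begin

section \<open>Left modules over a not necessarily commutative ring\<close>

text \<open>The additive group of a module is a subgroup of an ambient type of class
  \<open>ab_group_add\<close>; the ring is a record of HOL-Algebra, since the smash product below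
  lives on a proper subset of a type.\<close>

definition add_subgroup :: "'m::ab_group_add set \<Rightarrow> bool" where
  "add_subgroup S \<longleftrightarrow> 0 \<in> S \<and> (\<forall>x\<in>S. \<forall>y\<in>S. x - y \<in> S)"

record ('r, 'm) lmod =
  mcar :: "'m set"
  act :: "'r \<Rightarrow> 'm \<Rightarrow> 'm"

locale left_module =
  fixes R :: "('r, 'z) ring_scheme" (structure) and M :: "('r, 'm::ab_group_add, 'y) lmod_scheme"
  assumes mcar_subgroup: "add_subgroup (mcar M)"
    and act_closed: "\<lbrakk>r \<in> carrier R; x \<in> mcar M\<rbrakk> \<Longrightarrow> act M r x \<in> mcar M"
    and act_add_right: "\<lbrakk>r \<in> carrier R; x \<in> mcar M; y \<in> mcar M\<rbrakk>
      \<Longrightarrow> act M r (x + y) = act M r x + act M r y"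
    and act_add_left: "\<lbrakk>r \<in> carrier R; r' \<in> carrier R; x \<in> mcar M\<rbrakk>
      \<Longrightarrow> act M (r \<oplus> r') x = act M r x + act M r' x"
    and act_mult: "\<lbrakk>r \<in> carrier R; r' \<in> carrier R; x \<in> mcar M\<rbrakk>
      \<Longrightarrow> act M (r \<otimes> r') x = act M r (act M r' x)"
    and act_one: "x \<in> mcar M \<Longrightarrow> act M \<one> x = x"

definition univ_ring :: "'r::ring_1 ring" where
  "univ_ring = \<lparr>carrier = UNIV, mult = (*), one = 1, zero = 0, add = (+)\<rparr>"

definition submodule ::
  "('r, 'z) ring_scheme \<Rightarrow> ('r, 'm::ab_group_add, 'y) lmod_scheme \<Rightarrow> 'm set \<Rightarrow> bool" where
  "submodule R M X \<longleftrightarrow>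
    X \<subseteq> mcar M \<and> add_subgroup X \<and> (\<forall>r\<in>carrier R. \<forall>x\<in>X. act M r x \<in> X)"

definition complementary :: "('r, 'm::ab_group_add, 'y) lmod_scheme \<Rightarrow> 'm set \<Rightarrow> 'm set \<Rightarrow> bool" where
  "complementary M X Y \<longleftrightarrow> X \<inter> Y = {0} \<and> {x + y |x y. x \<in> X \<and> y \<in> Y} = mcar M"

definition simple_module ::
  "('r, 'z) ring_scheme \<Rightarrow> ('r, 'm::ab_group_add, 'y) lmod_scheme \<Rightarrow> bool" where
  "simple_module R M \<longleftrightarrow>
    left_module R M \<and> mcar M \<noteq> {0} \<and> (\<forall>X. submodule R M X \<longrightarrow> X = {0} \<or> X = mcar M)"

definition semisimple_module ::
  "('r, 'z) ring_scheme \<Rightarrow> ('r, 'm::ab_group_add, 'y) lmod_scheme \<Rightarrow> bool" where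
  "semisimple_module R M \<longleftrightarrow>
    left_module R M \<and> (\<forall>X. submodule R M X \<longrightarrow> (\<exists>Y. submodule R M Y \<and> complementary M X Y))"

definition lmod_hom ::
  "('r, 'z) ring_scheme \<Rightarrow> ('r, 'm::ab_group_add, 'y) lmod_scheme
    \<Rightarrow> ('r, 'n::ab_group_add, 'x) lmod_scheme \<Rightarrow> ('m \<Rightarrow> 'n) \<Rightarrow> bool" where
  "lmod_hom R M N f \<longleftrightarrow>
    (\<forall>x\<in>mcar M. f x \<in> mcar N) \<and>
    (\<forall>x\<in>mcar M. \<forall>y\<in>mcar M. f (x + y) = f x + f y) \<and>
    (\<forall>r\<in>carrier R. \<forall>x\<in>mcar M. f (act M r x) = act N r (f x))"

definition lmod_iso ::
  "('r, 'z) ring_scheme \<Rightarrow> ('r, 'm::ab_group_add, 'y) lmod_scheme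
    \<Rightarrow> ('r, 'n::ab_group_add, 'x) lmod_scheme \<Rightarrow> bool" where
  "lmod_iso R M N \<longleftrightarrow> (\<exists>f. lmod_hom R M N f \<and> bij_betw f (mcar M) (mcar N))"

definition lmod_dsum ::
  "'i set \<Rightarrow> ('i \<Rightarrow> ('r, 'm::ab_group_add, 'y) lmod_scheme) \<Rightarrow> ('r, 'i \<Rightarrow> 'm) lmod" where
  "lmod_dsum I M = \<lparr>
    mcar = {f. finite {i. f i \<noteq> 0} \<and> (\<forall>i\<in>I. f i \<in> mcar (M i)) \<and> (\<forall>i. i \<notin> I \<longrightarrow> f i = 0)},
    act = (\<lambda>r f i. if i \<in> I then act (M i) r (f i) else 0)\<rparr>"


section \<open>Graded rings and modules\<close>

definition direct_decomposition :: "'m::ab_group_add set \<Rightarrow> ('i \<Rightarrow> 'm set) \<Rightarrow> bool" where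
  "direct_decomposition M G \<longleftrightarrow>
    add_subgroup M \<and> (\<forall>i. add_subgroup (G i) \<and> G i \<subseteq> M) \<and>
    (\<forall>x\<in>M. \<exists>!f. finite {i. f i \<noteq> 0} \<and> (\<forall>i. f i \<in> G i) \<and> x = (\<Sum>i | f i \<noteq> 0. f i))"

record 'r gring = "'r ring" +
  rpart :: "nat \<Rightarrow> 'r set"

record ('r, 'm) glmod = "('r, 'm) lmod" +
  mpart :: "int \<Rightarrow> 'm set"

definition graded_module :: "'r gring \<Rightarrow> ('r, 'm::ab_group_add) glmod \<Rightarrow> bool" where
  "graded_module R M \<longleftrightarrow>
    left_module R M \<and> direct_decomposition (mcar M) (mpart M) \<and>
    (\<forall>i j. \<forall>r\<in>rpart R i. \<forall>x\<in>mpart M j. act M r x \<in> mpart M (int i + j))"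

definition graded_submodule :: "'r gring \<Rightarrow> ('r, 'm::ab_group_add) glmod \<Rightarrow> 'm set \<Rightarrow> bool" where
  "graded_submodule R M X \<longleftrightarrow>
    submodule R M X \<and> direct_decomposition X (\<lambda>i. X \<inter> mpart M i)"

definition restrict_gmod :: "('r, 'm::ab_group_add) glmod \<Rightarrow> 'm set \<Rightarrow> ('r, 'm) glmod" where
  "restrict_gmod M X = M\<lparr>mcar := X, mpart := (\<lambda>i. X \<inter> mpart M i)\<rparr>"

definition graded_hom ::
  "'r gring \<Rightarrow> ('r, 'm::ab_group_add) glmod \<Rightarrow> ('r, 'n::ab_group_add) glmod \<Rightarrow> ('m \<Rightarrow> 'n) \<Rightarrow> bool" where
  "graded_hom R M N f \<longleftrightarrow> lmod_hom R M N f \<and> (\<forall>i. \<forall>x\<in>mpart M i. f x \<in> mpart N i)"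

text \<open>The inverse of a bijective homomorphism of degree 0 also has degree 0.\<close>

definition graded_iso ::
  "'r gring \<Rightarrow> ('r, 'm::ab_group_add) glmod \<Rightarrow> ('r, 'n::ab_group_add) glmod \<Rightarrow> bool" where
  "graded_iso R M N \<longleftrightarrow> (\<exists>f. graded_hom R M N f \<and> bij_betw f (mcar M) (mcar N))"

definition shift :: "('r, 'm) glmod \<Rightarrow> int \<Rightarrow> ('r, 'm) glmod" where
  "shift M n = M\<lparr>mpart := (\<lambda>i. mpart M (i + n))\<rparr>"

definition gmod_power :: "('r, 'm::ab_group_add) glmod \<Rightarrow> nat \<Rightarrow> ('r, nat \<Rightarrow> 'm) glmod" where
  "gmod_power M n = (let D = lmod_dsum {..<n} (\<lambda>_. M) in
    \<lparr>mcar = mcar D, act = act D, mpart = (\<lambda>i. {f \<in> mcar D. \<forall>k<n. f k \<in> mpart M i})\<rparr>)"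

definition summand_multiplicity ::
  "'r gring \<Rightarrow> ('r, 'p::ab_group_add) glmod \<Rightarrow> ('r, 'q::ab_group_add) glmod \<Rightarrow> nat" where
  "summand_multiplicity R P Q = (GREATEST m. \<exists>X Y.
    graded_submodule R Q X \<and> graded_submodule R Q Y \<and> complementary Q X Y \<and>
    graded_iso R (gmod_power P m) (restrict_gmod Q X))"

text \<open>Projective objects of the category of graded modules and degree 0 homomorphisms. The test
  modules range over two types only. This is no restriction: the type \<open>'q \<Rightarrow> 'r\<close> contains the
  graded free module on the nonzero homogeneous elements of \<open>P\<close> (finitely supported functions),
  so taking \<open>N = P\<close> and \<open>g\<close> the identity exhibits \<open>P\<close> as a direct summand of a graded free
  module, and hence \<open>P\<close> has the lifting property for modules over any types.\<close>

definition graded_projective ::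
  "'r::ab_group_add gring \<Rightarrow> ('r, 'q::ab_group_add) glmod \<Rightarrow> bool" where
  "graded_projective R P \<longleftrightarrow> graded_module R P \<and>
    (\<forall>(M :: ('r, 'q \<Rightarrow> 'r) glmod) (N :: ('r, 'q) glmod) f g.
      graded_module R M \<and> graded_module R N \<and>
      graded_hom R M N f \<and> f ` mcar M = mcar N \<and> graded_hom R P N g \<longrightarrow>
      (\<exists>h. graded_hom R P M h \<and> (\<forall>x\<in>mcar P. f (h x) = g x)))"

definition superfluous :: "'r gring \<Rightarrow> ('r, 'm::ab_group_add) glmod \<Rightarrow> 'm set \<Rightarrow> bool" where
  "superfluous R M K \<longleftrightarrow>
    (\<forall>X. graded_submodule R M X \<and> {k + x |k x. k \<in> K \<and> x \<in> X} = mcar M \<longrightarrow> X = mcar M)"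

definition mod_ker :: "('r, 'm, 'y) lmod_scheme \<Rightarrow> ('m \<Rightarrow> 'n::zero) \<Rightarrow> 'm set" where
  "mod_ker M f = {x \<in> mcar M. f x = 0}"

text \<open>A resolution \<open>\<dots> \<rightarrow> Q 1 \<rightarrow> Q 0 \<rightarrow> M \<rightarrow> 0\<close> with differentials \<open>d n : Q (n + 1) \<rightarrow> Q n\<close> and
  augmentation \<open>e : Q 0 \<rightarrow> M\<close>. Minimality: \<open>e\<close>, and each \<open>d n\<close> as a map onto its image, is a
  projective cover.\<close>

definition minimal_graded_resolution ::
  "'r::ab_group_add gring \<Rightarrow> ('r, 'm::ab_group_add) glmod \<Rightarrow> (nat \<Rightarrow> ('r, 'q::ab_group_add) glmod)
    \<Rightarrow> (nat \<Rightarrow> 'q \<Rightarrow> 'q) \<Rightarrow> ('q \<Rightarrow> 'm) \<Rightarrow> bool" where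
  "minimal_graded_resolution R M Q d e \<longleftrightarrow>
    graded_module R M \<and> (\<forall>n. graded_projective R (Q n)) \<and>
    graded_hom R (Q 0) M e \<and> (\<forall>n. graded_hom R (Q (Suc n)) (Q n) (d n)) \<and>
    e ` mcar (Q 0) = mcar M \<and>
    d 0 ` mcar (Q 1) = mod_ker (Q 0) e \<and>
    (\<forall>n. d (Suc n) ` mcar (Q (Suc (Suc n))) = mod_ker (Q (Suc n)) (d n)) \<and>
    superfluous R (Q 0) (mod_ker (Q 0) e) \<and>
    (\<forall>n. superfluous R (Q (Suc n)) (mod_ker (Q (Suc n)) (d n)))"


section \<open>Tensor products of vector spaces\<close>

text \<open>A vector space over \<open>'k\<close> is a left module over \<open>univ_ring :: 'k ring\<close>.\<close>

abbreviation full_space :: "('k \<Rightarrow> 'v \<Rightarrow> 'v) \<Rightarrow> ('k, 'v) lmod" where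
  "full_space s \<equiv> \<lparr>mcar = UNIV, act = s\<rparr>"

definition bilinear_map ::
  "('k, 'v::ab_group_add) lmod \<Rightarrow> ('k, 'w::ab_group_add) lmod \<Rightarrow> ('k, 'u::ab_group_add) lmod
    \<Rightarrow> ('v \<Rightarrow> 'w \<Rightarrow> 'u) \<Rightarrow> bool" where
  "bilinear_map V W U f \<longleftrightarrow>
    (\<forall>v\<in>mcar V. \<forall>w\<in>mcar W. f v w \<in> mcar U) \<and>
    (\<forall>v\<in>mcar V. \<forall>v'\<in>mcar V. \<forall>w\<in>mcar W. f (v + v') w = f v w + f v' w) \<and>
    (\<forall>v\<in>mcar V. \<forall>w\<in>mcar W. \<forall>w'\<in>mcar W. f v (w + w') = f v w + f v w') \<and>
    (\<forall>c. \<forall>v\<in>mcar V. \<forall>w\<in>mcar W.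
      f (act V c v) w = act U c (f v w) \<and> f v (act W c w) = act U c (f v w))"

text \<open>Over a field, \<open>V \<otimes> W\<close> embeds into the dual of the space of bilinear forms on \<open>V \<times> W\<close>, with
  \<open>v \<otimes> w\<close> acting as evaluation at \<open>(v, w)\<close>. We take the image as the definition; it consists of
  the finite sums of pure tensors. Its universal property is \<open>bilinear_tpure\<close> together with
  \<open>tensor_lift_tsum\<close>.\<close>

type_synonym ('k, 'v, 'w) tensor = "('v \<Rightarrow> 'w \<Rightarrow> 'k) \<Rightarrow> 'k"

definition tpure ::
  "('k::field, 'v::ab_group_add) lmod \<Rightarrow> ('k, 'w::ab_group_add) lmod \<Rightarrow> 'v \<Rightarrow> 'w
    \<Rightarrow> ('k, 'v, 'w) tensor" where
  "tpure V W v w = (\<lambda>\<beta>. if bilinear_map V W (full_space (*)) \<beta> then \<beta> v w else 0)"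

definition tsum ::
  "('k::field, 'v::ab_group_add) lmod \<Rightarrow> ('k, 'w::ab_group_add) lmod \<Rightarrow> ('v \<times> 'w) list
    \<Rightarrow> ('k, 'v, 'w) tensor" where
  "tsum V W xs = (\<Sum>(v, w)\<leftarrow>xs. tpure V W v w)"

definition tspan ::
  "('k::field, 'v::ab_group_add) lmod \<Rightarrow> ('k, 'w::ab_group_add) lmod \<Rightarrow> 'v set \<Rightarrow> 'w set
    \<Rightarrow> ('k, 'v, 'w) tensor set" where
  "tspan V W X Y = {tsum V W xs |xs. set xs \<subseteq> X \<times> Y}"

definition tscale :: "'k::field \<Rightarrow> ('b \<Rightarrow> 'k) \<Rightarrow> 'b \<Rightarrow> 'k" where
  "tscale c t = (\<lambda>\<beta>. c * t \<beta>)"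

definition tensor_space ::
  "('k::field, 'v::ab_group_add) lmod \<Rightarrow> ('k, 'w::ab_group_add) lmod
    \<Rightarrow> ('k, ('k, 'v, 'w) tensor) lmod" where
  "tensor_space V W = \<lparr>mcar = tspan V W (mcar V) (mcar W), act = tscale\<rparr>"

text \<open>The linear map on \<open>V \<otimes> W\<close> induced by a bilinear map \<open>f\<close>. By \<open>tensor_lift_tsum\<close> the choice
  of the representation as a sum of pure tensors does not matter.\<close>

definition tensor_lift ::
  "('k::field, 'v::ab_group_add) lmod \<Rightarrow> ('k, 'w::ab_group_add) lmod \<Rightarrow> ('v \<Rightarrow> 'w \<Rightarrow> 'u::ab_group_add)
    \<Rightarrow> ('k, 'v, 'w) tensor \<Rightarrow> 'u" where
  "tensor_lift V W f t =
    (\<Sum>(v, w)\<leftarrow>(SOME xs. set xs \<subseteq> mcar V \<times> mcar W \<and> t = tsum V W xs). f v w)"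

lemma bilinear_tpure: "bilinear_map V W (tensor_space V W) (tpure V W)"
proof -
  have "tpure V W v w \<in> tspan V W (mcar V) (mcar W)" if "v \<in> mcar V" "w \<in> mcar W" for v w
    unfolding tspan_def
    by (rule CollectI, rule exI[of _ "[(v, w)]"]) (use that in \<open>auto simp: tsum_def\<close>)
  then show ?thesis
    unfolding bilinear_map_def[of V W "tensor_space V W"]
    by (auto simp: tensor_space_def tpure_def tscale_def bilinear_map_def fun_eq_iff)
qed

lemma separating_functional:
  fixes U :: "('k::field, 'u::ab_group_add) lmod"
  assumes U: "left_module (univ_ring :: 'k ring) U" and u: "u \<in> mcar U" "u \<noteq> 0"
  obtains g :: "'u \<Rightarrow> 'k"
    where "\<And>x y. x \<in> mcar U \<Longrightarrow> y \<in> mcar U \<Longrightarrow> g (x + y) = g x + g y"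
      and "\<And>c x. x \<in> mcar U \<Longrightarrow> g (act U c x) = c * g x"
      and "g u \<noteq> 0"
proof -
  let ?C = "mcar U"
  have car: "carrier (univ_ring :: 'k ring) = UNIV" "add (univ_ring :: 'k ring) = (+)"
    "mult (univ_ring :: 'k ring) = (*)" "one (univ_ring :: 'k ring) = 1"
    by (simp_all add: univ_ring_def)
  note L = left_module.act_add_right[OF U] left_module.act_add_left[OF U]
    left_module.act_mult[OF U] left_module.act_one[OF U] left_module.act_closed[OF U]
  note L = L[unfolded car]
  have sub: "add_subgroup ?C" by (rule left_module.mcar_subgroup[OF U])
  have C0: "0 \<in> ?C" and Cadd: "\<And>x y. x \<in> ?C \<Longrightarrow> y \<in> ?C \<Longrightarrow> x + y \<in> ?C"
    using sub unfolding add_subgroup_def by (auto, metis diff_0 diff_minus_eq_add)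
  have act0: "act U 0 x = 0" if "x \<in> ?C" for x
    using L(2)[of 0 0 x] that by simp
  have actr0: "act U c 0 = 0" for c
    using L(1)[of c 0 0] C0 by simp
  define ev where "ev p = (\<Sum>x | p x \<noteq> 0. act U (p x) x)" for p :: "'u \<Rightarrow> 'k"
  have ev_S: "ev p = (\<Sum>x\<in>S. act U (p x) x)"
    if "finite S" "{x. p x \<noteq> 0} \<subseteq> S" "S \<subseteq> ?C" for p S
    unfolding ev_def by (rule sum.mono_neutral_left) (use that act0 in auto)
  define N where "N = {p :: 'u \<Rightarrow> 'k. finite {x. p x \<noteq> 0} \<and> {x. p x \<noteq> 0} \<subseteq> ?C \<and> ev p = 0}"
  interpret F: vector_space "tscale :: 'k \<Rightarrow> ('u \<Rightarrow> 'k) \<Rightarrow> 'u \<Rightarrow> 'k"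
    by unfold_locales (auto simp: tscale_def fun_eq_iff algebra_simps)
  interpret K: vector_space "(*) :: 'k \<Rightarrow> 'k \<Rightarrow> 'k"
    by unfold_locales (auto simp: algebra_simps)
  interpret FK: vector_space_pair "tscale :: 'k \<Rightarrow> ('u \<Rightarrow> 'k) \<Rightarrow> 'u \<Rightarrow> 'k" "(*) :: 'k \<Rightarrow> 'k \<Rightarrow> 'k" ..
  have ev_add: "ev (p + q) = ev p + ev q"
    if "finite {x. p x \<noteq> 0}" "{x. p x \<noteq> 0} \<subseteq> ?C" "finite {x. q x \<noteq> 0}" "{x. q x \<noteq> 0} \<subseteq> ?C" for p q
  proof -
    let ?S = "{x. p x \<noteq> 0} \<union> {x. q x \<noteq> 0}"
    have S: "finite ?S" "?S \<subseteq> ?C" using that by auto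
    have "ev (p + q) = (\<Sum>x\<in>?S. act U ((p + q) x) x)" by (rule ev_S) (use S in auto)
    also have "\<dots> = (\<Sum>x\<in>?S. act U (p x) x + act U (q x) x)"
      by (rule sum.cong) (use S L(2) in auto)
    also have "\<dots> = ev p + ev q"
      using ev_S[of ?S p] ev_S[of ?S q] S by (simp add: sum.distrib)
    finally show ?thesis .
  qed
  have act_sum: "act U c (\<Sum>x\<in>S. h x) = (\<Sum>x\<in>S. act U c (h x)) \<and> (\<Sum>x\<in>S. h x) \<in> ?C"
    if "finite S" "\<And>x. x \<in> S \<Longrightarrow> h x \<in> ?C" for c S and h :: "'u \<Rightarrow> 'u"
    using that by (induction S rule: finite_induct) (auto simp: actr0 C0 Cadd L(1))
  have ev_scale: "ev (tscale c p) = act U c (ev p)"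
    if "finite {x. p x \<noteq> 0}" "{x. p x \<noteq> 0} \<subseteq> ?C" for c p
  proof -
    let ?S = "{x. p x \<noteq> 0}"
    have "ev (tscale c p) = (\<Sum>x\<in>?S. act U (c * p x) x)"
      using ev_S[of ?S "tscale c p"] that by (auto simp: tscale_def)
    also have "\<dots> = (\<Sum>x\<in>?S. act U c (act U (p x) x))"
      by (rule sum.cong) (use that L(3) in auto)
    also have "\<dots> = act U c (ev p)"
      unfolding ev_def
      by (rule conjunct1[OF act_sum, symmetric]) (use that L(5) in auto)
    finally show ?thesis .
  qed
  have fin: "finite {y. (p + q) y \<noteq> 0} \<and> {y. (p + q) y \<noteq> 0} \<subseteq> ?C"
    if "finite {x. p x \<noteq> 0}" "{x. p x \<noteq> 0} \<subseteq> ?C" "finite {x. q x \<noteq> 0}" "{x. q x \<noteq> 0} \<subseteq> ?C"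
    for p q :: "'u \<Rightarrow> 'k"
  proof -
    have "{y. (p + q) y \<noteq> 0} \<subseteq> {x. p x \<noteq> 0} \<union> {x. q x \<noteq> 0}" by auto
    then show ?thesis using that by (meson finite_UnI finite_subset le_sup_iff subset_trans)
  qed
  have Nsub: "F.subspace N"
  proof (rule F.subspaceI)
    show "0 \<in> N" by (simp add: N_def ev_def)
    show "p + q \<in> N" if "p \<in> N" "q \<in> N" for p q
      using fin[of p q] ev_add[of p q] that unfolding N_def mem_Collect_eq
      by (metis add_0_left)
    show "tscale c p \<in> N" if "p \<in> N" for c p
    proof -
      have "{x. tscale c p x \<noteq> 0} \<subseteq> {x. p x \<noteq> 0}" by (auto simp: tscale_def)
      then show ?thesis
        using ev_scale[of p c] actr0[of c] that unfolding N_def mem_Collect_eq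
        by (metis finite_subset subset_trans)
    qed
  qed
  define \<delta> where "\<delta> x = (\<lambda>y. if y = x then 1 else 0 :: 'k)" for x :: 'u
  have supp\<delta>: "{y. \<delta> x y \<noteq> 0} = {x}" for x by (auto simp: \<delta>_def)
  have ev\<delta>: "ev (\<delta> x) = x" if "x \<in> ?C" for x
    unfolding ev_def supp\<delta> using L(4)[OF that] by (simp add: \<delta>_def)
  obtain B where B: "B \<subseteq> N" "F.independent B" "F.span B = N"
    using F.basis_exists[of N] Nsub by (metis F.span_minimal F.span_mono F.span_eq_iff subset_antisym)
  have "\<delta> u \<notin> F.span B" using B(3) ev\<delta>[OF u(1)] u(2) by (auto simp: N_def)
  then have ind: "F.independent (insert (\<delta> u) B)" and nB: "\<delta> u \<notin> B"
    using B(2) F.span_base by (auto simp: F.independent_insert)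
  define \<Lambda> where "\<Lambda> = FK.construct (insert (\<delta> u) B) (\<lambda>b. if b = \<delta> u then 1 else 0)"
  have lin: "Vector_Spaces.linear tscale (*) \<Lambda>"
    unfolding \<Lambda>_def by (rule FK.linear_construct[OF ind])
  interpret lin: Vector_Spaces.linear tscale "(*)" \<Lambda> by (rule lin)
  have \<Lambda>u: "\<Lambda> (\<delta> u) = 1" unfolding \<Lambda>_def by (simp add: FK.construct_basis[OF ind])
  have \<Lambda>B: "\<Lambda> b = 0" if "b \<in> B" for b
    unfolding \<Lambda>_def using FK.construct_basis[OF ind, of b] that nB by auto
  have \<Lambda>N: "\<Lambda> p = 0" if "p \<in> N" for p
    using lin.eq_0_on_span[of B p] \<Lambda>B that B(3) by auto
  have key: "\<Lambda> p = \<Lambda> (\<delta> (ev p))"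
    if p: "finite {x. p x \<noteq> 0}" "{x. p x \<noteq> 0} \<subseteq> ?C" and e: "ev p \<in> ?C" for p
  proof -
    let ?m = "tscale (- 1) (\<delta> (ev p))"
    have m: "{x. ?m x \<noteq> 0} = {ev p}" by (auto simp: tscale_def \<delta>_def)
    have "ev (p + ?m) = ev p + act U (- 1) (ev p)"
      using ev_add[of p ?m] ev_scale[of "\<delta> (ev p)" "- 1"] p e ev\<delta>[OF e] by (simp add: m supp\<delta>)
    also have "\<dots> = 0"
      using L(2)[of 1 "- 1" "ev p"] L(4)[OF e] act0[OF e] e by simp
    finally have z: "ev (p + ?m) = 0" .
    have m': "finite {x. ?m x \<noteq> 0}" "{x. ?m x \<noteq> 0} \<subseteq> ?C" unfolding m using e by auto
    have "p + ?m \<in> N"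
      using fin[OF p m'] z unfolding N_def mem_Collect_eq by blast
    from \<Lambda>N[OF this] show ?thesis by (simp add: lin.diff)
  qed
  show ?thesis
  proof (rule that[of "\<lambda>x. \<Lambda> (\<delta> x)"])
    fix x y assume xy: "x \<in> ?C" "y \<in> ?C"
    have e: "ev (\<delta> x + \<delta> y) = x + y"
      using ev_add[of "\<delta> x" "\<delta> y"] xy by (simp add: supp\<delta> ev\<delta>)
    have "\<Lambda> (\<delta> x + \<delta> y) = \<Lambda> (\<delta> (x + y))"
      using key[of "\<delta> x + \<delta> y"] fin[of "\<delta> x" "\<delta> y"] xy Cadd by (simp add: supp\<delta> e)
    then show "\<Lambda> (\<delta> (x + y)) = \<Lambda> (\<delta> x) + \<Lambda> (\<delta> y)" by (simp add: lin.add)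
  next
    fix c x assume x: "x \<in> ?C"
    have s: "{y. tscale c (\<delta> x) y \<noteq> 0} \<subseteq> {x}" by (auto simp: tscale_def \<delta>_def)
    have e: "ev (tscale c (\<delta> x)) = act U c x"
      using ev_scale[of "\<delta> x" c] x by (simp add: supp\<delta> ev\<delta>)
    have "\<Lambda> (tscale c (\<delta> x)) = \<Lambda> (\<delta> (act U c x))"
      using key[of "tscale c (\<delta> x)"] finite_subset[OF s] s x L(5)[OF UNIV_I x] by (auto simp: e)
    then show "\<Lambda> (\<delta> (act U c x)) = c * \<Lambda> (\<delta> x)" by (simp add: lin.scale)
  next
    show "\<Lambda> (\<delta> u) \<noteq> 0" by (simp add: \<Lambda>u)
  qed
qed

lemma tsum_eq_imp:
  fixes U :: "('k::field, 'u::ab_group_add) lmod"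
  assumes U: "left_module (univ_ring :: 'k ring) U" and f: "bilinear_map V W U f"
    and xs: "set xs \<subseteq> mcar V \<times> mcar W" and ys: "set ys \<subseteq> mcar V \<times> mcar W"
    and eq: "tsum V W xs = tsum V W ys"
  shows "(\<Sum>(v, w)\<leftarrow>xs. f v w) = (\<Sum>(v, w)\<leftarrow>ys. f v w)"
proof (rule ccontr)
  let ?S = "\<lambda>zs. \<Sum>(v, w)\<leftarrow>zs. f v w"
  assume ne: "?S xs \<noteq> ?S ys"
  have C: "add_subgroup (mcar U)" by (rule left_module.mcar_subgroup[OF U])
  then have C0: "0 \<in> mcar U" and Cd: "\<And>x y. x \<in> mcar U \<Longrightarrow> y \<in> mcar U \<Longrightarrow> x - y \<in> mcar U"
    and Ca: "\<And>x y. x \<in> mcar U \<Longrightarrow> y \<in> mcar U \<Longrightarrow> x + y \<in> mcar U"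
    unfolding add_subgroup_def by (auto, metis diff_0 diff_minus_eq_add)
  have fU: "f v w \<in> mcar U" if "v \<in> mcar V" "w \<in> mcar W" for v w
    using f that by (auto simp: bilinear_map_def)
  have S: "?S zs \<in> mcar U" if "set zs \<subseteq> mcar V \<times> mcar W" for zs
    using that by (induction zs) (auto simp: C0 Ca fU)
  have D: "?S xs - ?S ys \<in> mcar U" using S[OF xs] S[OF ys] by (rule Cd)
  have D0: "?S xs - ?S ys \<noteq> 0" using ne by (simp del: split_paired_All)
  obtain g where g: "\<And>x y. x \<in> mcar U \<Longrightarrow> y \<in> mcar U \<Longrightarrow> g (x + y) = g x + g y"
      "\<And>c x. x \<in> mcar U \<Longrightarrow> g (act U c x) = c * g x" "g (?S xs - ?S ys) \<noteq> 0"
    by (rule separating_functional[OF U D D0]) (rule that)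
  have g0: "g 0 = 0" using g(1)[OF C0 C0, unfolded add_0_left] by (metis add_cancel_right_right)
  define \<beta> where "\<beta> v w = g (f v w)" for v w
  have \<beta>: "bilinear_map V W (full_space (*)) \<beta>"
    using f fU by (simp add: bilinear_map_def \<beta>_def g)
  have app: "tsum V W zs \<beta> = g (?S zs)" if "set zs \<subseteq> mcar V \<times> mcar W" for zs
    using that by (induction zs) (auto simp: tsum_def g0 g(1) fU S tpure_def \<beta> \<beta>_def)
  have "g (?S xs) = g (?S ys)" using app[OF xs] app[OF ys] eq by simp
  moreover have "g (?S xs) = g (?S xs - ?S ys) + g (?S ys)"
    using g(1)[OF D S[OF ys]] by simp
  ultimately show False using g(3) by simp
qed

lemma tensor_lift_tsum:
  fixes U :: "('k::field, 'u::ab_group_add) lmod"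
  assumes U: "left_module (univ_ring :: 'k ring) U" and f: "bilinear_map V W U f"
    and xs: "set xs \<subseteq> mcar V \<times> mcar W"
  shows "tensor_lift V W f (tsum V W xs) = (\<Sum>(v, w)\<leftarrow>xs. f v w)"
proof -
  let ?P = "\<lambda>ys. set ys \<subseteq> mcar V \<times> mcar W \<and> tsum V W xs = tsum V W ys"
  have "?P (SOME ys. ?P ys)" by (rule someI[of ?P xs]) (use xs in auto)
  then show ?thesis
    unfolding tensor_lift_def using tsum_eq_imp[OF U f _ xs, of "SOME ys. ?P ys"] by metis
qed


section \<open>Hopf algebras and their modules\<close>

locale k_algebra = vector_space scale
  for scale :: "'k::field \<Rightarrow> 'a::ring_1 \<Rightarrow> 'a" +
  assumes scale_mult_left: "scale c (x * y) = scale c x * y"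
    and scale_mult_right: "scale c (x * y) = x * scale c y"

record ('k, 'h) hopf_data =
  hscale :: "'k \<Rightarrow> 'h \<Rightarrow> 'h"
  comult :: "'h \<Rightarrow> ('k, 'h, 'h) tensor"
  counit :: "'h \<Rightarrow> 'k"
  antipode :: "'h \<Rightarrow> 'h"

abbreviation hspace :: "('k, 'h) hopf_data \<Rightarrow> ('k, 'h) lmod" where
  "hspace H \<equiv> full_space (hscale H)"

text \<open>The Sweedler sum of the terms \<open>f h\<^sub>1 h\<^sub>2\<close> for bilinear \<open>f\<close>.\<close>

definition sweedler ::
  "('k::field, 'h::ring_1) hopf_data \<Rightarrow> 'h \<Rightarrow> ('h \<Rightarrow> 'h \<Rightarrow> 'u::ab_group_add) \<Rightarrow> 'u" where
  "sweedler H h f = tensor_lift (hspace H) (hspace H) f (comult H h)"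

locale hopf_algebra =
  fixes H :: "('k::field, 'h::ring_1) hopf_data"
  assumes algebra: "k_algebra (hscale H)"
    and comult_tensor: "comult H h \<in> mcar (tensor_space (hspace H) (hspace H))"
    and comult_linear: "Vector_Spaces.linear (hscale H) tscale (comult H)"
    and counit_linear: "Vector_Spaces.linear (hscale H) (*) (counit H)"
    and antipode_linear: "Vector_Spaces.linear (hscale H) (hscale H) (antipode H)"
    and coassoc:
      "sweedler H h (\<lambda>x y. sweedler H y (\<lambda>y\<^sub>1 y\<^sub>2.
         tpure (hspace H) (tensor_space (hspace H) (hspace H)) x (tpure (hspace H) (hspace H) y\<^sub>1 y\<^sub>2)))
     = sweedler H h (\<lambda>x y. sweedler H x (\<lambda>x\<^sub>1 x\<^sub>2.
         tpure (hspace H) (tensor_space (hspace H) (hspace H)) x\<^sub>1 (tpure (hspace H) (hspace H) x\<^sub>2 y)))"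
    and counit_left: "sweedler H h (\<lambda>x y. hscale H (counit H x) y) = h"
    and counit_right: "sweedler H h (\<lambda>x y. hscale H (counit H y) x) = h"
    and comult_one: "comult H 1 = tpure (hspace H) (hspace H) 1 1"
    and comult_mult: "comult H (g * h) =
      sweedler H g (\<lambda>g\<^sub>1 g\<^sub>2. sweedler H h (\<lambda>h\<^sub>1 h\<^sub>2. tpure (hspace H) (hspace H) (g\<^sub>1 * h\<^sub>1) (g\<^sub>2 * h\<^sub>2)))"
    and counit_one: "counit H 1 = 1"
    and counit_mult: "counit H (g * h) = counit H g * counit H h"
    and antipode_left: "sweedler H h (\<lambda>x y. antipode H x * y) = hscale H (counit H h) 1"
    and antipode_right: "sweedler H h (\<lambda>x y. x * antipode H y) = hscale H (counit H h) 1"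

definition regular_module :: "('r::ring_1, 'r) lmod" where
  "regular_module = \<lparr>mcar = UNIV, act = (*)\<rparr>"

definition semisimple_hopf_algebra :: "('k::field, 'h::ring_1) hopf_data \<Rightarrow> bool" where
  "semisimple_hopf_algebra H \<longleftrightarrow>
    hopf_algebra H \<and> semisimple_module univ_ring (regular_module :: ('h, 'h) lmod)"

definition base_space :: "('k, 'h::ring_1) hopf_data \<Rightarrow> ('h, 'v, 'y) lmod_scheme \<Rightarrow> ('k, 'v) lmod" where
  "base_space H M = \<lparr>mcar = mcar M, act = (\<lambda>c. act M (hscale H c 1))\<rparr>"

definition hopf_tensor ::
  "('k::field, 'h::ring_1) hopf_data \<Rightarrow> ('h, 'v::ab_group_add) lmod \<Rightarrow> ('h, 'w::ab_group_add) lmod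
    \<Rightarrow> ('h, ('k, 'v, 'w) tensor) lmod" where
  "hopf_tensor H M N =
    \<lparr>mcar = mcar (tensor_space (base_space H M) (base_space H N)),
     act = (\<lambda>h. tensor_lift (base_space H M) (base_space H N) (\<lambda>m n.
       sweedler H h (\<lambda>h\<^sub>1 h\<^sub>2. tpure (base_space H M) (base_space H N) (act M h\<^sub>1 m) (act N h\<^sub>2 n))))\<rparr>"

text \<open>The trivial module \<open>H / ker \<epsilon>\<close>, realised on the ground field.\<close>

definition trivial_module :: "('k::field, 'h) hopf_data \<Rightarrow> ('h, 'k) lmod" where
  "trivial_module H = \<lparr>mcar = UNIV, act = (\<lambda>h c. counit H h * c)\<rparr>"

text \<open>Every simple \<open>H\<close>-module is a quotient of \<open>H\<close>, so its dimension is at most \<open>dim H\<close> and it has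
  an isomorphic copy whose additive group is a subgroup of \<open>'h\<close>. Hence it suffices to
  let \<open>M\<close> below range over modules inside the type \<open>'h\<close>.\<close>

definition complete_simples ::
  "('k::field, 'h::ring_1) hopf_data \<Rightarrow> nat \<Rightarrow> (nat \<Rightarrow> ('h, 'v::ab_group_add) lmod) \<Rightarrow> bool" where
  "complete_simples H s V \<longleftrightarrow>
    (\<forall>i\<le>s. simple_module univ_ring (V i)) \<and>
    (\<forall>i\<le>s. \<forall>j\<le>s. lmod_iso univ_ring (V i) (V j) \<longrightarrow> i = j) \<and>
    (\<forall>M :: ('h, 'h) lmod. simple_module univ_ring M \<longrightarrow> (\<exists>i\<le>s. lmod_iso univ_ring M (V i))) \<and>
    lmod_iso univ_ring (V 0) (trivial_module H)"


section \<open>Actions on connected graded algebras and smash products\<close>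

record ('k, 'h, 'a) action_data =
  ascale :: "'k \<Rightarrow> 'a \<Rightarrow> 'a"
  apart :: "nat \<Rightarrow> 'a set"
  aact :: "'h \<Rightarrow> 'a \<Rightarrow> 'a"

locale connected_graded_algebra = k_algebra scale
  for scale :: "'k::field \<Rightarrow> 'a::ring_1 \<Rightarrow> 'a" +
  fixes part :: "nat \<Rightarrow> 'a set"
  assumes part_subspace: "subspace (part i)"
    and decomposition: "direct_decomposition UNIV part"
    and connected: "part 0 = range (\<lambda>c. scale c 1)"
    and part_mult: "\<lbrakk>x \<in> part i; y \<in> part j\<rbrakk> \<Longrightarrow> x * y \<in> part (i + j)"

text \<open>No proper subalgebra contains the finite set \<open>X\<close> of elements of degree one.\<close>

definition fin_gen_degree_one :: "('k::field, 'h, 'a::ring_1) action_data \<Rightarrow> bool" where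
  "fin_gen_degree_one A \<longleftrightarrow> (\<exists>X. finite X \<and> X \<subseteq> apart A 1 \<and>
    (\<forall>B. module.subspace (ascale A) B \<and> 1 \<in> B \<and> (\<forall>x\<in>B. \<forall>y\<in>B. x * y \<in> B) \<and> X \<subseteq> B
      \<longrightarrow> B = UNIV))"

locale graded_hopf_action = hopf_algebra H
  for H :: "('k::field, 'h::ring_1) hopf_data" +
  fixes A :: "('k, 'h, 'a::ring_1) action_data"
  assumes graded_algebra: "connected_graded_algebra (ascale A) (apart A)"
    and action_module: "left_module univ_ring \<lparr>mcar = UNIV, act = aact A\<rparr>"
    and action_scale: "aact A (hscale H c 1) a = ascale A c a"
    and action_mult: "aact A h (a * b) = sweedler H h (\<lambda>h\<^sub>1 h\<^sub>2. aact A h\<^sub>1 a * aact A h\<^sub>2 b)"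
    and action_one: "aact A h 1 = ascale A (counit H h) 1"
    and action_graded: "a \<in> apart A i \<Longrightarrow> aact A h a \<in> apart A i"

abbreviation aspace :: "('k, 'h, 'a) action_data \<Rightarrow> ('k, 'a) lmod" where
  "aspace A \<equiv> full_space (ascale A)"

definition degree_one_module :: "('k, 'h, 'a) action_data \<Rightarrow> ('h, 'a) lmod" where
  "degree_one_module A = \<lparr>mcar = apart A 1, act = aact A\<rparr>"

definition smash_mult ::
  "('k::field, 'h::ring_1) hopf_data \<Rightarrow> ('k, 'h, 'a::ring_1) action_data
    \<Rightarrow> ('k, 'a, 'h) tensor \<Rightarrow> ('k, 'a, 'h) tensor \<Rightarrow> ('k, 'a, 'h) tensor" where
  "smash_mult H A z z' =
    tensor_lift (aspace A) (hspace H) (\<lambda>a h.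
      tensor_lift (aspace A) (hspace H) (\<lambda>a' h'.
        sweedler H h (\<lambda>h\<^sub>1 h\<^sub>2. tpure (aspace A) (hspace H) (a * aact A h\<^sub>1 a') (h\<^sub>2 * h'))) z') z"

definition smash ::
  "('k::field, 'h::ring_1) hopf_data \<Rightarrow> ('k, 'h, 'a::ring_1) action_data
    \<Rightarrow> ('k, 'a, 'h) tensor gring" where
  "smash H A =
    \<lparr>carrier = mcar (tensor_space (aspace A) (hspace H)),
     mult = smash_mult H A, one = tpure (aspace A) (hspace H) 1 1, zero = 0, add = (+),
     rpart = (\<lambda>i. tspan (aspace A) (hspace H) (apart A i) UNIV)\<rparr>"

definition proj_module ::
  "('k::field, 'h::ring_1) hopf_data \<Rightarrow> ('k, 'h, 'a::ring_1) action_data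
    \<Rightarrow> ('h, 'v::ab_group_add) lmod \<Rightarrow> (('k, 'a, 'h) tensor, ('k, 'a, 'v) tensor) glmod" where
  "proj_module H A V =
    \<lparr>mcar = mcar (tensor_space (aspace A) (base_space H V)),
     act = (\<lambda>z t. tensor_lift (aspace A) (hspace H) (\<lambda>x h.
       tensor_lift (aspace A) (base_space H V) (\<lambda>a v.
         sweedler H h (\<lambda>h\<^sub>1 h\<^sub>2.
           tpure (aspace A) (base_space H V) (x * aact A h\<^sub>1 a) (act V h\<^sub>2 v))) t) z),
     mpart = (\<lambda>i. if 0 \<le> i then tspan (aspace A) (base_space H V) (apart A (nat i)) (mcar V)
       else {0})\<rparr>"

text \<open>The projection of \<open>A\<close> onto \<open>A\<^sub>0\<close>, with \<open>A\<^sub>0\<close> identified with the ground field.\<close>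

definition augmentation :: "('k, 'h, 'a::ring_1) action_data \<Rightarrow> 'a \<Rightarrow> 'k" where
  "augmentation A a =
    (THE c. \<exists>f n. (\<forall>i. f i \<in> apart A i) \<and> a = ascale A c 1 + (\<Sum>i=1..n. f i))"

definition smash_proj ::
  "('k::field, 'h::ring_1) hopf_data \<Rightarrow> ('k, 'h, 'a::ring_1) action_data
    \<Rightarrow> ('k, 'a, 'h) tensor \<Rightarrow> 'h" where
  "smash_proj H A = tensor_lift (aspace A) (hspace H) (\<lambda>a h. hscale H (augmentation A a) h)"

definition inflated_module ::
  "('k::field, 'h::ring_1) hopf_data \<Rightarrow> ('k, 'h, 'a::ring_1) action_data
    \<Rightarrow> ('h, 'v::ab_group_add) lmod \<Rightarrow> (('k, 'a, 'h) tensor, 'v) glmod" where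
  "inflated_module H A V =
    \<lparr>mcar = mcar V, act = (\<lambda>z. act V (smash_proj H A z)),
     mpart = (\<lambda>i. if i = 0 then mcar V else {0})\<rparr>"


section \<open>The two quivers\<close>

definition quiver :: "nat \<Rightarrow> (nat \<Rightarrow> 'x) \<Rightarrow> (nat \<Rightarrow> nat \<Rightarrow> nat) \<Rightarrow> ('x, nat \<times> nat \<times> nat) pre_digraph" where
  "quiver s X m =
    \<lparr>verts = X ` {..s}, arcs = {(i, j, l). i \<le> s \<and> j \<le> s \<and> l < m i j},
     tail = (\<lambda>(i, j, l). X i), head = (\<lambda>(i, j, l). X j)\<rparr>"

definition gabriel_quiver ::
  "('k::field, 'h::ring_1) hopf_data \<Rightarrow> ('k, 'h, 'a::ring_1) action_data \<Rightarrow> nat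
    \<Rightarrow> (nat \<Rightarrow> ('h, 'v::ab_group_add) lmod)
    \<Rightarrow> (nat \<Rightarrow> nat \<Rightarrow> (('k, 'a, 'h) tensor, 'q::ab_group_add) glmod)
    \<Rightarrow> ((('k, 'a, 'h) tensor, ('k, 'a, 'v) tensor) glmod, nat \<times> nat \<times> nat) pre_digraph" where
  "gabriel_quiver H A s V Q = quiver s (\<lambda>i. proj_module H A (V i))
    (\<lambda>i j. summand_multiplicity (smash H A) (shift (proj_module H A (V i)) (- 1)) (Q j 1))"

definition decomposition_multiplicities ::
  "nat \<Rightarrow> (nat \<Rightarrow> ('h::ring_1, 'v::ab_group_add) lmod) \<Rightarrow> ('h, 'm::ab_group_add) lmod \<Rightarrow> nat \<Rightarrow> nat" where
  "decomposition_multiplicities s V M =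
    (SOME n. lmod_iso univ_ring M (lmod_dsum {(i, l). i \<le> s \<and> l < n i} (\<lambda>(i, l). V i)))"

definition mckay_quiver ::
  "('k::field, 'h::ring_1) hopf_data \<Rightarrow> ('h, 'w::ab_group_add) lmod \<Rightarrow> nat
    \<Rightarrow> (nat \<Rightarrow> ('h, 'v::ab_group_add) lmod) \<Rightarrow> (('h, 'v) lmod, nat \<times> nat \<times> nat) pre_digraph" where
  "mckay_quiver H W s V = quiver s V
    (\<lambda>i j. decomposition_multiplicities s V (hopf_tensor H W (V j)) i)"

end

theory Submission
  imports Defs
begin

text \<open>Write \<open>S = A # H\<close>. For an \<open>H\<close>-module \<open>U\<close>, the \<open>S\<close>-linear maps \<open>A \<otimes> U \<rightarrow> M\<close> raising degrees by \<open>n\<close> are the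
  \<open>H\<close>-linear maps \<open>U \<rightarrow> M\<^sub>n\<close>. Hence a graded projective module \<open>Q\<close> generated in degree \<open>n\<close> is
  \<open>A \<otimes> Q\<^sub>n\<close> shifted by \<open>n\<close>. Minimality forces the resolution of \<open>V\<^sub>j\<close> to start with \<open>A \<otimes> V\<^sub>j\<close>. As \<open>A\<close> is
  generated in degree one, the kernel of the augmentation is generated by its degree one part
  \<open>W \<otimes> V\<^sub>j\<close>, so the next term is \<open>A \<otimes> (W \<otimes> V\<^sub>j)\<close> shifted by one. Decomposing \<open>W \<otimes> V\<^sub>j\<close> into simple modules
  turns this into the sum of the \<open>P\<^sub>i[-1]\<close> with the McKay multiplicities, and these are recovered by
  counting simple modules in the lowest degree. The decomposition is finite because a normalized
  integral of \<open>H\<close> makes \<open>H\<close> finite-dimensional.\<close>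

text \<open>Three obstacles shape the proof. The modules to be decomposed have carriers of arbitrary
  types, whereas \<open>complete_simples\<close> classifies simple modules carried by the type of
  \<open>H\<close>. Simple left ideals bridge the gap: a module is explored through the orbits
  \<open>L x\<close> of simple left ideals \<open>L\<close>, and \<open>socle_ring\<close> says that
  there are enough of them. It is exploited by exhibiting a graded submodule that meets every coset
  of the kernel, and it turns into injectivity in the generating degree because
  \<open>H\<close>-submodules have complements. Last, the number of arrows in the Gabriel quiver is
  a greatest \<open>m\<close>, so besides a summand an upper bound is required. A summand yields an
  embedding of the \<open>m\<close>-th power of \<open>V i\<close> into a sum of simple modules;
  powers of \<open>V i\<close> are compared by the leading positions of their vectors, without
  endomorphism rings or dimensions.\<close>

text \<open>Tensors are functions; the simplifier would turn \<open>s + t\<close> and \<open>0\<close> into abstractions.\<close>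

declare plus_fun_apply [simp del] zero_fun_apply [simp del]

section \<open>Subgroups, additive maps and modules\<close>

lemma
  assumes "add_subgroup S"
  shows add_subgroup_zero: "0 \<in> S"
    and add_subgroup_diff: "x \<in> S \<Longrightarrow> y \<in> S \<Longrightarrow> x - y \<in> S"
    and add_subgroup_minus: "x \<in> S \<Longrightarrow> - x \<in> S"
    and add_subgroup_add: "x \<in> S \<Longrightarrow> y \<in> S \<Longrightarrow> x + y \<in> S"
proof -
  have z: "0 \<in> S" and d: "\<And>x y. x \<in> S \<Longrightarrow> y \<in> S \<Longrightarrow> x - y \<in> S"
    using assms by (auto simp: add_subgroup_def)
  show "0 \<in> S" by (rule z)
  show "x \<in> S \<Longrightarrow> y \<in> S \<Longrightarrow> x - y \<in> S" by (rule d)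
  show m: "x \<in> S \<Longrightarrow> - x \<in> S" for x using d[OF z, of x] by simp
  show "x \<in> S \<Longrightarrow> y \<in> S \<Longrightarrow> x + y \<in> S" using d[OF _ m, of x y] by simp
qed

lemma add_subgroupI:
  assumes "0 \<in> S" "\<And>x y. x \<in> S \<Longrightarrow> y \<in> S \<Longrightarrow> x + y \<in> S" "\<And>x. x \<in> S \<Longrightarrow> - x \<in> S"
  shows "add_subgroup S"
  unfolding add_subgroup_def diff_conv_add_uminus using assms by blast

lemma add_subgroup_sum:
  "add_subgroup S \<Longrightarrow> (\<And>i. i \<in> I \<Longrightarrow> f i \<in> S) \<Longrightarrow> sum f I \<in> S"
  by (induction I rule: infinite_finite_induct) (auto simp: add_subgroup_zero add_subgroup_add)

lemma add_subgroup_sum_list: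
  "add_subgroup S \<Longrightarrow> (\<And>x. x \<in> set xs \<Longrightarrow> f x \<in> S) \<Longrightarrow> (\<Sum>x\<leftarrow>xs. f x) \<in> S"
  by (induction xs) (auto simp: add_subgroup_zero add_subgroup_add)

lemma add_subgroup_UNIV: "add_subgroup UNIV"
  and add_subgroup_singleton: "add_subgroup {0}"
  by (simp_all add: add_subgroup_def)

lemma add_subgroup_Int: "add_subgroup S \<Longrightarrow> add_subgroup T \<Longrightarrow> add_subgroup (S \<inter> T)"
  by (simp add: add_subgroup_def)

text \<open>Tensor lifts and module maps are total functions whose values are controlled on a
  carrier alone, hence the relativization to \<open>C\<close>.\<close>

definition additive_on :: "'a::ab_group_add set \<Rightarrow> ('a \<Rightarrow> 'b::ab_group_add) \<Rightarrow> bool" where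
  "additive_on C g \<longleftrightarrow> (\<forall>x\<in>C. \<forall>y\<in>C. g (x + y) = g x + g y)"

lemma additive_onD: "additive_on C g \<Longrightarrow> x \<in> C \<Longrightarrow> y \<in> C \<Longrightarrow> g (x + y) = g x + g y"
  by (simp add: additive_on_def)

lemma additive_on_subset: "additive_on C g \<Longrightarrow> B \<subseteq> C \<Longrightarrow> additive_on B g"
  unfolding additive_on_def by blast

lemma
  assumes "additive_on C g" and C: "add_subgroup C"
  shows additive_on_zero: "g 0 = 0"
    and additive_on_minus: "x \<in> C \<Longrightarrow> g (- x) = - g x"
    and additive_on_diff: "x \<in> C \<Longrightarrow> y \<in> C \<Longrightarrow> g (x - y) = g x - g y"
    and additive_on_sum: "(\<And>i. i \<in> I \<Longrightarrow> f i \<in> C) \<Longrightarrow> g (sum f I) = (\<Sum>i\<in>I. g (f i))"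
    and additive_on_sum_list: "(\<And>z. z \<in> set zs \<Longrightarrow> h z \<in> C) \<Longrightarrow> g (\<Sum>z\<leftarrow>zs. h z) = (\<Sum>z\<leftarrow>zs. g (h z))"
proof -
  note D = additive_onD[OF assms(1)]
  have "g (0 + 0) = g 0 + g 0" by (rule D) (use C in \<open>simp_all add: add_subgroup_zero\<close>)
  then show z: "g 0 = 0" by simp
  have m: "g (- x) = - g x" if "x \<in> C" for x
  proof -
    have "g (x + - x) = g x + g (- x)" by (rule D) (use C that in \<open>simp_all add: add_subgroup_minus\<close>)
    then show ?thesis using z by (simp add: eq_neg_iff_add_eq_0 add.commute)
  qed
  then show "x \<in> C \<Longrightarrow> g (- x) = - g x" .
  show "g (x - y) = g x - g y" if "x \<in> C" "y \<in> C"
    using D[of x "- y"] m[of y] that C by (simp add: add_subgroup_minus)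
  show "(\<And>i. i \<in> I \<Longrightarrow> f i \<in> C) \<Longrightarrow> g (sum f I) = (\<Sum>i\<in>I. g (f i))"
    by (induction I rule: infinite_finite_induct) (auto simp: z D add_subgroup_sum[OF C])
  show "(\<And>z. z \<in> set zs \<Longrightarrow> h z \<in> C) \<Longrightarrow> g (\<Sum>z\<leftarrow>zs. h z) = (\<Sum>z\<leftarrow>zs. g (h z))"
    by (induction zs) (auto simp: z D add_subgroup_sum_list[OF C])
qed

lemma add_subgroup_image:
  assumes "additive_on C g" "add_subgroup C"
  shows "add_subgroup (g ` C)"
proof (rule add_subgroupI)
  show "0 \<in> g ` C" using additive_on_zero[OF assms] add_subgroup_zero[OF assms(2)] by force
  show "x + y \<in> g ` C" if "x \<in> g ` C" "y \<in> g ` C" for x y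
    using that additive_onD[OF assms(1), symmetric] add_subgroup_add[OF assms(2)] by auto
  show "- x \<in> g ` C" if "x \<in> g ` C" for x
    using that additive_on_minus[OF assms, symmetric] add_subgroup_minus[OF assms(2)] by auto
qed

text \<open>Turns a property that says where an additive expression in \<open>x\<close> lies into a
  subgroup, so that it can be checked on generators.\<close>

lemma add_subgroup_vimage:
  assumes "additive_on UNIV g" "add_subgroup X"
  shows "add_subgroup {x. g x \<in> X}"
proof (rule add_subgroupI)
  note g = assms(1) and X = assms(2)
  show "0 \<in> {x. g x \<in> X}"
    using additive_on_zero[OF g add_subgroup_UNIV] add_subgroup_zero[OF X] by simp
  show "x + y \<in> {x. g x \<in> X}" if "x \<in> {x. g x \<in> X}" "y \<in> {x. g x \<in> X}" for x y
    using additive_onD[OF g, of x y] add_subgroup_add[OF X, of "g x" "g y"] that by simp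
  show "- x \<in> {x. g x \<in> X}" if "x \<in> {x. g x \<in> X}" for x
    using additive_on_minus[OF g add_subgroup_UNIV, of x] add_subgroup_minus[OF X, of "g x"] that by simp
qed

section \<open>Modules and their homomorphisms\<close>

lemma univ_ring_simps [simp]:
  "carrier univ_ring = UNIV" "mult univ_ring = (*)" "one univ_ring = 1" "zero univ_ring = 0"
  "add univ_ring = (+)"
  by (simp_all add: univ_ring_def)

context left_module
begin

lemma mcar_zero: "0 \<in> mcar M"
  and mcar_add: "x \<in> mcar M \<Longrightarrow> y \<in> mcar M \<Longrightarrow> x + y \<in> mcar M"
  and mcar_minus: "x \<in> mcar M \<Longrightarrow> - x \<in> mcar M"
  and mcar_diff: "x \<in> mcar M \<Longrightarrow> y \<in> mcar M \<Longrightarrow> x - y \<in> mcar M"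
  using mcar_subgroup
  by (simp_all add: add_subgroup_zero add_subgroup_add add_subgroup_minus add_subgroup_diff)

lemma act_additive: "r \<in> carrier R \<Longrightarrow> additive_on (mcar M) (act M r)"
  by (simp add: additive_on_def act_add_right)

lemma act_zero_right: "r \<in> carrier R \<Longrightarrow> act M r 0 = 0"
  and act_diff_right:
    "r \<in> carrier R \<Longrightarrow> x \<in> mcar M \<Longrightarrow> y \<in> mcar M \<Longrightarrow> act M r (x - y) = act M r x - act M r y"
  using act_additive[of r] mcar_subgroup
  by (simp_all add: additive_on_zero additive_on_diff)

end

lemmas mod_closed = left_module.act_closed
lemmas mod_add_right = left_module.act_add_right
lemmas mod_add_left = left_module.act_add_left
lemmas mod_mult = left_module.act_mult
lemmas mod_one = left_module.act_one
lemmas mod_subgroup = left_module.mcar_subgroup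

lemma submoduleD:
  assumes "submodule R M X"
  shows "X \<subseteq> mcar M" "add_subgroup X" "\<And>r x. r \<in> carrier R \<Longrightarrow> x \<in> X \<Longrightarrow> act M r x \<in> X"
  using assms by (auto simp: submodule_def)

lemma lmod_homD:
  assumes "lmod_hom R M N f"
  shows "\<And>x. x \<in> mcar M \<Longrightarrow> f x \<in> mcar N"
    and "\<And>x y. x \<in> mcar M \<Longrightarrow> y \<in> mcar M \<Longrightarrow> f (x + y) = f x + f y"
    and "\<And>r x. r \<in> carrier R \<Longrightarrow> x \<in> mcar M \<Longrightarrow> f (act M r x) = act N r (f x)"
    and "additive_on (mcar M) f"
  using assms by (auto simp: lmod_hom_def additive_on_def)

lemma lmod_homI:
  assumes "\<And>x. x \<in> mcar M \<Longrightarrow> f x \<in> mcar N"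
    and "\<And>x y. x \<in> mcar M \<Longrightarrow> y \<in> mcar M \<Longrightarrow> f (x + y) = f x + f y"
    and "\<And>r x. r \<in> carrier R \<Longrightarrow> x \<in> mcar M \<Longrightarrow> f (act M r x) = act N r (f x)"
  shows "lmod_hom R M N f"
  using assms by (auto simp: lmod_hom_def)

lemma lmod_hom_comp: "lmod_hom R M N f \<Longrightarrow> lmod_hom R N L g \<Longrightarrow> lmod_hom R M L (\<lambda>x. g (f x))"
  by (simp add: lmod_hom_def)

text \<open>\<open>M\<close> is assumed closed rather than to be a module because
  \<open>lmod_iso_sym\<close> is applied to \<open>hopf_tensor\<close>, for which exactly these two
  closure properties are available (\<open>hopf_tensor_subgroup\<close>,
  \<open>hopf_tensor_closed\<close>).\<close>

lemma lmod_hom_inv: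
  assumes M: "add_subgroup (mcar M)" "\<And>r x. r \<in> carrier R \<Longrightarrow> x \<in> mcar M \<Longrightarrow> act M r x \<in> mcar M"
    and f: "lmod_hom R M N f" and bij: "bij_betw f (mcar M) (mcar N)"
  shows "lmod_hom R N M (the_inv_into (mcar M) f)" (is "lmod_hom R N M ?g")
proof (rule lmod_homI)
  have inj: "inj_on f (mcar M)" and im: "f ` mcar M = mcar N"
    using bij by (auto simp: bij_betw_def)
  have inv: "?g (f x) = x" if "x \<in> mcar M" for x by (rule the_inv_into_f_f[OF inj that])
  show "?g y \<in> mcar M" if "y \<in> mcar N" for y
    using that inv unfolding im[symmetric] by auto
  show "?g (x + y) = ?g x + ?g y" if xy: "x \<in> mcar N" "y \<in> mcar N" for x y
  proof -
    obtain x' y' where x: "x' \<in> mcar M" "x = f x'" and y: "y' \<in> mcar M" "y = f y'"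
      using xy unfolding im[symmetric] by blast
    have "?g (x + y) = ?g (f (x' + y'))" using lmod_homD(2)[OF f x(1) y(1)] x y by simp
    also have "\<dots> = x' + y'" by (rule inv) (rule add_subgroup_add[OF M(1) x(1) y(1)])
    finally show ?thesis using x y inv by simp
  qed
  show "?g (act N r y) = act M r (?g y)" if r: "r \<in> carrier R" and y': "y \<in> mcar N" for r y
  proof -
    obtain y' where y: "y' \<in> mcar M" "y = f y'" using y' unfolding im[symmetric] by blast
    have "?g (act N r y) = ?g (f (act M r y'))" using lmod_homD(3)[OF f r y(1)] y by simp
    also have "\<dots> = act M r y'" by (rule inv) (rule M(2)[OF r y(1)])
    finally show ?thesis using y inv by simp
  qed
qed

lemma lmod_iso_sym:
  assumes M: "add_subgroup (mcar M)" "\<And>r x. r \<in> carrier R \<Longrightarrow> x \<in> mcar M \<Longrightarrow> act M r x \<in> mcar M"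
    and "lmod_iso R M N"
  shows "lmod_iso R N M"
proof -
  obtain f where "lmod_hom R M N f" "bij_betw f (mcar M) (mcar N)"
    using assms(3) by (auto simp: lmod_iso_def)
  then show ?thesis
    unfolding lmod_iso_def using lmod_hom_inv[OF M] bij_betw_the_inv_into by blast
qed

lemma lmod_iso_trans:
  assumes "lmod_iso R M N" "lmod_iso R N L"
  shows "lmod_iso R M L"
proof -
  obtain f g where "lmod_hom R M N f" "bij_betw f (mcar M) (mcar N)"
    "lmod_hom R N L g" "bij_betw g (mcar N) (mcar L)"
    using assms by (auto simp: lmod_iso_def)
  then have "lmod_hom R M L (\<lambda>x. g (f x))" "bij_betw (g \<circ> f) (mcar M) (mcar L)"
    by (auto intro: lmod_hom_comp bij_betw_trans)
  then show ?thesis by (auto simp: lmod_iso_def comp_def)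
qed

lemma inj_on_additive:
  assumes g: "additive_on C g" "add_subgroup C" and "\<And>x. x \<in> C \<Longrightarrow> g x = 0 \<Longrightarrow> x = 0"
  shows "inj_on g C"
proof (rule inj_onI)
  fix x y assume xy: "x \<in> C" "y \<in> C" "g x = g y"
  have "g (x - y) = 0" using additive_on_diff[OF g xy(1,2)] xy(3) by simp
  then have "x - y = 0" using assms(3) add_subgroup_diff[OF g(2) xy(1,2)] by blast
  then show "x = y" by simp
qed


section \<open>Tensor products\<close>

lemma bilinear_mapI:
  assumes "\<And>v w. v \<in> mcar V \<Longrightarrow> w \<in> mcar W \<Longrightarrow> f v w \<in> mcar U"
    and "\<And>v v' w. v \<in> mcar V \<Longrightarrow> v' \<in> mcar V \<Longrightarrow> w \<in> mcar W \<Longrightarrow> f (v + v') w = f v w + f v' w"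
    and "\<And>v w w'. v \<in> mcar V \<Longrightarrow> w \<in> mcar W \<Longrightarrow> w' \<in> mcar W \<Longrightarrow> f v (w + w') = f v w + f v w'"
    and "\<And>c v w. v \<in> mcar V \<Longrightarrow> w \<in> mcar W \<Longrightarrow> f (act V c v) w = act U c (f v w)"
    and "\<And>c v w. v \<in> mcar V \<Longrightarrow> w \<in> mcar W \<Longrightarrow> f v (act W c w) = act U c (f v w)"
  shows "bilinear_map V W U f"
  using assms by (simp add: bilinear_map_def)

lemma bilinear_mapD:
  assumes "bilinear_map V W U f"
  shows "\<And>v w. v \<in> mcar V \<Longrightarrow> w \<in> mcar W \<Longrightarrow> f v w \<in> mcar U"
    and "\<And>v v' w. v \<in> mcar V \<Longrightarrow> v' \<in> mcar V \<Longrightarrow> w \<in> mcar W \<Longrightarrow> f (v + v') w = f v w + f v' w"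
    and "\<And>v w w'. v \<in> mcar V \<Longrightarrow> w \<in> mcar W \<Longrightarrow> w' \<in> mcar W \<Longrightarrow> f v (w + w') = f v w + f v w'"
    and "\<And>c v w. v \<in> mcar V \<Longrightarrow> w \<in> mcar W \<Longrightarrow> f (act V c v) w = act U c (f v w)"
    and "\<And>c v w. v \<in> mcar V \<Longrightarrow> w \<in> mcar W \<Longrightarrow> f v (act W c w) = act U c (f v w)"
  using assms by (simp_all add: bilinear_map_def)

lemma
  shows tpure_add_left: "v \<in> mcar V \<Longrightarrow> v' \<in> mcar V \<Longrightarrow> w \<in> mcar W \<Longrightarrow>
      tpure V W (v + v') w = tpure V W v w + tpure V W v' w"
    and tpure_add_right: "v \<in> mcar V \<Longrightarrow> w \<in> mcar W \<Longrightarrow> w' \<in> mcar W \<Longrightarrow>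
      tpure V W v (w + w') = tpure V W v w + tpure V W v w'"
    and tpure_scale_left: "v \<in> mcar V \<Longrightarrow> w \<in> mcar W \<Longrightarrow>
      tpure V W (act V c v) w = tscale c (tpure V W v w)"
    and tpure_scale_right: "v \<in> mcar V \<Longrightarrow> w \<in> mcar W \<Longrightarrow>
      tpure V W v (act W c w) = tscale c (tpure V W v w)"
  using bilinear_mapD(2-5)[OF bilinear_tpure[of V W]] by (simp_all add: tensor_space_def)

lemma tscale_simps:
  "tscale c (s + t) = tscale c s + tscale c t" "tscale (b + c) t = tscale b t + tscale c t"
  "tscale b (tscale c t) = tscale (b * c) t" "tscale 1 t = t" "tscale c 0 = 0" "tscale (- 1) t = - t"
  by (auto simp: tscale_def fun_eq_iff algebra_simps plus_fun_apply zero_fun_apply)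

lemma tspan_zero: "0 \<in> tspan V W X Y"
  unfolding tspan_def by (auto intro: exI[of _ "[]"] simp: tsum_def)

lemma tspan_pure: "v \<in> X \<Longrightarrow> w \<in> Y \<Longrightarrow> tpure V W v w \<in> tspan V W X Y"
  unfolding tspan_def by (auto intro!: exI[of _ "[(v, w)]"] simp: tsum_def)

lemma tsum_append: "tsum V W (xs @ ys) = tsum V W xs + tsum V W ys"
  by (simp add: tsum_def)

lemma tsum_Cons: "tsum V W ((v, w) # ys) = tpure V W v w + tsum V W ys"
  by (simp add: tsum_def)

lemma tspan_add: "s \<in> tspan V W X Y \<Longrightarrow> t \<in> tspan V W X Y \<Longrightarrow> s + t \<in> tspan V W X Y"
  unfolding tspan_def
proof clarify
  fix xs ys assume "set xs \<subseteq> X \<times> Y" "set ys \<subseteq> X \<times> Y"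
  then show "\<exists>zs. tsum V W xs + tsum V W ys = tsum V W zs \<and> set zs \<subseteq> X \<times> Y"
    by (intro exI[of _ "xs @ ys"]) (simp add: tsum_append)
qed

lemma tspan_mono: "X \<subseteq> X' \<Longrightarrow> Y \<subseteq> Y' \<Longrightarrow> tspan V W X Y \<subseteq> tspan V W X' Y'"
  unfolding tspan_def by blast

lemma tspan_induct [consumes 1, case_names zero add]:
  assumes "t \<in> tspan V W X Y" and z: "P 0"
    and s: "\<And>v w t. v \<in> X \<Longrightarrow> w \<in> Y \<Longrightarrow> t \<in> tspan V W X Y \<Longrightarrow> P t \<Longrightarrow> P (tpure V W v w + t)"
  shows "P t"
proof -
  have "P (tsum V W xs)" if "set xs \<subseteq> X \<times> Y" for xs
    using that
  proof (induction xs)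
    case Nil
    have "tsum V W [] = 0" by (simp add: tsum_def)
    then show ?case using z by simp
  next
    case (Cons p xs)
    then show ?case
      by (cases p) (auto simp: tsum_Cons tspan_def intro!: s)
  qed
  then show ?thesis using assms(1) by (auto simp: tspan_def)
qed

text \<open>Scalars are absorbed by the left factors, which is why stability is asked of
  \<open>X\<close> and not of \<open>Y\<close>. In particular negation, being scaling by -1, stays
  inside the span.\<close>

lemma tspan_scale:
  assumes "t \<in> tspan V W X Y" "X \<subseteq> mcar V" "Y \<subseteq> mcar W" "\<And>x. x \<in> X \<Longrightarrow> act V c x \<in> X"
  shows "tscale c t \<in> tspan V W X Y"
  using assms(1)
proof (induction rule: tspan_induct)
  case zero
  then show ?case by (simp add: tscale_simps tspan_zero)
next
  case (add v w t)
  have "tscale c (tpure V W v w) = tpure V W (act V c v) w"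
    using add(1,2) assms(2,3) by (intro tpure_scale_left[symmetric]) auto
  then show ?case
    using add by (simp add: tscale_simps tspan_add tspan_pure assms(4))
qed

lemma tspan_subgroup:
  assumes "X \<subseteq> mcar V" "Y \<subseteq> mcar W" "\<And>c x. x \<in> X \<Longrightarrow> act V c x \<in> X"
  shows "add_subgroup (tspan V W X Y)"
proof (rule add_subgroupI[OF tspan_zero tspan_add])
  show "- t \<in> tspan V W X Y" if "t \<in> tspan V W X Y" for t
    using tspan_scale[OF that assms(1,2), of "- 1"] assms(3) by (simp add: tscale_simps)
qed

lemma tensor_space_simps [simp]:
  "mcar (tensor_space V W) = tspan V W (mcar V) (mcar W)" "act (tensor_space V W) = tscale"
  by (simp_all add: tensor_space_def)

lemma tensor_space_module:
  fixes V :: "('k::field, 'v::ab_group_add) lmod" and W :: "('k, 'w::ab_group_add) lmod"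
  assumes V: "left_module univ_ring V"
  shows "left_module (univ_ring :: 'k ring) (tensor_space V W)"
proof -
  have "act V c x \<in> mcar V" if "x \<in> mcar V" for c x using mod_closed[OF V _ that] by simp
  then show ?thesis
    by unfold_locales (auto simp: tscale_simps intro: tspan_subgroup tspan_scale)
qed

text \<open>By definition \<open>tensor_lift\<close> sums over one fixed representation of the tensor, so statements about
  its dependence on the function need no bilinearity.\<close>

definition tensor_rep ::
  "('k::field, 'v::ab_group_add) lmod \<Rightarrow> ('k, 'w::ab_group_add) lmod \<Rightarrow> ('k, 'v, 'w) tensor \<Rightarrow> ('v \<times> 'w) list"
  where "tensor_rep V W t = (SOME xs. set xs \<subseteq> mcar V \<times> mcar W \<and> t = tsum V W xs)"

lemma tensor_rep:
  assumes "t \<in> tspan V W (mcar V) (mcar W)"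
  shows "set (tensor_rep V W t) \<subseteq> mcar V \<times> mcar W" "tsum V W (tensor_rep V W t) = t"
proof -
  have "\<exists>xs. set xs \<subseteq> mcar V \<times> mcar W \<and> t = tsum V W xs"
    using assms by (auto simp: tspan_def)
  from someI_ex[OF this]
  show "set (tensor_rep V W t) \<subseteq> mcar V \<times> mcar W" "tsum V W (tensor_rep V W t) = t"
    unfolding tensor_rep_def by metis+
qed

lemma tensor_lift_rep: "tensor_lift V W f t = (\<Sum>(v, w)\<leftarrow>tensor_rep V W t. f v w)"
  by (simp add: tensor_lift_def tensor_rep_def)

lemma tensor_lift_cong:
  assumes "t \<in> tspan V W (mcar V) (mcar W)"
    and "\<And>v w. v \<in> mcar V \<Longrightarrow> w \<in> mcar W \<Longrightarrow> f v w = g v w"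
  shows "tensor_lift V W f t = tensor_lift V W g t"
  unfolding tensor_lift_rep
  by (rule arg_cong[of _ _ sum_list], rule map_cong[OF refl])
    (use tensor_rep(1)[OF assms(1)] assms(2) in auto)

lemma tensor_lift_additive:
  assumes "additive_on C g" "add_subgroup C" "t \<in> tspan V W (mcar V) (mcar W)"
    and "\<And>v w. v \<in> mcar V \<Longrightarrow> w \<in> mcar W \<Longrightarrow> f v w \<in> C"
  shows "g (tensor_lift V W f t) = tensor_lift V W (\<lambda>v w. g (f v w)) t"
  unfolding tensor_lift_rep
  by (subst additive_on_sum_list[OF assms(1,2)])
    (use tensor_rep(1)[OF assms(3)] assms(4) in \<open>auto simp: case_prod_unfold\<close>)

lemma tensor_lift_fun_add:
  "tensor_lift V W (\<lambda>v w. f v w + g v w) t = tensor_lift V W f t + tensor_lift V W g t"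
  by (simp add: tensor_lift_rep case_prod_unfold sum_list_addf)

lemma tensor_lift_fun_closed:
  assumes "add_subgroup C" "t \<in> tspan V W (mcar V) (mcar W)"
    and "\<And>v w. v \<in> mcar V \<Longrightarrow> w \<in> mcar W \<Longrightarrow> f v w \<in> C"
  shows "tensor_lift V W f t \<in> C"
  unfolding tensor_lift_rep
  by (rule add_subgroup_sum_list[OF assms(1)]) (use tensor_rep(1)[OF assms(2)] assms(3) in auto)

lemma sum_list_swap:
  "(\<Sum>x\<leftarrow>xs. \<Sum>y\<leftarrow>ys. f x y) = (\<Sum>y\<leftarrow>ys. \<Sum>x\<leftarrow>xs. f x y :: 'a::ab_group_add)"
  by (induction xs) (simp_all add: sum_list_addf)

lemma tensor_lift_swap:
  "tensor_lift V W (\<lambda>v w. tensor_lift V' W' (\<lambda>v' w'. f v w v' w') t') t =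
   tensor_lift V' W' (\<lambda>v' w'. tensor_lift V W (\<lambda>v w. f v w v' w') t) t'"
  unfolding tensor_lift_rep case_prod_unfold by (rule sum_list_swap)

section \<open>Dependence of \<open>tensor_lift\<close> on the tensor, where bilinearity
  enters\<close>

context
  fixes U :: "('k::field, 'u::ab_group_add) lmod"
    and V :: "('k, 'v::ab_group_add) lmod" and W :: "('k, 'w::ab_group_add) lmod" and f
  assumes U: "left_module (univ_ring :: 'k ring) U" and f: "bilinear_map V W U f"
begin

lemma tensor_lift_pure: "v \<in> mcar V \<Longrightarrow> w \<in> mcar W \<Longrightarrow> tensor_lift V W f (tpure V W v w) = f v w"
  using tensor_lift_tsum[OF U f, of "[(v, w)]"] by (simp add: tsum_def)

lemma tensor_lift_add:
  assumes "s \<in> tspan V W (mcar V) (mcar W)" "t \<in> tspan V W (mcar V) (mcar W)"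
  shows "tensor_lift V W f (s + t) = tensor_lift V W f s + tensor_lift V W f t"
proof -
  obtain xs ys where "set xs \<subseteq> mcar V \<times> mcar W" "set ys \<subseteq> mcar V \<times> mcar W"
    "s = tsum V W xs" "t = tsum V W ys"
    using assms by (auto simp: tspan_def)
  then show ?thesis
    using tensor_lift_tsum[OF U f, of "xs @ ys"] tensor_lift_tsum[OF U f, of xs]
      tensor_lift_tsum[OF U f, of ys] by (simp add: tsum_append)
qed

lemma tensor_lift_additive_on: "additive_on (tspan V W (mcar V) (mcar W)) (tensor_lift V W f)"
  by (simp add: additive_on_def tensor_lift_add)

lemma tensor_lift_zero: "tensor_lift V W f 0 = 0"
  using tensor_lift_tsum[OF U f, of "[]"] by (simp add: tsum_def)

lemma tensor_lift_closed:
  "t \<in> tspan V W (mcar V) (mcar W) \<Longrightarrow> tensor_lift V W f t \<in> mcar U"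
  by (rule tensor_lift_fun_closed[OF mod_subgroup[OF U]]) (simp_all add: bilinear_mapD(1)[OF f])

lemma tensor_lift_scale:
  assumes V: "left_module univ_ring V" and t: "t \<in> tspan V W (mcar V) (mcar W)"
  shows "tensor_lift V W f (tscale c t) = act U c (tensor_lift V W f t)"
  using t
proof (induction rule: tspan_induct)
  case zero
  then show ?case
    using left_module.act_zero_right[OF U, of c] by (simp add: tscale_simps tensor_lift_zero)
next
  case (add v w t)
  have cv: "act V c v \<in> mcar V" using mod_closed[OF V _ add(1)] by simp
  have ct: "tscale c t \<in> tspan V W (mcar V) (mcar W)"
    using mod_closed[OF tensor_space_module[OF V, of W], of c t] add by simp
  have "tensor_lift V W f (tscale c (tpure V W v w + t)) =
      tensor_lift V W f (tpure V W (act V c v) w + tscale c t)"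
    using add by (simp add: tscale_simps tpure_scale_left)
  also have "\<dots> = act U c (f v w) + act U c (tensor_lift V W f t)"
    using add cv ct by (simp add: tensor_lift_add tspan_pure tensor_lift_pure bilinear_mapD(4)[OF f])
  also have "\<dots> = act U c (tensor_lift V W f (tpure V W v w + t))"
    using add mod_add_right[OF U, of c]
    by (simp add: tensor_lift_add tspan_pure tensor_lift_pure bilinear_mapD(1)[OF f] tensor_lift_closed)
  finally show ?case .
qed

end

lemma additive_on_tspan_eqI:
  assumes "additive_on (tspan V W X Y) g" "additive_on (tspan V W X Y) h"
    and "\<And>v w. v \<in> X \<Longrightarrow> w \<in> Y \<Longrightarrow> g (tpure V W v w) = h (tpure V W v w)"
    and "t \<in> tspan V W X Y"
  shows "g t = h t"
  using assms(4)
proof (induction rule: tspan_induct)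
  case zero
  \<comment> \<open>\<open>0\<close> lies in the span, so additivity at \<open>0 + 0\<close> gives
    \<open>g 0 = 0\<close> without knowing that the span is a subgroup.\<close>
  have "g (0 + 0) = g 0 + g 0" "h (0 + 0) = h 0 + h 0"
    by (rule additive_onD[OF assms(1)] additive_onD[OF assms(2)]; rule tspan_zero)+
  then show ?case by simp
next
  case (add v w t)
  then show ?case
    using additive_onD[OF assms(1)] additive_onD[OF assms(2)] by (simp add: tspan_pure assms(3))
qed

lemma additive_on_comp:
  "additive_on C g \<Longrightarrow> additive_on B h \<Longrightarrow> h ` B \<subseteq> C \<Longrightarrow> additive_on B (\<lambda>x. g (h x))"
  unfolding additive_on_def by (simp add: image_subset_iff)


lemma regular_module_simps [simp]: "mcar regular_module = UNIV" "act regular_module = (*)"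
  by (simp_all add: regular_module_def)

lemma regular_module_module: "left_module univ_ring regular_module"
  by unfold_locales (simp_all add: add_subgroup_UNIV algebra_simps)


section \<open>Sweedler sums\<close>

lemma full_space_module: "vector_space s \<Longrightarrow> left_module univ_ring (full_space s)"
  by unfold_locales
    (simp_all add: add_subgroup_UNIV vector_space.vector_space_assms)

context hopf_algebra
begin

sublocale hs: k_algebra "hscale H"
  by (rule algebra)

abbreviation "HS \<equiv> hspace H"

lemma hspace_module: "left_module univ_ring HS"
  by (rule full_space_module[OF hs.vector_space_axioms])

lemma comult_tspan: "comult H h \<in> tspan HS HS (mcar HS) (mcar HS)"
  using comult_tensor by simp

lemma sweedler_additive:
  assumes "additive_on C g" "add_subgroup C" "\<And>x y. f x y \<in> C"
  shows "g (sweedler H h f) = sweedler H h (\<lambda>x y. g (f x y))"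
  unfolding sweedler_def by (rule tensor_lift_additive[OF assms(1,2) comult_tspan assms(3)])

lemma sweedler_closed: "add_subgroup C \<Longrightarrow> (\<And>x y. f x y \<in> C) \<Longrightarrow> sweedler H h f \<in> C"
  unfolding sweedler_def by (rule tensor_lift_fun_closed[OF _ comult_tspan])

lemma sweedler_fun_add:
  "sweedler H h (\<lambda>x y. f x y + g x y) = sweedler H h f + sweedler H h g"
  unfolding sweedler_def by (rule tensor_lift_fun_add)

lemma sweedler_swap:
  "sweedler H g (\<lambda>x y. sweedler H h (\<lambda>z w. f x y z w)) = sweedler H h (\<lambda>z w. sweedler H g (\<lambda>x y. f x y z w))"
  unfolding sweedler_def by (rule tensor_lift_swap)

lemma sweedler_counit_left:
  "additive_on UNIV g \<Longrightarrow> sweedler H h (\<lambda>x y. g (hscale H (counit H x) y)) = g h"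
  using sweedler_additive[of UNIV g "\<lambda>x y. hscale H (counit H x) y" h] counit_left
  by (simp add: add_subgroup_UNIV)

context
  fixes U :: "('k, 'u::ab_group_add) lmod" and f :: "'h \<Rightarrow> 'h \<Rightarrow> 'u"
  assumes U: "left_module univ_ring U" and f: "bilinear_map HS HS U f"
begin

lemma sweedler_add: "sweedler H (g + h) f = sweedler H g f + sweedler H h f"
  unfolding sweedler_def
  using tensor_lift_add[OF U f comult_tspan comult_tspan] comult_linear
  by (simp add: Vector_Spaces.linear_iff)

lemma sweedler_scale: "sweedler H (hscale H c h) f = act U c (sweedler H h f)"
  unfolding sweedler_def
  using tensor_lift_scale[OF U f hspace_module comult_tspan] comult_linear
  by (simp add: Vector_Spaces.linear_iff)

lemma sweedler_one: "sweedler H 1 f = f 1 1"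
  unfolding sweedler_def comult_one by (rule tensor_lift_pure[OF U f]) simp_all

text \<open>Apply the linear map on \<open>H \<otimes> H\<close> induced by \<open>f\<close> to the
  axiom \<open>comult_mult\<close> and move it through both Sweedler sums.\<close>

lemma sweedler_mult:
  "sweedler H (g * h) f = sweedler H g (\<lambda>g1 g2. sweedler H h (\<lambda>h1 h2. f (g1 * h1) (g2 * h2)))"
proof -
  let ?T = "tspan HS HS (mcar HS) (mcar HS)"
  let ?L = "tensor_lift HS HS f"
  have L: "additive_on ?T ?L" by (rule tensor_lift_additive_on[OF U f])
  have T: "add_subgroup ?T" by (rule tspan_subgroup) simp_all
  have p: "tpure HS HS x y \<in> ?T" for x y by (rule tspan_pure) simp_all
  have "sweedler H (g * h) f =
      ?L (sweedler H g (\<lambda>g1 g2. sweedler H h (\<lambda>h1 h2. tpure HS HS (g1 * h1) (g2 * h2))))"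
    unfolding sweedler_def[of H "g * h"] comult_mult ..
  also have "\<dots> = sweedler H g (\<lambda>g1 g2. ?L (sweedler H h (\<lambda>h1 h2. tpure HS HS (g1 * h1) (g2 * h2))))"
    by (rule sweedler_additive[OF L T]) (intro sweedler_closed[OF T] p)
  also have "\<dots> = sweedler H g (\<lambda>g1 g2. sweedler H h (\<lambda>h1 h2. ?L (tpure HS HS (g1 * h1) (g2 * h2))))"
    by (subst sweedler_additive[OF L T]) (use p in auto)
  also have "\<dots> = sweedler H g (\<lambda>g1 g2. sweedler H h (\<lambda>h1 h2. f (g1 * h1) (g2 * h2)))"
    by (simp add: tensor_lift_pure[OF U f])
  finally show ?thesis .
qed

end

text \<open>The axiom \<open>coassoc\<close> concerns the universal trilinear map into
  \<open>H \<otimes> (H \<otimes> H)\<close>. The two hypotheses make \<open>f\<close> trilinear, so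
  it factors through that map: lifting the last two arguments gives \<open>F\<close>, and lifting
  \<open>F\<close> gives the factorization.\<close>

lemma sweedler_coassoc:
  fixes U :: "('k, 'u::ab_group_add) lmod"
  assumes U: "left_module univ_ring U" and f: "\<And>x. bilinear_map HS HS U (\<lambda>y z. f x y z)"
    and f': "\<And>z. bilinear_map HS HS U (\<lambda>x y. f x y z)"
  shows "sweedler H h (\<lambda>x y. sweedler H y (\<lambda>y1 y2. f x y1 y2)) =
    sweedler H h (\<lambda>x y. sweedler H x (\<lambda>x1 x2. f x1 x2 y))"
proof -
  let ?HH = "tensor_space HS HS"
  let ?T = "tspan HS ?HH UNIV (mcar ?HH)"
  define F where "F x t = tensor_lift HS HS (f x) t" for x t
  have pHH: "tpure HS HS x y \<in> mcar ?HH" for x y by (simp add: tspan_pure)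
  have cl: "f x y z \<in> mcar U" for x y z using bilinear_mapD(1)[OF f] by simp
  have F: "bilinear_map HS ?HH U F"
  proof (rule bilinear_mapI)
    fix x y t c assume t: "t \<in> mcar ?HH"
    show "F x t \<in> mcar U" unfolding F_def by (rule tensor_lift_closed[OF U f]) (use t in simp)
    show "F (x + y) t = F x t + F y t"
    proof -
      have "F (x + y) t = tensor_lift HS HS (\<lambda>v w. f x v w + f y v w) t"
        unfolding F_def by (rule tensor_lift_cong) (use t bilinear_mapD(2)[OF f'] in auto)
      then show ?thesis by (simp add: F_def tensor_lift_fun_add)
    qed
    show "F (act HS c x) t = act U c (F x t)"
    proof -
      have "F (act HS c x) t = tensor_lift HS HS (\<lambda>v w. act U c (f x v w)) t"
        unfolding F_def by (rule tensor_lift_cong) (use t bilinear_mapD(4)[OF f'] in auto)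
      also have "\<dots> = act U c (F x t)"
        unfolding F_def
        by (rule tensor_lift_additive[OF left_module.act_additive[OF U] mod_subgroup[OF U], symmetric])
          (use t cl in auto)
      finally show ?thesis .
    qed
    show "F x (act ?HH c t) = act U c (F x t)"
      unfolding F_def using tensor_lift_scale[OF U f hspace_module] t by simp
    show "F x (t + s) = F x t + F x s" if "s \<in> mcar ?HH" for s
      unfolding F_def using tensor_lift_add[OF U f] t that by simp
  qed
  let ?L = "tensor_lift HS ?HH F"
  have T: "add_subgroup ?T" by (rule tspan_subgroup) simp_all
  have p: "tpure HS ?HH x (tpure HS HS y z) \<in> ?T" for x y z
    by (rule tspan_pure[OF UNIV_I pHH])
  have L: "additive_on ?T ?L"
    using tensor_lift_additive_on[OF U F] by simp
  have Lp: "?L (tpure HS ?HH x (tpure HS HS y z)) = f x y z" for x y z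
    using tensor_lift_pure[OF U F, of x "tpure HS HS y z"] pHH
    by (simp add: F_def tensor_lift_pure[OF U f])
  \<comment> \<open>The two sides of \<open>coassoc\<close> differ in the leg that is split and in
    the places of the three factors; free \<open>g\<close>, \<open>a\<close>, \<open>b\<close>,
    \<open>c\<close> cover both.\<close>
  have s: "?L (sweedler H h (\<lambda>x y. sweedler H (g x y)
      (\<lambda>v w. tpure HS ?HH (a x y v w) (tpure HS HS (b x y v w) (c x y v w))))) =
    sweedler H h (\<lambda>x y. sweedler H (g x y) (\<lambda>v w. f (a x y v w) (b x y v w) (c x y v w)))"
    for g a b c
  proof -
    have "?L (sweedler H h (\<lambda>x y. sweedler H (g x y)
        (\<lambda>v w. tpure HS ?HH (a x y v w) (tpure HS HS (b x y v w) (c x y v w))))) =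
      sweedler H h (\<lambda>x y. ?L (sweedler H (g x y)
        (\<lambda>v w. tpure HS ?HH (a x y v w) (tpure HS HS (b x y v w) (c x y v w)))))"
      by (rule sweedler_additive[OF L T]) (intro sweedler_closed[OF T] p)
    also have "\<dots> = sweedler H h (\<lambda>x y. sweedler H (g x y)
        (\<lambda>v w. ?L (tpure HS ?HH (a x y v w) (tpure HS HS (b x y v w) (c x y v w)))))"
      by (subst sweedler_additive[OF L T]) (use p in auto)
    finally show ?thesis by (simp only: Lp)
  qed
  show ?thesis
    using arg_cong[OF coassoc[of h], of ?L] unfolding s .
qed

end


section \<open>The modules \<open>A \<otimes> U\<close> over the smash product\<close>

text \<open>The value of \<open>x # h\<close> on \<open>a \<otimes> u\<close>, that is, the
  innermost term of the two nested lifts in \<open>proj_module\<close>.\<close>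

definition proj_term ::
  "('k::field, 'h::ring_1) hopf_data \<Rightarrow> ('k, 'h, 'a::ring_1) action_data \<Rightarrow> ('h, 'u::ab_group_add) lmod
    \<Rightarrow> 'a \<Rightarrow> 'h \<Rightarrow> 'a \<Rightarrow> 'u \<Rightarrow> ('k, 'a, 'u) tensor" where
  "proj_term H A U x h a u =
    sweedler H h (\<lambda>h1 h2. tpure (aspace A) (base_space H U) (x * aact A h1 a) (act U h2 u))"

context graded_hopf_action
begin

sublocale ga: connected_graded_algebra "ascale A" "apart A"
  by (rule graded_algebra)

abbreviation "AS \<equiv> aspace A"
abbreviation "S \<equiv> smash H A"
abbreviation "BS \<equiv> base_space H"
abbreviation "PM \<equiv> proj_module H A"

lemma aspace_module: "left_module univ_ring AS"
  by (rule full_space_module[OF ga.vector_space_axioms])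

lemma aact_add_left: "aact A (g + h) a = aact A g a + aact A h a"
  and aact_add_right: "aact A h (a + b) = aact A h a + aact A h b"
  and aact_mult_left: "aact A (g * h) a = aact A g (aact A h a)"
  and aact_one_left: "aact A 1 a = a"
  using mod_add_left[OF action_module, of g h a] mod_add_right[OF action_module, of h a b]
    mod_mult[OF action_module, of g h a] mod_one[OF action_module, of a]
  by simp_all

text \<open>The scalars \<open>hscale H c 1\<close> are central in \<open>H\<close>. Hence they can
  be pulled through every \<open>H\<close>-action, and \<open>H\<close>-linear maps are linear over
  the ground field.\<close>

lemma hscale_one_mult: "hscale H c h = hscale H c 1 * h" "hscale H c h = h * hscale H c 1"
  using hs.scale_mult_left[of c 1 h] hs.scale_mult_right[of c h 1] by simp_all

lemma aact_scale: "aact A (hscale H c h) a = ascale A c (aact A h a)"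
  "aact A h (ascale A c a) = ascale A c (aact A h a)"
proof -
  show *: "aact A (hscale H c h) a = ascale A c (aact A h a)"
    by (subst hscale_one_mult(1)) (simp add: aact_mult_left action_scale)
  show "aact A h (ascale A c a) = ascale A c (aact A h a)"
    unfolding *[symmetric] by (subst hscale_one_mult(2)) (simp add: aact_mult_left action_scale)
qed

lemma base_space_simps [simp]: "mcar (BS U) = mcar U" "act (BS U) c = act U (hscale H c 1)"
  by (simp_all add: base_space_def)

lemma base_space_module:
  assumes "left_module univ_ring U"
  shows "left_module univ_ring (BS U)"
proof -
  note L = mod_closed[OF assms] mod_add_left[OF assms, symmetric] mod_add_right[OF assms]
    mod_mult[OF assms, symmetric] mod_one[OF assms] mod_subgroup[OF assms]
  show ?thesis
    by unfold_locales (use L in \<open>simp_all add: hs.scale_left_distrib flip: hscale_one_mult(1)\<close>)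
qed

lemma act_hscale:
  assumes U: "left_module univ_ring U" and u: "u \<in> mcar U"
  shows "act U (hscale H c h) u = act U (hscale H c 1) (act U h u)"
    and "act U h (act U (hscale H c 1) u) = act U (hscale H c 1) (act U h u)"
proof -
  show *: "act U (hscale H c h) u = act U (hscale H c 1) (act U h u)"
    by (subst hscale_one_mult(1)) (use mod_mult[OF U] u in simp)
  show "act U h (act U (hscale H c 1) u) = act U (hscale H c 1) (act U h u)"
    unfolding *[symmetric] by (subst hscale_one_mult(2)) (use mod_mult[OF U] u in simp)
qed

lemma proj_module_simps [simp]:
  "mcar (PM U) = tspan AS (BS U) UNIV (mcar U)"
  "act (PM U) z t = tensor_lift AS HS (\<lambda>x h. tensor_lift AS (BS U) (proj_term H A U x h) t) z"
  "mpart (PM U) i = (if 0 \<le> i then tspan AS (BS U) (apart A (nat i)) (mcar U) else {0})"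
  by (simp_all add: proj_module_def proj_term_def[abs_def])

lemma smash_simps [simp]:
  "carrier S = tspan AS HS UNIV UNIV" "mult S = smash_mult H A" "one S = tpure AS HS 1 1"
  "zero S = 0" "add S = (+)" "rpart S i = tspan AS HS (apart A i) UNIV"
  by (simp_all add: smash_def)

lemma base_space_regular: "BS regular_module = HS"
  by (simp add: base_space_def fun_eq_iff flip: hscale_one_mult(1))

text \<open>As a left module over itself the smash product is \<open>A \<otimes> U\<close> for
  \<open>U = H\<close>. Closure, distributivity and the multiplication of pure tensors in the ring
  thus become instances of the results on \<open>PM U\<close>.\<close>

lemma proj_regular:
  "mcar (PM regular_module) = carrier S" "act (PM regular_module) = mult S"
  "mpart (PM regular_module) (int i) = rpart S i"
proof -
  show "mcar (PM regular_module) = carrier S" "mpart (PM regular_module) (int i) = rpart S i"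
    by (simp_all add: base_space_regular)
  show "act (PM regular_module) = mult S"
    by (intro ext) (simp add: smash_mult_def proj_term_def[abs_def] base_space_regular)
qed

context
  fixes U :: "('h, 'u::ab_group_add) lmod"
  assumes U: "left_module univ_ring U"
begin

abbreviation (input) "TU \<equiv> tensor_space AS (BS U)"

lemma TU_module: "left_module univ_ring TU"
  by (rule tensor_space_module[OF aspace_module])

lemma TU_subgroup: "add_subgroup (mcar TU)"
  by (rule mod_subgroup[OF TU_module])

lemma tscale_additive_TU: "additive_on (mcar TU) (tscale c)"
  by (simp add: additive_on_def tscale_simps)

lemma act_U: "u \<in> mcar U \<Longrightarrow> act U h u \<in> mcar U"
  using mod_closed[OF U] by simp

lemma proj_term_bilinear_sweedler:
  assumes "u \<in> mcar U"
  shows "bilinear_map HS HS TU (\<lambda>h1 h2. tpure AS (BS U) (x * aact A h1 a) (act U h2 u))"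
proof (rule bilinear_mapI)
  fix c v w
  show "tpure AS (BS U) (x * aact A (act HS c v) a) (act U w u) =
      act TU c (tpure AS (BS U) (x * aact A v a) (act U w u))"
    using tpure_scale_left[of "x * aact A v a" AS "act U w u" "BS U" c] assms
    by (simp add: aact_scale act_U ga.scale_mult_right)
  show "tpure AS (BS U) (x * aact A v a) (act U (act HS c w) u) =
      act TU c (tpure AS (BS U) (x * aact A v a) (act U w u))"
    using tpure_scale_right[of "x * aact A v a" AS "act U w u" "BS U" c] assms
    by (simp add: act_hscale(1)[OF U, of u c w] act_U)
qed (use assms in \<open>auto simp: aact_add_left mod_add_left[OF U, simplified] act_U algebra_simps
    tpure_add_left tpure_add_right tspan_pure\<close>)

lemma proj_term_closed: "u \<in> mcar U \<Longrightarrow> proj_term H A U x h a u \<in> mcar TU"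
  unfolding proj_term_def by (rule sweedler_closed[OF TU_subgroup]) (simp add: tspan_pure act_U)

lemma proj_term_add:
  assumes u: "u \<in> mcar U"
  shows "proj_term H A U (x + y) h a u = proj_term H A U x h a u + proj_term H A U y h a u"
    "proj_term H A U x (g + h) a u = proj_term H A U x g a u + proj_term H A U x h a u"
    "proj_term H A U x h (a + b) u = proj_term H A U x h a u + proj_term H A U x h b u"
    "w \<in> mcar U \<Longrightarrow> proj_term H A U x h a (u + w) = proj_term H A U x h a u + proj_term H A U x h a w"
  using u sweedler_add[OF TU_module proj_term_bilinear_sweedler[OF u], where g = g and h = h]
    mod_add_right[OF U, of _ u w]
  by (simp_all add: proj_term_def tpure_add_left tpure_add_right act_U distrib_left distrib_right
      aact_add_right sweedler_fun_add)

lemma proj_term_scale: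
  assumes u: "u \<in> mcar U"
  shows "proj_term H A U (ascale A c x) h a u = tscale c (proj_term H A U x h a u)"
    "proj_term H A U x (hscale H c h) a u = tscale c (proj_term H A U x h a u)"
    "proj_term H A U x h (ascale A c a) u = tscale c (proj_term H A U x h a u)"
    "proj_term H A U x h a (act U (hscale H c 1) u) = tscale c (proj_term H A U x h a u)"
proof -
  have *: "tscale c (proj_term H A U x h a u) = sweedler H h (\<lambda>h1 h2.
      tscale c (tpure AS (BS U) (x * aact A h1 a) (act U h2 u)))"
    unfolding proj_term_def
    by (rule sweedler_additive[OF tscale_additive_TU TU_subgroup]) (use u in \<open>simp add: tspan_pure act_U\<close>)
  have l: "tpure AS (BS U) (ascale A c b) w = tscale c (tpure AS (BS U) b w)"
    and r: "tpure AS (BS U) b (act U (hscale H c 1) w) = tscale c (tpure AS (BS U) b w)"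
    if "w \<in> mcar U" for b w
    using tpure_scale_left[of b AS w "BS U" c] tpure_scale_right[of b AS w "BS U" c] that by simp_all
  show "proj_term H A U (ascale A c x) h a u = tscale c (proj_term H A U x h a u)"
    "proj_term H A U x h (ascale A c a) u = tscale c (proj_term H A U x h a u)"
    "proj_term H A U x h a (act U (hscale H c 1) u) = tscale c (proj_term H A U x h a u)"
    unfolding * using u
    by (simp_all add: proj_term_def aact_scale l r act_U act_hscale(2)[OF U]
        flip: ga.scale_mult_left ga.scale_mult_right)
  show "proj_term H A U x (hscale H c h) a u = tscale c (proj_term H A U x h a u)"
    unfolding proj_term_def using sweedler_scale[OF TU_module proj_term_bilinear_sweedler[OF u]] by simp
qed

lemma proj_term_bilinear: "bilinear_map AS (BS U) TU (proj_term H A U x h)"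
  by (rule bilinear_mapI)
    (simp_all add: proj_term_closed[simplified] proj_term_add proj_term_scale)

text \<open>This makes the outer lift of the action well behaved in the ring element. With
  \<open>t\<close> fixed, the identities hold term by term in the fixed representation of
  \<open>t\<close>.\<close>

lemma proj_act_bilinear:
  assumes t: "t \<in> mcar (PM U)"
  shows "bilinear_map AS HS TU (\<lambda>x h. tensor_lift AS (BS U) (proj_term H A U x h) t)"
proof (rule bilinear_mapI)
  have t': "t \<in> tspan AS (BS U) (mcar AS) (mcar (BS U))" using t by simp
  have sc: "tensor_lift AS (BS U) (\<lambda>a u. tscale c (proj_term H A U x h a u)) t =
      tscale c (tensor_lift AS (BS U) (proj_term H A U x h) t)" for c x h
    by (rule tensor_lift_additive[OF tscale_additive_TU TU_subgroup t', symmetric])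
      (use proj_term_closed in simp)
  fix x y :: 'a and g h :: 'h and c
  show "tensor_lift AS (BS U) (proj_term H A U x h) t \<in> mcar TU"
    by (rule tensor_lift_closed[OF TU_module proj_term_bilinear t'])
  show "tensor_lift AS (BS U) (proj_term H A U (x + y) h) t =
     tensor_lift AS (BS U) (proj_term H A U x h) t + tensor_lift AS (BS U) (proj_term H A U y h) t"
    unfolding tensor_lift_fun_add[symmetric]
    by (rule tensor_lift_cong[OF t']) (simp add: proj_term_add)
  show "tensor_lift AS (BS U) (proj_term H A U x (g + h)) t =
     tensor_lift AS (BS U) (proj_term H A U x g) t + tensor_lift AS (BS U) (proj_term H A U x h) t"
    unfolding tensor_lift_fun_add[symmetric]
    by (rule tensor_lift_cong[OF t']) (simp add: proj_term_add)
  have "tensor_lift AS (BS U) (proj_term H A U (act AS c x) h) t =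
      tensor_lift AS (BS U) (\<lambda>a u. tscale c (proj_term H A U x h a u)) t"
    by (rule tensor_lift_cong[OF t']) (simp add: proj_term_scale)
  then show "tensor_lift AS (BS U) (proj_term H A U (act AS c x) h) t =
      act TU c (tensor_lift AS (BS U) (proj_term H A U x h) t)" by (simp add: sc)
  have "tensor_lift AS (BS U) (proj_term H A U x (act HS c h)) t =
      tensor_lift AS (BS U) (\<lambda>a u. tscale c (proj_term H A U x h a u)) t"
    by (rule tensor_lift_cong[OF t']) (simp add: proj_term_scale)
  then show "tensor_lift AS (BS U) (proj_term H A U x (act HS c h)) t =
      act TU c (tensor_lift AS (BS U) (proj_term H A U x h) t)" by (simp add: sc)
qed

lemma proj_act_closed: "z \<in> carrier S \<Longrightarrow> t \<in> mcar (PM U) \<Longrightarrow> act (PM U) z t \<in> mcar (PM U)"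
  using tensor_lift_closed[OF TU_module proj_act_bilinear, of t z] by simp

lemma proj_act_pure_left:
  "t \<in> mcar (PM U) \<Longrightarrow> act (PM U) (tpure AS HS x h) t = tensor_lift AS (BS U) (proj_term H A U x h) t"
  using tensor_lift_pure[OF TU_module proj_act_bilinear, of t x h] by simp

lemma proj_act_pure:
  "u \<in> mcar U \<Longrightarrow> act (PM U) (tpure AS HS x h) (tpure AS (BS U) a u) = proj_term H A U x h a u"
  using proj_act_pure_left[of "tpure AS (BS U) a u"] tensor_lift_pure[OF TU_module proj_term_bilinear, of a u]
  by (simp add: tspan_pure)

lemma proj_act_additive_left: "t \<in> mcar (PM U) \<Longrightarrow> additive_on (carrier S) (\<lambda>z. act (PM U) z t)"
  using tensor_lift_additive_on[OF TU_module proj_act_bilinear, of t] by simp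

lemma proj_act_additive_right:
  assumes z: "z \<in> carrier S"
  shows "additive_on (mcar (PM U)) (act (PM U) z)"
  unfolding additive_on_def
proof (intro ballI)
  fix s t assume st: "s \<in> mcar (PM U)" "t \<in> mcar (PM U)"
  have z': "z \<in> tspan AS HS (mcar AS) (mcar HS)" using z by simp
  show "act (PM U) z (s + t) = act (PM U) z s + act (PM U) z t"
    unfolding proj_module_simps tensor_lift_fun_add[symmetric]
    by (rule tensor_lift_cong[OF z'])
      (use st tensor_lift_add[OF TU_module proj_term_bilinear] in simp)
qed

end

lemma smash_mult_closed: "z \<in> carrier S \<Longrightarrow> z' \<in> carrier S \<Longrightarrow> mult S z z' \<in> carrier S"
  using proj_act_closed[OF regular_module_module, of z z'] unfolding proj_regular .

lemma smash_mult_pure: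
  "mult S (tpure AS HS x h) (tpure AS HS y g) = sweedler H h (\<lambda>h1 h2. tpure AS HS (x * aact A h1 y) (h2 * g))"
  using proj_act_pure[OF regular_module_module, of g x h y]
  unfolding proj_regular by (simp add: proj_term_def base_space_regular)

lemma smash_mult_additive:
  "z \<in> carrier S \<Longrightarrow> additive_on (carrier S) (mult S z)"
  "z \<in> carrier S \<Longrightarrow> additive_on (carrier S) (\<lambda>z'. mult S z' z)"
  using proj_act_additive_right[OF regular_module_module, of z]
    proj_act_additive_left[OF regular_module_module, of z]
  unfolding proj_regular by simp_all

lemma smash_subgroup: "add_subgroup (carrier S)"
  using TU_subgroup[OF regular_module_module] by (simp add: base_space_regular)

end


section \<open>Direct decompositions\<close>

lemma direct_decompositionD:
  assumes "direct_decomposition M G"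
  shows "add_subgroup M" "\<And>i. add_subgroup (G i)" "\<And>i. G i \<subseteq> M" "\<And>i x. x \<in> G i \<Longrightarrow> x \<in> M"
  using assms by (auto simp: direct_decomposition_def)

definition component :: "('i \<Rightarrow> 'm::ab_group_add set) \<Rightarrow> 'm \<Rightarrow> 'i \<Rightarrow> 'm" where
  "component G x = (THE f. finite {i. f i \<noteq> 0} \<and> (\<forall>i. f i \<in> G i) \<and> x = (\<Sum>i | f i \<noteq> 0. f i))"

context
  fixes M :: "'m::ab_group_add set" and G :: "'i \<Rightarrow> 'm set"
  assumes dd: "direct_decomposition M G"
begin

lemma component_props:
  assumes "x \<in> M"
  shows "finite {i. component G x i \<noteq> 0}" "component G x i \<in> G i"
    "x = (\<Sum>i | component G x i \<noteq> 0. component G x i)"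
  using theI'[of "\<lambda>f. finite {i. f i \<noteq> 0} \<and> (\<forall>i. f i \<in> G i) \<and> x = (\<Sum>i | f i \<noteq> 0. f i)"] dd assms
  unfolding direct_decomposition_def component_def[symmetric] by auto

text \<open>\<open>direct_decomposition\<close> speaks of sums over the exact support of a function.
  Cutting \<open>f\<close> down to \<open>I\<close> reduces any finite sum of homogeneous elements,
  possibly with zero summands, to that form.\<close>

lemma component_unique:
  assumes I: "finite I" and f: "\<And>i. i \<in> I \<Longrightarrow> f i \<in> G i" and x: "x = (\<Sum>i\<in>I. f i)"
  shows "component G x i = (if i \<in> I then f i else 0)"
proof -
  define g where "g i = (if i \<in> I then f i else 0)" for i
  have xM: "x \<in> M" unfolding x
    by (rule add_subgroup_sum[OF direct_decompositionD(1)[OF dd]])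
      (rule direct_decompositionD(4)[OF dd f])
  have gI: "{i. g i \<noteq> 0} \<subseteq> I" by (auto simp: g_def)
  have "x = (\<Sum>i\<in>I. g i)" unfolding x by (rule sum.cong) (simp_all add: g_def)
  also have "\<dots> = (\<Sum>i | g i \<noteq> 0. g i)"
    by (rule sum.mono_neutral_right[OF I gI]) simp
  finally have "x = (\<Sum>i | g i \<noteq> 0. g i)" .
  moreover have "finite {i. g i \<noteq> 0}" using finite_subset[OF gI I] .
  moreover have "\<forall>i. g i \<in> G i"
    using f direct_decompositionD(2)[OF dd] by (simp add: g_def add_subgroup_zero)
  ultimately have "component G x = g"
    unfolding component_def using dd xM unfolding direct_decomposition_def
    by (intro the1_equality) blast+
  then show ?thesis by (simp add: g_def)
qed

lemma component_homogeneous: "x \<in> G i \<Longrightarrow> component G x j = (if j = i then x else 0)"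
  using component_unique[of "{i}" "\<lambda>_. x" x j] by simp

lemma component_sum_superset:
  assumes "x \<in> M" "finite I" "{i. component G x i \<noteq> 0} \<subseteq> I"
  shows "x = (\<Sum>i\<in>I. component G x i)"
proof -
  have "(\<Sum>i | component G x i \<noteq> 0. component G x i) = (\<Sum>i\<in>I. component G x i)"
    by (rule sum.mono_neutral_left) (use assms in auto)
  then show ?thesis using component_props(3)[OF assms(1)] by simp
qed

lemma component_add:
  assumes "x \<in> M" "y \<in> M"
  shows "component G (x + y) i = component G x i + component G y i"
proof -
  let ?I = "{i. component G x i \<noteq> 0} \<union> {i. component G y i \<noteq> 0}"
  have I: "finite ?I" using component_props(1) assms by simp
  have "x + y = (\<Sum>i\<in>?I. component G x i) + (\<Sum>i\<in>?I. component G y i)"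
    using component_sum_superset[OF assms(1) I] component_sum_superset[OF assms(2) I] by simp
  then have "x + y = (\<Sum>i\<in>?I. component G x i + component G y i)"
    by (simp add: sum.distrib)
  from component_unique[OF I _ this, of i]
  show ?thesis
    using component_props(2)[OF assms(1)] component_props(2)[OF assms(2)]
      add_subgroup_add[OF direct_decompositionD(2)[OF dd]] by auto
qed

lemma component_additive: "additive_on M (\<lambda>x. component G x i)"
  by (simp add: additive_on_def component_add)

text \<open>Together with \<open>add_subgroup_vimage\<close> this serves as induction over
  homogeneous elements.\<close>

lemma direct_decomposition_generated:
  assumes "add_subgroup X" "\<And>i. G i \<subseteq> X"
  shows "M \<subseteq> X"
proof
  fix x assume x: "x \<in> M"
  show "x \<in> X"
    by (subst component_props(3)[OF x], rule add_subgroup_sum[OF assms(1)])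
      (use component_props(2)[OF x] assms(2) in auto)
qed

lemma direct_decomposition_sub:
  assumes X: "add_subgroup X" "X \<subseteq> M" and c: "\<And>x i. x \<in> X \<Longrightarrow> component G x i \<in> X"
  shows "direct_decomposition X (\<lambda>i. X \<inter> G i)"
  unfolding direct_decomposition_def
proof (intro conjI allI ballI)
  fix x assume x: "x \<in> X"
  then have xM: "x \<in> M" using X by auto
  show "\<exists>!f. finite {i. f i \<noteq> 0} \<and> (\<forall>i. f i \<in> X \<inter> G i) \<and> x = (\<Sum>i | f i \<noteq> 0. f i)"
  proof (rule ex1I[of _ "component G x"])
    show "finite {i. component G x i \<noteq> 0} \<and> (\<forall>i. component G x i \<in> X \<inter> G i) \<and>
        x = (\<Sum>i | component G x i \<noteq> 0. component G x i)"
      using component_props[OF xM] c[OF x] by blast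
  next
    fix f assume f: "finite {i. f i \<noteq> 0} \<and> (\<forall>i. f i \<in> X \<inter> G i) \<and> x = (\<Sum>i | f i \<noteq> 0. f i)"
    show "f = component G x"
    proof
      fix i show "f i = component G x i"
        using component_unique[of "{i. f i \<noteq> 0}" f x i] f by auto
    qed
  qed
qed (use X direct_decompositionD(2)[OF dd] add_subgroup_Int in auto)

end

lemma component_hom:
  assumes dd: "direct_decomposition M G" and f: "additive_on M f" and g: "\<And>i x. x \<in> G i \<Longrightarrow> f x \<in> G' i" and dd': "direct_decomposition M' G'"
    and x: "x \<in> M"
  shows "component G' (f x) i = f (component G x i)"
proof -
  have "f x = (\<Sum>i | component G x i \<noteq> 0. f (component G x i))"
    by (subst component_props(3)[OF dd x], rule additive_on_sum[OF f direct_decompositionD(1)[OF dd]])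
      (use direct_decompositionD(4)[OF dd component_props(2)[OF dd x]] in auto)
  moreover have "f 0 = 0" using additive_on_zero[OF f direct_decompositionD(1)[OF dd]] .
  ultimately show ?thesis
    by (metis (mono_tags, lifting) component_unique[OF dd' component_props(1)[OF dd x]]
      g component_props(2)[OF dd x] mem_Collect_eq)
qed

text \<open>Existence and uniqueness are separated. The sums of homogeneous elements form a
  subgroup, so \<open>gen\<close> yields existence; the projection \<open>pr i\<close> reads off the
  \<open>i\<close>-th summand of any representation, which yields uniqueness.\<close>

lemma direct_decompositionI:
  assumes M: "add_subgroup M" and G: "\<And>i. add_subgroup (G i)" "\<And>i. G i \<subseteq> M"
    and gen: "\<And>X. add_subgroup X \<Longrightarrow> (\<And>i. G i \<subseteq> X) \<Longrightarrow> M \<subseteq> X"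
    and pr: "\<And>i. additive_on M (pr i)" "\<And>i x. x \<in> G i \<Longrightarrow> pr i x = x"
      "\<And>i j x. i \<noteq> j \<Longrightarrow> x \<in> G j \<Longrightarrow> pr i x = 0"
  shows "direct_decomposition M G"
  unfolding direct_decomposition_def
proof (intro conjI allI ballI)
  let ?P = "\<lambda>x f. finite {i. f i \<noteq> 0} \<and> (\<forall>i. f i \<in> G i) \<and> x = (\<Sum>i | f i \<noteq> 0. f i)"
  define X where "X = {x. \<exists>f. ?P x f}"
  have "add_subgroup X"
  proof (rule add_subgroupI)
    show "0 \<in> X" unfolding X_def using G(1)
      by (auto intro!: exI[of _ "\<lambda>_. 0"] simp: add_subgroup_zero)
  next
    fix x y assume "x \<in> X" "y \<in> X"
    then obtain f g where f: "?P x f" and g: "?P y g" by (auto simp: X_def)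
    let ?I = "{i. f i \<noteq> 0} \<union> {i. g i \<noteq> 0}" and ?h = "\<lambda>i. f i + g i"
    have fin: "finite ?I" and sub: "{i. ?h i \<noteq> 0} \<subseteq> ?I" using f g by auto
    have "(\<Sum>i | f i \<noteq> 0. f i) = (\<Sum>i\<in>?I. f i)" "(\<Sum>i | g i \<noteq> 0. g i) = (\<Sum>i\<in>?I. g i)"
      by (rule sum.mono_neutral_left[OF fin]; auto)+
    then have "x + y = (\<Sum>i\<in>?I. ?h i)" using f g by (simp add: sum.distrib)
    also have "\<dots> = (\<Sum>i | ?h i \<noteq> 0. ?h i)" by (rule sum.mono_neutral_right[OF fin sub]) simp
    finally have "?P (x + y) ?h"
      using f g finite_subset[OF sub fin] add_subgroup_add[OF G(1)] by auto
    then show "x + y \<in> X" unfolding X_def by (intro CollectI exI[of _ ?h])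
  next
    fix x assume "x \<in> X"
    then obtain f where f: "?P x f" by (auto simp: X_def)
    have "?P (- x) (\<lambda>i. - f i)"
      using f add_subgroup_minus[OF G(1)] by (auto simp: sum_negf)
    then show "- x \<in> X" unfolding X_def by (intro CollectI exI[of _ "\<lambda>i. - f i"])
  qed
  moreover have "G i \<subseteq> X" for i
  proof
    fix x assume "x \<in> G i"
    then have "?P x (\<lambda>j. if j = i then x else 0)"
      using add_subgroup_zero[OF G(1)] by (auto simp: if_distrib cong: if_cong)
    then show "x \<in> X" unfolding X_def
      by (intro CollectI exI[of _ "\<lambda>j. if j = i then x else 0"])
  qed
  ultimately have MX: "M \<subseteq> X" by (rule gen)
  fix x assume x: "x \<in> M"
  have pr_f: "pr i x = f i" if f: "?P x f" for f i
  proof -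
    have "pr i x = (\<Sum>j | f j \<noteq> 0. pr i (f j))"
      by (subst conjunct2[OF conjunct2[OF f]], rule additive_on_sum[OF pr(1) M]) (use f G in auto)
    also have "\<dots> = (\<Sum>j | f j \<noteq> 0. if j = i then f i else 0)"
    proof (rule sum.cong[OF refl])
      fix j
      show "pr i (f j) = (if j = i then f i else 0)" using f pr(2)[of "f i" i] pr(3)[of i j "f j"] by simp
    qed
    also have "\<dots> = f i" using f by simp
    finally show ?thesis .
  qed
  show "\<exists>!f. ?P x f"
  proof (rule ex_ex1I)
    show "\<exists>f. ?P x f" using x MX by (auto simp: X_def)
    show "f = g" if "?P x f" "?P x g" for f g using pr_f[OF that(1)] pr_f[OF that(2)] by auto
  qed
qed (use M G in auto)

section \<open>Graded modules and homomorphisms of degree 0\<close>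

lemma graded_moduleD:
  assumes "graded_module R M"
  shows "left_module R M" "direct_decomposition (mcar M) (mpart M)"
    "\<And>i j r x. r \<in> rpart R i \<Longrightarrow> x \<in> mpart M j \<Longrightarrow> act M r x \<in> mpart M (int i + j)"
    "\<And>i x. x \<in> mpart M i \<Longrightarrow> x \<in> mcar M"
  using assms direct_decompositionD(4) by (auto simp: graded_module_def)

lemma graded_homD:
  assumes "graded_hom R M N f"
  shows "lmod_hom R M N f" "\<And>i x. x \<in> mpart M i \<Longrightarrow> f x \<in> mpart N i"
  using assms by (auto simp: graded_hom_def)

lemma graded_hom_comp: "graded_hom R M N f \<Longrightarrow> graded_hom R N L g \<Longrightarrow> graded_hom R M L (\<lambda>x. g (f x))"
  unfolding graded_hom_def by (auto intro: lmod_hom_comp)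

lemma graded_hom_component:
  assumes "graded_module R M" "graded_module R N" "graded_hom R M N f" "x \<in> mcar M"
  shows "component (mpart N) (f x) i = f (component (mpart M) x i)"
  by (rule component_hom[OF graded_moduleD(2)[OF assms(1)] lmod_homD(4)[OF graded_homD(1)[OF assms(3)]]
      graded_homD(2)[OF assms(3)] graded_moduleD(2)[OF assms(2)] assms(4)])

lemma graded_submodule_image:
  assumes M: "graded_module R M" and N: "graded_module R N" and f: "graded_hom R M N f"
  shows "graded_submodule R N (f ` mcar M)"
proof -
  note h = lmod_homD[OF graded_homD(1)[OF f]]
  have sub: "submodule R N (f ` mcar M)"
    unfolding submodule_def
    using h add_subgroup_image[OF h(4) mod_subgroup[OF graded_moduleD(1)[OF M]]]
      mod_closed[OF graded_moduleD(1)[OF M]]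
    by (auto simp flip: h(3))
  moreover have "component (mpart N) y i \<in> f ` mcar M" if "y \<in> f ` mcar M" for y i
  proof -
    obtain x where x: "x \<in> mcar M" "y = f x" using \<open>y \<in> f ` mcar M\<close> by auto
    then show ?thesis
      using graded_hom_component[OF M N f x(1)]
        graded_moduleD(4)[OF M component_props(2)[OF graded_moduleD(2)[OF M] x(1)]] by simp
  qed
  ultimately show ?thesis
    unfolding graded_submodule_def
    using direct_decomposition_sub[OF graded_moduleD(2)[OF N]] submoduleD(1,2)[OF sub] by blast
qed

lemma submodule_ker:
  assumes M: "left_module R M" and N: "left_module R N" and f: "lmod_hom R M N f"
  shows "submodule R M (mod_ker M f)"
proof -
  note h = lmod_homD[OF f]
  note S = mod_subgroup[OF M]
  have "add_subgroup (mod_ker M f)"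
    by (rule add_subgroupI)
      (use add_subgroup_zero[OF S] add_subgroup_add[OF S] add_subgroup_minus[OF S] h(2)
        additive_on_zero[OF h(4) S] additive_on_minus[OF h(4) S] in \<open>auto simp: mod_ker_def\<close>)
  then show ?thesis
    unfolding submodule_def
    by (auto simp: mod_ker_def mod_closed[OF M] h(3) left_module.act_zero_right[OF N])
qed

lemma graded_submodule_ker:
  assumes M: "graded_module R M" and N: "graded_module R N" and f: "graded_hom R M N f"
  shows "graded_submodule R M (mod_ker M f)"
proof -
  note sub = submodule_ker[OF graded_moduleD(1)[OF M] graded_moduleD(1)[OF N] graded_homD(1)[OF f]]
  have N0: "component (mpart N) 0 i = 0" for i
    using component_homogeneous[OF graded_moduleD(2)[OF N], of 0 i i]
      add_subgroup_zero[OF direct_decompositionD(2)[OF graded_moduleD(2)[OF N]]] by simp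
  have "component (mpart M) y i \<in> mod_ker M f" if "y \<in> mod_ker M f" for y i
    using that graded_hom_component[OF M N f, of y i] N0
      component_props(2)[OF graded_moduleD(2)[OF M], of y i] graded_moduleD(4)[OF M]
    by (auto simp: mod_ker_def)
  then show ?thesis
    unfolding graded_submodule_def
    using sub direct_decomposition_sub[OF graded_moduleD(2)[OF M]] submoduleD(1,2)[OF sub] by blast
qed

lemma graded_module_shift:
  assumes "graded_module R M"
  shows "graded_module R (shift M n)"
proof -
  note dd = graded_moduleD(2)[OF assms]
  have [simp]: "mcar (shift M n) = mcar M" "act (shift M n) = act M" "mpart (shift M n) i = mpart M (i + n)" for i
    by (simp_all add: shift_def)
  have "left_module R (shift M n)"
    using graded_moduleD(1)[OF assms] unfolding left_module_def by simp
  moreover have "direct_decomposition (mcar M) (mpart (shift M n))"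
  proof (rule direct_decompositionI[where pr = "\<lambda>i x. component (mpart M) x (i + n)"])
    fix X assume X: "add_subgroup X" "\<And>i. mpart (shift M n) i \<subseteq> X"
    have "mpart M i \<subseteq> X" for i using X(2)[of "i - n"] by simp
    then show "mcar M \<subseteq> X" by (rule direct_decomposition_generated[OF dd X(1)])
  qed (auto simp: direct_decompositionD[OF dd] component_additive[OF dd] component_homogeneous[OF dd])
  ultimately show ?thesis
    using graded_moduleD(3)[OF assms] unfolding graded_module_def by (auto simp: add.assoc)
qed


context graded_hopf_action
begin

lemma pure_smash: "tpure AS HS x h \<in> carrier S"
  by (simp add: tspan_pure)

lemma proj_term_one: "u \<in> mcar U \<Longrightarrow> left_module univ_ring U \<Longrightarrow>
    proj_term H A U x 1 a u = tpure AS (BS U) (x * a) u"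
  using sweedler_one[OF TU_module proj_term_bilinear_sweedler, of U u x a] mod_one[of univ_ring U u]
  by (simp add: proj_term_def aact_one_left)

text \<open>Comultiplying \<open>h2 * g\<close> splits the second leg of \<open>h\<close>.
  Coassociativity moves this splitting to the first leg, where \<open>action_mult\<close> folds the
  two parts into the action of one element on the product of \<open>y\<close> with
  \<open>aact A g1 a\<close>.\<close>

lemma proj_act_mult_pure:
  assumes U: "left_module univ_ring U" and u: "u \<in> mcar U"
  shows "act (PM U) (mult S (tpure AS HS x h) (tpure AS HS y g)) (tpure AS (BS U) a u) =
    act (PM U) (tpure AS HS x h) (act (PM U) (tpure AS HS y g) (tpure AS (BS U) a u))"
proof -
  let ?p = "\<lambda>b w. tpure AS (BS U) b w"
  have au: "?p a u \<in> mcar (PM U)" using u by (simp add: tspan_pure)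
  have T: "mcar (PM U) = mcar (tensor_space AS (BS U))" by simp
  have b: "bilinear_map HS HS (tensor_space AS (BS U)) (\<lambda>k1 k2. ?p (x * aact A k1 b) (act U k2 w))"
    if "w \<in> mcar U" for x b w
    by (rule proj_term_bilinear_sweedler[OF U that])
  have tri: "bilinear_map HS HS (tensor_space AS (BS U))
      (\<lambda>h1 k1. ?p (x * aact A h1 y * aact A k1 b) (act U k2 w))" if w: "w \<in> mcar U" for k2 b w
  proof (rule bilinear_mapI)
    have k: "act U k2 w \<in> mcar (BS U)" using act_U[OF U w] by simp
    have s: "?p (ascale A c z) (act U k2 w) = tscale c (?p z (act U k2 w))" for c z
      using tpure_scale_left[of z AS "act U k2 w" "BS U" c] k by simp
    fix v v' z c
    show "?p (x * aact A v y * aact A z b) (act U k2 w) \<in> mcar (tensor_space AS (BS U))"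
      using k by (simp add: tspan_pure)
    show "?p (x * aact A (act HS c v) y * aact A z b) (act U k2 w) =
      act (tensor_space AS (BS U)) c (?p (x * aact A v y * aact A z b) (act U k2 w))"
      by (simp add: aact_scale flip: ga.scale_mult_left ga.scale_mult_right s)
    show "?p (x * aact A v y * aact A (act HS c z) b) (act U k2 w) =
      act (tensor_space AS (BS U)) c (?p (x * aact A v y * aact A z b) (act U k2 w))"
      by (simp add: aact_scale flip: ga.scale_mult_left ga.scale_mult_right s)
  qed (use w in \<open>simp_all add: aact_add_left algebra_simps tpure_add_left act_U[OF U]\<close>)
  have "act (PM U) (mult S (tpure AS HS x h) (tpure AS HS y g)) (?p a u) =
      sweedler H h (\<lambda>h1 h2. act (PM U) (tpure AS HS (x * aact A h1 y) (h2 * g)) (?p a u))"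
    unfolding smash_mult_pure
    by (rule sweedler_additive[OF proj_act_additive_left[OF U au] smash_subgroup pure_smash])
  also have "\<dots> = sweedler H h (\<lambda>h1 h2. sweedler H (h2 * g)
      (\<lambda>g1 g2. ?p (x * aact A h1 y * aact A g1 a) (act U g2 u)))"
    by (simp only: proj_act_pure[OF U u] proj_term_def)
  also have "\<dots> = sweedler H h (\<lambda>h1 h2. sweedler H h2 (\<lambda>k1 k2. sweedler H g
      (\<lambda>g1 g2. ?p (x * aact A h1 y * aact A k1 (aact A g1 a)) (act U k2 (act U g2 u)))))"
    using u by (simp add: sweedler_mult[OF TU_module[OF U] b[OF u]] aact_mult_left mod_mult[OF U, simplified])
  \<comment> \<open>The sum over \<open>g\<close> is moved outermost, so that coassociativity can be
    applied to \<open>h\<close> with \<open>g1\<close> and \<open>g2\<close> fixed.\<close>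
  also have "\<dots> = sweedler H g (\<lambda>g1 g2. sweedler H h (\<lambda>h1 h2. sweedler H h2 (\<lambda>k1 k2.
      ?p (x * aact A h1 y * aact A k1 (aact A g1 a)) (act U k2 (act U g2 u)))))"
    by (subst (2) sweedler_swap, subst (1) sweedler_swap) (rule refl)
  also have "\<dots> = sweedler H g (\<lambda>g1 g2. sweedler H h (\<lambda>h1 h2. sweedler H h1 (\<lambda>k1 k2.
      ?p (x * aact A k1 y * aact A k2 (aact A g1 a)) (act U h2 (act U g2 u)))))"
    by (subst sweedler_coassoc[OF TU_module[OF U] b tri]) (use act_U[OF U u] in auto)
  also have "\<dots> = sweedler H g (\<lambda>g1 g2. sweedler H h (\<lambda>h1 h2.
      ?p (x * aact A h1 (y * aact A g1 a)) (act U h2 (act U g2 u))))"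
  proof -
    have "?p (x * aact A h1 (y * b)) (act U h2 w) =
      sweedler H h1 (\<lambda>k1 k2. ?p (x * aact A k1 y * aact A k2 b) (act U h2 w))"
      if w: "w \<in> mcar U" for b h1 h2 w
    proof -
      have "additive_on UNIV (\<lambda>z. ?p (x * z) (act U h2 w))"
        using act_U[OF U w] by (simp add: additive_on_def distrib_left tpure_add_left)
      from sweedler_additive[OF this add_subgroup_UNIV]
      show ?thesis by (simp add: action_mult mult.assoc)
    qed
    then show ?thesis using act_U[OF U u] by simp
  qed
  also have "\<dots> = sweedler H g (\<lambda>g1 g2. act (PM U) (tpure AS HS x h) (?p (y * aact A g1 a) (act U g2 u)))"
    using proj_act_pure[OF U act_U[OF U u]] by (simp only: proj_term_def)
  also have "\<dots> = act (PM U) (tpure AS HS x h) (proj_term H A U y g a u)"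
    unfolding proj_term_def
    by (rule sweedler_additive[OF proj_act_additive_right[OF U pure_smash], symmetric])
      (use TU_subgroup[OF U] act_U[OF U u] in \<open>simp_all add: tspan_pure\<close>)
  also have "proj_term H A U y g a u = act (PM U) (tpure AS HS y g) (?p a u)"
    by (rule proj_act_pure[OF U u, symmetric])
  finally show ?thesis .
qed

lemma proj_module_left:
  assumes U: "left_module univ_ring U"
  shows "left_module S (PM U)"
proof
  note cl = proj_act_closed[OF U] and ar = proj_act_additive_right[OF U]
    and al = proj_act_additive_left[OF U]
  note sm = smash_mult_closed smash_mult_additive
  have T: "mcar (PM U) = tspan AS (BS U) UNIV (mcar U)" "carrier S = tspan AS HS UNIV UNIV" by simp_all
  show "add_subgroup (mcar (PM U))" using TU_subgroup[OF U] by simp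
  show "act (PM U) r x \<in> mcar (PM U)" if "r \<in> carrier S" "x \<in> mcar (PM U)" for r x
    by (rule cl[OF that])
  show "act (PM U) r (x + y) = act (PM U) r x + act (PM U) r y"
    if "r \<in> carrier S" "x \<in> mcar (PM U)" "y \<in> mcar (PM U)" for r x y
    by (rule additive_onD[OF ar[OF that(1)] that(2,3)])
  show "act (PM U) (r \<oplus>\<^bsub>S\<^esub> r') x = act (PM U) r x + act (PM U) r' x"
    if "r \<in> carrier S" "r' \<in> carrier S" "x \<in> mcar (PM U)" for r r' x
    using additive_onD[OF al[OF that(3)] that(1,2)] by simp
  show "act (PM U) \<one>\<^bsub>S\<^esub> x = x" if "x \<in> mcar (PM U)" for x
  proof -
    have "act (PM U) (tpure AS HS 1 1) x = x"
    proof (rule additive_on_tspan_eqI[OF _ _ _ that[unfolded T(1)]])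
      show "additive_on (tspan AS (BS U) UNIV (mcar U)) (\<lambda>x. x)" by (simp add: additive_on_def)
      show "additive_on (tspan AS (BS U) UNIV (mcar U)) (act (PM U) (tpure AS HS 1 1))"
        unfolding T(1)[symmetric] by (rule ar[OF pure_smash])
      show "act (PM U) (tpure AS HS 1 1) (tpure AS (BS U) a u) = tpure AS (BS U) a u"
        if u: "u \<in> mcar U" for a u
        using proj_act_pure[OF U u] proj_term_one[OF u U] by simp
    qed
    then show ?thesis by simp
  qed
  show "act (PM U) (r \<otimes>\<^bsub>S\<^esub> r') x = act (PM U) r (act (PM U) r' x)"
    if r: "r \<in> carrier S" "r' \<in> carrier S" and x: "x \<in> mcar (PM U)" for r r' x
  proof -
    \<comment> \<open>The pure case extends by additivity three times: in the vector, then in the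
      left ring factor, then in the right one.\<close>
    have 1: "act (PM U) (mult S (tpure AS HS a h) (tpure AS HS b g)) t =
        act (PM U) (tpure AS HS a h) (act (PM U) (tpure AS HS b g) t)" if t: "t \<in> mcar (PM U)" for a h b g t
    proof (rule additive_on_tspan_eqI[OF _ _ _ t[unfolded T(1)]])
      show "additive_on (tspan AS (BS U) UNIV (mcar U))
          (act (PM U) (mult S (tpure AS HS a h) (tpure AS HS b g)))"
        using ar[OF sm(1)[OF pure_smash pure_smash]] unfolding T .
      show "additive_on (tspan AS (BS U) UNIV (mcar U))
          (\<lambda>t. act (PM U) (tpure AS HS a h) (act (PM U) (tpure AS HS b g) t))"
        unfolding T[symmetric]
        by (rule additive_on_comp[OF ar ar]) (use cl pure_smash in blast)+
      show "act (PM U) (mult S (tpure AS HS a h) (tpure AS HS b g)) (tpure AS (BS U) v w) =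
          act (PM U) (tpure AS HS a h) (act (PM U) (tpure AS HS b g) (tpure AS (BS U) v w))"
        if "w \<in> mcar U" for v w by (rule proj_act_mult_pure[OF U that])
    qed
    have 2: "act (PM U) (mult S z (tpure AS HS b g)) x =
        act (PM U) z (act (PM U) (tpure AS HS b g) x)" if z: "z \<in> carrier S" for z b g
    proof (rule additive_on_tspan_eqI[OF _ _ _ z[unfolded T(2)]])
      show "additive_on (tspan AS HS UNIV UNIV) (\<lambda>z. act (PM U) (mult S z (tpure AS HS b g)) x)"
        unfolding T(2)[symmetric]
        by (rule additive_on_comp[OF al[OF x] sm(3)]) (use sm(1) pure_smash in blast)+
      show "additive_on (tspan AS HS UNIV UNIV) (\<lambda>z. act (PM U) z (act (PM U) (tpure AS HS b g) x))"
        unfolding T(2)[symmetric] by (rule al[OF cl[OF pure_smash x]])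
    qed (rule 1[OF x])
    have "act (PM U) (mult S r r') x = act (PM U) r (act (PM U) r' x)"
    proof (rule additive_on_tspan_eqI[OF _ _ _ r(2)[unfolded T(2)]])
      show "additive_on (tspan AS HS UNIV UNIV) (\<lambda>z. act (PM U) (mult S r z) x)"
        unfolding T(2)[symmetric]
        by (rule additive_on_comp[OF al[OF x] sm(2)[OF r(1)]]) (use sm(1) r(1) in blast)
      show "additive_on (tspan AS HS UNIV UNIV) (\<lambda>z. act (PM U) r (act (PM U) z x))"
        unfolding T(2)[symmetric]
        by (rule additive_on_comp[OF ar[OF r(1)] al[OF x]]) (use cl x in blast)
    qed (rule 2[OF r(1)])
    then show ?thesis by simp
  qed
qed

definition part_proj :: "nat \<Rightarrow> 'a \<Rightarrow> 'a" where
  "part_proj i a = component (apart A) a i"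

lemma part_subgroup: "add_subgroup (apart A i)"
  by (rule direct_decompositionD(2)[OF ga.decomposition])

lemma part_scale: "a \<in> apart A i \<Longrightarrow> ascale A c a \<in> apart A i"
  using ga.part_subspace by (rule ga.subspace_scale)

lemma part_proj_mem: "part_proj i a \<in> apart A i"
  unfolding part_proj_def by (rule component_props(2)[OF ga.decomposition UNIV_I])

lemma part_proj_add: "part_proj i (a + b) = part_proj i a + part_proj i b"
  unfolding part_proj_def by (rule component_add[OF ga.decomposition UNIV_I UNIV_I])

lemma part_proj_homogeneous: "a \<in> apart A j \<Longrightarrow> part_proj i a = (if i = j then a else 0)"
  unfolding part_proj_def by (rule component_homogeneous[OF ga.decomposition])

lemma part_proj_scale: "part_proj i (ascale A c a) = ascale A c (part_proj i a)"
  unfolding part_proj_def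
  by (rule component_hom[OF ga.decomposition _ _ ga.decomposition UNIV_I])
    (simp_all add: additive_on_def ga.scale_right_distrib part_scale)

lemma tensor_map_bilinear:
  assumes U: "left_module univ_ring U"
    and f: "\<And>a b. f (a + b) = f a + f b" "\<And>c a. f (ascale A c a) = ascale A c (f a)"
  shows "bilinear_map AS (BS U) (tensor_space AS (BS U)) (\<lambda>a u. tpure AS (BS U) (f a) u)"
proof (rule bilinear_mapI)
  fix c v w assume "v \<in> mcar AS" "w \<in> mcar (BS U)"
  then show "tpure AS (BS U) (f (act AS c v)) w = act (tensor_space AS (BS U)) c (tpure AS (BS U) (f v) w)"
    "tpure AS (BS U) (f v) (act (BS U) c w) = act (tensor_space AS (BS U)) c (tpure AS (BS U) (f v) w)"
    using tpure_scale_left[of "f v" AS w "BS U" c] tpure_scale_right[of "f v" AS w "BS U" c]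
    by (simp_all add: f)
qed (simp_all add: f tpure_add_left tpure_add_right tspan_pure)

lemma proj_module_graded:
  assumes U: "left_module univ_ring U"
  shows "graded_module S (PM U)"
  unfolding graded_module_def
proof (intro conjI allI ballI)
  show "left_module S (PM U)" by (rule proj_module_left[OF U])
  \<comment> \<open>The projection onto degree \<open>i\<close> is the one of \<open>A\<close>
    tensored with the identity of \<open>U\<close>; negative degrees are zero.\<close>
  define pr where "pr i = (if 0 \<le> i then
      tensor_lift AS (BS U) (\<lambda>a u. tpure AS (BS U) (part_proj (nat i) a) u) else (\<lambda>_. 0))" for i :: int
  have bil: "bilinear_map AS (BS U) (tensor_space AS (BS U)) (\<lambda>a u. tpure AS (BS U) (part_proj i a) u)" for i
    by (rule tensor_map_bilinear[OF U part_proj_add part_proj_scale])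
  note add = tensor_lift_additive_on[OF TU_module[OF U] bil]
  have part: "tspan AS (BS U) (apart A i) (mcar U) \<subseteq> tspan AS (BS U) UNIV (mcar U)" for i
    by (rule tspan_mono) simp_all
  have lift: "tensor_lift AS (BS U) (\<lambda>a u. tpure AS (BS U) (part_proj i a) u) t = (if i = j then t else 0)"
    if t: "t \<in> tspan AS (BS U) (apart A j) (mcar U)" for i j t
  proof (rule additive_on_tspan_eqI[OF _ _ _ t])
    show "additive_on (tspan AS (BS U) (apart A j) (mcar U))
        (tensor_lift AS (BS U) (\<lambda>a u. tpure AS (BS U) (part_proj i a) u))"
      by (rule additive_on_subset[OF add]) (use part in simp)
    show "additive_on (tspan AS (BS U) (apart A j) (mcar U)) (\<lambda>t. if i = j then t else 0)"
      by (simp add: additive_on_def)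
    fix v w assume vw: "v \<in> apart A j" "w \<in> mcar U"
    have "tpure AS (BS U) 0 w = 0"
      using tpure_add_left[of 0 AS 0 w "BS U"] vw by simp
    then show "tensor_lift AS (BS U) (\<lambda>a u. tpure AS (BS U) (part_proj i a) u) (tpure AS (BS U) v w) =
        (if i = j then tpure AS (BS U) v w else 0)"
      using tensor_lift_pure[OF TU_module[OF U] bil, of v w i] vw
      by (simp add: part_proj_homogeneous)
  qed
  show "direct_decomposition (mcar (PM U)) (mpart (PM U))"
  proof (rule direct_decompositionI[where pr = pr])
    show "add_subgroup (mcar (PM U))" using TU_subgroup[OF U] by simp
    show "add_subgroup (mpart (PM U) i)" for i
      by (auto simp: add_subgroup_singleton part_scale intro!: tspan_subgroup)
    show "mpart (PM U) i \<subseteq> mcar (PM U)" for i using part tspan_zero by auto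
    show "additive_on (mcar (PM U)) (pr i)" for i
      using add by (simp add: pr_def) (simp add: additive_on_def)
    show "pr i x = x" if "x \<in> mpart (PM U) i" for i x
      using that lift by (auto simp: pr_def split: if_splits)
    show "pr i x = 0" if "i \<noteq> j" "x \<in> mpart (PM U) j" for i j x
      using that lift[of x "nat j" "nat i"] additive_on_zero[OF add] TU_subgroup[OF U]
      by (auto simp: pr_def nat_eq_iff split: if_splits)
  next
    fix X assume X: "add_subgroup X" "\<And>i. mpart (PM U) i \<subseteq> X"
    \<comment> \<open>For fixed \<open>u\<close> the elements \<open>a\<close> with
      \<open>a \<otimes> u\<close> in \<open>X\<close> form a subgroup that contains every
      homogeneous part of \<open>A\<close>.\<close>
    have pure: "tpure AS (BS U) a u \<in> X" if u: "u \<in> mcar U" for a u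
    proof -
      let ?Y = "{a. tpure AS (BS U) a u \<in> X}"
      have ta: "additive_on UNIV (\<lambda>a. tpure AS (BS U) a u)"
        using u by (simp add: additive_on_def tpure_add_left)
      have "add_subgroup ?Y" by (rule add_subgroup_vimage[OF ta X(1)])
      moreover have "apart A i \<subseteq> ?Y" for i
        using X(2)[of "int i"] u by (auto intro!: tspan_pure)
      ultimately show ?thesis
        using direct_decomposition_generated[OF ga.decomposition, of ?Y] by auto
    qed
    show "mcar (PM U) \<subseteq> X"
    proof
      fix t assume "t \<in> mcar (PM U)"
      then have "t \<in> tspan AS (BS U) UNIV (mcar U)" by simp
      then show "t \<in> X"
        by (induction rule: tspan_induct) (auto intro: add_subgroup_zero add_subgroup_add X(1) pure)
    qed
  qed
  fix i j r x assume r: "r \<in> rpart S i" and x: "x \<in> mpart (PM U) j"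
  show "act (PM U) r x \<in> mpart (PM U) (int i + j)"
  \<comment> \<open>For negative \<open>j\<close> the vector is \<open>0\<close>, but the target
    degree may be nonnegative, so \<open>0\<close> is needed in every part.\<close>
  proof (cases "0 \<le> j")
    case False
    then have "x = 0" using x by simp
    moreover have "r \<in> carrier S" using r tspan_mono[of "apart A i" UNIV UNIV UNIV AS HS] by auto
    moreover have "0 \<in> mpart (PM U) k" for k by (simp add: tspan_zero)
    ultimately show ?thesis
      using left_module.act_zero_right[OF proj_module_left[OF U]] by metis
  next
    case True
    define k where "k = nat j"
    have j: "j = int k" using True by (simp add: k_def)
    let ?Y = "tspan AS (BS U) (apart A (i + k)) (mcar U)"
    have Y: "add_subgroup ?Y" by (rule tspan_subgroup) (simp_all add: part_scale)
    have x': "x \<in> tspan AS (BS U) (apart A k) (mcar U)" using x j by simp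
    have pure: "act (PM U) (tpure AS HS a h) t \<in> ?Y"
      if a: "a \<in> apart A i" and t: "t \<in> tspan AS (BS U) (apart A k) (mcar U)" for a h t
      using t
    proof (induction rule: tspan_induct)
      case zero
      then show ?case
        using left_module.act_zero_right[OF proj_module_left[OF U] pure_smash] tspan_zero by metis
    next
      case (add v w t)
      have "act (PM U) (tpure AS HS a h) (tpure AS (BS U) v w + t) =
          proj_term H A U a h v w + act (PM U) (tpure AS HS a h) t"
        using additive_onD[OF proj_act_additive_right[OF U pure_smash], of "tpure AS (BS U) v w" t a h]
          proj_act_pure[OF U add(2), of a h v] add part by (auto simp: tspan_pure)
      moreover have "proj_term H A U a h v w \<in> ?Y"
        unfolding proj_term_def
        by (rule sweedler_closed[OF Y]) (use a add act_U[OF U] action_graded ga.part_mult in \<open>simp add: tspan_pure\<close>)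
      ultimately show ?case using add by (simp add: tspan_add)
    qed
    have r': "r \<in> tspan AS HS (apart A i) UNIV" using r by simp
    have "act (PM U) r x \<in> ?Y"
      using r'
    proof (induction rule: tspan_induct)
      case zero
      have "x \<in> mcar (PM U)" using x' part by auto
      then show ?case
        using additive_on_zero[OF proj_act_additive_left[OF U] smash_subgroup] tspan_zero by metis
    next
      case (add v w t)
      have "act (PM U) (tpure AS HS v w + t) x = act (PM U) (tpure AS HS v w) x + act (PM U) t x"
        by (rule additive_onD[OF proj_act_additive_left[OF U]])
          (use x' part add tspan_mono[of "apart A i" UNIV UNIV UNIV AS HS] in \<open>auto intro: tspan_pure\<close>)
      then show ?case using add pure[OF add(1) x'] by (simp only: tspan_add)
    qed
    then show ?thesis using j by (simp add: nat_int_add)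
  qed
qed

end


section \<open>Direct sums of copies of a graded module\<close>

text \<open>One construction for two uses: with \<open>P = PM regular_module\<close> it is the free
  graded module with basis \<open>I\<close> in degree \<open>n\<close>, and with
  \<open>I = {..<m}\<close> and \<open>n = 0\<close> it is \<open>gmod_power\<close>.\<close>

definition dsum_gmod ::
  "'i set \<Rightarrow> ('r, 'm::ab_group_add) glmod \<Rightarrow> int \<Rightarrow> ('r, 'i \<Rightarrow> 'm) glmod" where
  "dsum_gmod I P n = \<lparr>mcar = mcar (lmod_dsum I (\<lambda>_. P)), act = act (lmod_dsum I (\<lambda>_. P)),
    mpart = (\<lambda>i. {f \<in> mcar (lmod_dsum I (\<lambda>_. P)). \<forall>x\<in>I. f x \<in> mpart P (i - n)})\<rparr>"

lemma lmod_dsum_simps: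
  "f \<in> mcar (lmod_dsum I M) \<longleftrightarrow>
    finite {i. f i \<noteq> 0} \<and> (\<forall>i\<in>I. f i \<in> mcar (M i)) \<and> (\<forall>i. i \<notin> I \<longrightarrow> f i = 0)"
  "act (lmod_dsum I M) r f i = (if i \<in> I then act (M i) r (f i) else 0)"
  by (simp_all add: lmod_dsum_def)

lemma finite_support_add:
  "finite {i. f i \<noteq> 0} \<Longrightarrow> finite {i. g i \<noteq> 0} \<Longrightarrow> finite {i. f i + g i \<noteq> (0::'a::ab_group_add)}"
  by (rule finite_subset[of _ "{i. f i \<noteq> 0} \<union> {i. g i \<noteq> 0}"]) auto

lemma lmod_dsum_left_module:
  assumes M: "\<And>i. i \<in> I \<Longrightarrow> left_module R (M i)"
  shows "left_module R (lmod_dsum I M)"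
proof
  note cl = left_module.mcar_zero[OF M] left_module.mcar_add[OF M] left_module.mcar_minus[OF M]
    mod_closed[OF M] left_module.act_zero_right[OF M]
  show "add_subgroup (mcar (lmod_dsum I M))"
    by (rule add_subgroupI) (auto simp: lmod_dsum_simps zero_fun_apply plus_fun_apply cl finite_support_add)
  show "act (lmod_dsum I M) r x \<in> mcar (lmod_dsum I M)"
    if "r \<in> carrier R" "x \<in> mcar (lmod_dsum I M)" for r x
  proof -
    have "{i. act (lmod_dsum I M) r x i \<noteq> 0} \<subseteq> {i. x i \<noteq> 0}"
      using that by (auto simp: lmod_dsum_simps cl)
    moreover have "finite {i. x i \<noteq> 0}" using that by (simp add: lmod_dsum_simps)
    ultimately have "finite {i. act (lmod_dsum I M) r x i \<noteq> 0}" by (rule finite_subset)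
    then show ?thesis using that by (auto simp: lmod_dsum_simps(1) lmod_dsum_simps(2) cl)
  qed
qed (auto simp: lmod_dsum_simps fun_eq_iff plus_fun_apply mod_add_left[OF M] mod_add_right[OF M]
      mod_mult[OF M] mod_one[OF M])

lemma delta_dsum:
  assumes "\<And>i. i \<in> I \<Longrightarrow> left_module R (M i)" "j \<in> I" "x \<in> mcar (M j)"
  shows "(\<lambda>i. if i = j then x else 0) \<in> mcar (lmod_dsum I M)"
  using assms left_module.mcar_zero[OF assms(1)] by (auto simp: lmod_dsum_simps)

lemma sum_fun_apply: "(\<Sum>i\<in>I. f i) x = (\<Sum>i\<in>I. f i x)"
  by (induction I rule: infinite_finite_induct) (simp_all add: zero_fun_apply plus_fun_apply)

lemma finite_support_decompose:
  fixes f :: "'i \<Rightarrow> 'm::ab_group_add"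
  assumes "finite {i. f i \<noteq> 0}"
  shows "f = (\<Sum>j | f j \<noteq> 0. (\<lambda>i. if i = j then f j else 0))"
  using assms by (auto simp: fun_eq_iff sum_fun_apply if_distrib cong: if_cong)

lemma dsum_gmod_simps [simp]:
  "mcar (dsum_gmod I P n) = mcar (lmod_dsum I (\<lambda>_. P))"
  "act (dsum_gmod I P n) = act (lmod_dsum I (\<lambda>_. P))"
  "mpart (dsum_gmod I P n) i = {f \<in> mcar (lmod_dsum I (\<lambda>_. P)). \<forall>x\<in>I. f x \<in> mpart P (i - n)}"
  by (simp_all add: dsum_gmod_def)

lemma dsum_gmod_graded:
  fixes I :: "'i set" and P :: "('r, 'm::ab_group_add) glmod"
  assumes P: "graded_module R P"
  shows "graded_module R (dsum_gmod I P n)"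
  unfolding graded_module_def
proof (intro conjI allI ballI)
  let ?D = "lmod_dsum I (\<lambda>_. P)"
  note PL = graded_moduleD(1)[OF P] and PD = graded_moduleD(2)[OF P]
  note Pi = direct_decompositionD(2)[OF PD]
  have D: "left_module R ?D" by (rule lmod_dsum_left_module[OF PL])
  show "left_module R (dsum_gmod I P n)" using D unfolding left_module_def by simp
  have part: "add_subgroup (mpart (dsum_gmod I P n) i)" for i
    by (rule add_subgroupI)
      (use left_module.mcar_zero[OF D] left_module.mcar_add[OF D] left_module.mcar_minus[OF D] in
        \<open>auto simp: plus_fun_apply zero_fun_apply add_subgroup_zero[OF Pi] add_subgroup_add[OF Pi]
          add_subgroup_minus[OF Pi]\<close>)
  define pr where "pr i f = (\<lambda>x. if x \<in> I then component (mpart P) (f x) (i - n) else 0)" for i and f :: "'i \<Rightarrow> 'm"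
  show "direct_decomposition (mcar (dsum_gmod I P n)) (mpart (dsum_gmod I P n))"
  proof (rule direct_decompositionI[where pr = pr])
    show "add_subgroup (mcar (dsum_gmod I P n))" using mod_subgroup[OF D] by simp
    show "add_subgroup (mpart (dsum_gmod I P n) i)" for i by (rule part)
    show "additive_on (mcar (dsum_gmod I P n)) (pr i)" for i
      by (auto simp: additive_on_def pr_def fun_eq_iff plus_fun_apply lmod_dsum_simps component_add[OF PD])
    show "pr i f = f" if "f \<in> mpart (dsum_gmod I P n) i" for i f
      using that by (auto simp: pr_def fun_eq_iff lmod_dsum_simps component_homogeneous[OF PD])
    show "pr i f = 0" if "i \<noteq> j" "f \<in> mpart (dsum_gmod I P n) j" for i j f
      using that by (auto simp: pr_def fun_eq_iff zero_fun_apply lmod_dsum_simps component_homogeneous[OF PD])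
  next
    fix X assume X: "add_subgroup X" "\<And>i. mpart (dsum_gmod I P n) i \<subseteq> X"
    have delta: "(\<lambda>x. if x = j then p else 0) \<in> X" if j: "j \<in> I" and p: "p \<in> mcar P" for j p
    proof -
      let ?\<delta> = "\<lambda>p x. if x = j then p else 0"
      let ?Y = "{p. ?\<delta> p \<in> X}"
      have d: "additive_on UNIV ?\<delta>" by (auto simp: additive_on_def fun_eq_iff plus_fun_apply)
      have "add_subgroup ?Y" by (rule add_subgroup_vimage[OF d X(1)])
      moreover have "mpart P i \<subseteq> ?Y" for i
      proof
        fix p assume p: "p \<in> mpart P i"
        have "?\<delta> p \<in> mpart (dsum_gmod I P n) (i + n)"
          using delta_dsum[where R = R and M = "\<lambda>_. P" and I = I, OF PL j graded_moduleD(4)[OF P p]]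
            p add_subgroup_zero[OF Pi] by auto
        from subsetD[OF X(2) this] show "p \<in> ?Y" by simp
      qed
      ultimately show ?thesis
        using direct_decomposition_generated[OF PD, of ?Y] p by auto
    qed
    show "mcar (dsum_gmod I P n) \<subseteq> X"
    proof
      fix f assume "f \<in> mcar (dsum_gmod I P n)"
      then have f: "finite {i. f i \<noteq> 0}" "\<And>i. i \<in> I \<Longrightarrow> f i \<in> mcar P" "\<And>i. f i \<noteq> 0 \<Longrightarrow> i \<in> I"
        by (auto simp: lmod_dsum_simps)
      show "f \<in> X"
        by (subst finite_support_decompose[OF f(1)], rule add_subgroup_sum[OF X(1)])
          (rule delta, use f in auto)
    qed
  qed auto
  fix i j r f assume r: "r \<in> rpart R i" and f: "f \<in> mpart (dsum_gmod I P n) j"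
  \<comment> \<open>A homogeneous \<open>r\<close> is not known to lie in the carrier of
    \<open>R\<close>, so \<open>act_zero_right\<close> does not apply. But \<open>0\<close> has
    every degree, so its image under \<open>r\<close> has two different degrees and must
    vanish.\<close>
  have PZ: "act P r 0 = 0"
  proof -
    have "act P r 0 \<in> mpart P (int i + k)" for k
      by (rule graded_moduleD(3)[OF P r]) (rule add_subgroup_zero[OF Pi])
    from this[of 0] this[of 1] show ?thesis
      using component_homogeneous[OF PD, of "act P r 0" "int i" "int i"]
        component_homogeneous[OF PD, of "act P r 0" "int i + 1" "int i"] by simp
  qed
  have "{x. act ?D r f x \<noteq> 0} \<subseteq> {x. f x \<noteq> 0}" using PZ by (auto simp: lmod_dsum_simps)
  moreover have "finite {x. f x \<noteq> 0}" using f by (simp add: lmod_dsum_simps)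
  ultimately have "finite {x. act ?D r f x \<noteq> 0}" by (rule finite_subset)
  moreover have "act P r (f x) \<in> mpart P (int i + j - n)" if "x \<in> I" for x
    using graded_moduleD(3)[OF P r, of "f x" "j - n"] f that by (simp add: algebra_simps)
  ultimately show "act (dsum_gmod I P n) r f \<in> mpart (dsum_gmod I P n) (int i + j)"
    unfolding dsum_gmod_simps mem_Collect_eq lmod_dsum_simps
    by (simp add: graded_moduleD(4)[OF P, of _ "int i + j - n"])
qed


section \<open>Maps out of \<open>A \<otimes> U\<close>\<close>

text \<open>Restriction of scalars along the embedding of \<open>H\<close> in the smash product. The
  carrier is a parameter because single degrees, complements inside a degree and the whole module
  are all used.\<close>

definition hmod ::
  "('k::field, 'h::ring_1) hopf_data \<Rightarrow> ('k, 'h, 'a::ring_1) action_data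
    \<Rightarrow> (('k, 'a, 'h) tensor, 'm, 'y) lmod_scheme \<Rightarrow> 'm set \<Rightarrow> ('h, 'm) lmod" where
  "hmod H A M X = \<lparr>mcar = X, act = (\<lambda>h. act M (tpure (aspace A) (hspace H) 1 h))\<rparr>"

text \<open>One direction of the adjunction between tensoring with \<open>A\<close> and restricting
  scalars to \<open>H\<close>.\<close>

definition induced_map ::
  "('k::field, 'h::ring_1) hopf_data \<Rightarrow> ('k, 'h, 'a::ring_1) action_data
    \<Rightarrow> (('k, 'a, 'h) tensor, 'm::ab_group_add, 'y) lmod_scheme \<Rightarrow> ('h, 'u::ab_group_add) lmod
    \<Rightarrow> ('u \<Rightarrow> 'm) \<Rightarrow> ('k, 'a, 'u) tensor \<Rightarrow> 'm" where
  "induced_map H A M U \<phi> =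
    tensor_lift (aspace A) (base_space H U) (\<lambda>a u. act M (tpure (aspace A) (hspace H) a 1) (\<phi> u))"

context graded_hopf_action
begin

text \<open>From here on the ring and its action are handled through their rules on pure tensors;
  unfolding them into nested lifts would keep these rules from matching.\<close>

declare proj_module_simps(2) [simp del] smash_simps(1,2) [simp del]

text \<open>The embeddings \<open>eta\<close> of \<open>H\<close> and \<open>alpha\<close> of
  \<open>A\<close> replace the Sweedler formula for the product: every pure tensor is
  \<open>alpha a\<close> times \<open>eta h\<close> (\<open>alpha_eta\<close>).\<close>

definition eta :: "'h \<Rightarrow> ('k, 'a, 'h) tensor" where "eta h = tpure AS HS 1 h"
definition alpha :: "'a \<Rightarrow> ('k, 'a, 'h) tensor" where "alpha a = tpure AS HS a 1"

abbreviation "HM \<equiv> hmod H A"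

lemma hmod_simps [simp]: "mcar (HM M X) = X" "act (HM M X) h = act M (eta h)"
  by (simp_all add: hmod_def eta_def)

lemma eta_carrier: "eta h \<in> carrier S" and alpha_carrier: "alpha a \<in> carrier S"
  unfolding eta_def alpha_def by (rule pure_smash)+

lemma one_part: "1 \<in> apart A 0"
  unfolding ga.connected by (rule image_eqI[of _ _ 1]) simp_all

lemma eta_part: "eta h \<in> rpart S 0"
  by (simp add: eta_def tspan_pure one_part)

lemma alpha_part: "a \<in> apart A i \<Longrightarrow> alpha a \<in> rpart S i"
  by (simp add: alpha_def tspan_pure)

lemma eta_add: "eta (g + h) = eta g + eta h"
  by (simp add: eta_def tpure_add_right)

lemma eta_one: "eta 1 = one S"
  by (simp add: eta_def)

lemma alpha_add: "alpha (a + b) = alpha a + alpha b"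
  by (simp add: alpha_def tpure_add_left)

lemma alpha_one: "alpha 1 = one S"
  by (simp add: alpha_def)

lemma alpha_act_pure:
  "left_module univ_ring U \<Longrightarrow> u \<in> mcar U \<Longrightarrow>
    act (PM U) (alpha a) (tpure AS (BS U) b u) = tpure AS (BS U) (a * b) u"
  by (simp add: alpha_def proj_act_pure proj_term_one)

text \<open>\<open>H\<close> acts on \<open>1\<close> by the counit, so the counit axiom collapses
  the Sweedler sum. This makes \<open>1 \<otimes> U\<close> a copy of \<open>U\<close> in degree
  0.\<close>

lemma eta_act_one:
  assumes U: "left_module univ_ring U" and u: "u \<in> mcar U"
  shows "act (PM U) (eta h) (tpure AS (BS U) 1 u) = tpure AS (BS U) 1 (act U h u)"
proof -
  have "act (PM U) (eta h) (tpure AS (BS U) 1 u) =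
      sweedler H h (\<lambda>h1 h2. tpure AS (BS U) (ascale A (counit H h1) 1) (act U h2 u))"
    by (simp add: eta_def proj_act_pure[OF U u] proj_term_def action_one)
  also have "\<dots> = sweedler H h (\<lambda>h1 h2. tpure AS (BS U) 1 (act U (hscale H (counit H h1) h2) u))"
  proof -
    have "tpure AS (BS U) (ascale A c 1) (act U h2 u) = tpure AS (BS U) 1 (act U (hscale H c h2) u)"
      for c h2
      using tpure_scale_left[of 1 AS "act U h2 u" "BS U" c] tpure_scale_right[of 1 AS "act U h2 u" "BS U" c]
      by (simp add: act_U[OF U u] act_hscale(1)[OF U u, of c h2])
    then show ?thesis by simp
  qed
  also have "\<dots> = tpure AS (BS U) 1 (act U h u)"
    by (rule sweedler_counit_left)
      (use mod_add_left[OF U] u in \<open>simp add: additive_on_def tpure_add_right act_U[OF U u]\<close>)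
  finally show ?thesis .
qed

lemma alpha_mult_pure: "mult S (alpha a) (tpure AS HS b g) = tpure AS HS (a * b) g"
  using alpha_act_pure[OF regular_module_module, of g a b] by (simp add: proj_regular base_space_regular)

lemma eta_mult: "mult S (eta g) (eta h) = eta (g * h)"
  using eta_act_one[OF regular_module_module, of h g]
  by (simp add: proj_regular base_space_regular eta_def)

lemma alpha_eta: "mult S (alpha a) (eta h) = tpure AS HS a h"
  by (simp add: eta_def alpha_mult_pure)

lemma alpha_mult: "mult S (alpha a) (alpha b) = alpha (a * b)"
  by (simp add: alpha_def[of b] alpha_mult_pure) (simp add: alpha_def)

text \<open>The copies of the ground field in \<open>A\<close> and in \<open>H\<close> coincide in
  the smash product.\<close>

lemma eta_scalar: "eta (hscale H c 1) = alpha (ascale A c 1)"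
  using tpure_scale_left[of 1 AS 1 HS c] tpure_scale_right[of 1 AS 1 HS c]
  by (simp add: eta_def alpha_def)

lemma alpha_scale: "alpha (ascale A c a) = mult S (alpha a) (eta (hscale H c 1))"
  "alpha (ascale A c a) = mult S (eta (hscale H c 1)) (alpha a)"
  using ga.scale_mult_right[of c a 1] ga.scale_mult_left[of c 1 a]
  by (simp_all add: eta_scalar alpha_mult)

lemma smash_act_additive:
  assumes "left_module S M" "m \<in> mcar M"
  shows "additive_on (carrier S) (\<lambda>z. act M z m)"
  using mod_add_left[OF assms(1) _ _ assms(2)] by (simp add: additive_on_def)

lemma hmod_module:
  assumes M: "left_module S M" and X: "add_subgroup X" "X \<subseteq> mcar M"
    and cl: "\<And>h x. x \<in> X \<Longrightarrow> act M (eta h) x \<in> X"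
  shows "left_module univ_ring (HM M X)"
proof -
  have X': "x \<in> mcar M" if "x \<in> X" for x using that X by auto
  show ?thesis
    using mod_add_right[OF M eta_carrier X' X'] mod_add_left[OF M eta_carrier eta_carrier X']
      mod_mult[OF M eta_carrier eta_carrier X'] mod_one[OF M X']
    by unfold_locales (simp_all add: X cl eta_add eta_mult[symmetric] eta_one)
qed

lemma eta_act_part: "graded_module S M \<Longrightarrow> x \<in> mpart M n \<Longrightarrow> act M (eta h) x \<in> mpart M n"
  using graded_moduleD(3)[OF _ eta_part] by fastforce

lemma hmod_part:
  assumes "graded_module S M"
  shows "left_module univ_ring (HM M (mpart M n))"
  using graded_moduleD[OF assms] direct_decompositionD[OF graded_moduleD(2)[OF assms]]
  by (intro hmod_module eta_act_part[OF assms]) auto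

lemma hmod_full: "left_module S M \<Longrightarrow> left_module univ_ring (HM M (mcar M))"
  by (rule hmod_module) (auto intro: mod_subgroup mod_closed eta_carrier)

lemma proj_pure_one:
  "left_module univ_ring U \<Longrightarrow> u \<in> mcar U \<Longrightarrow>
    tpure AS (BS U) a u = act (PM U) (alpha a) (tpure AS (BS U) 1 u)"
  by (simp add: alpha_act_pure)

text \<open>The elements \<open>1 \<otimes> u\<close> generate \<open>A \<otimes> U\<close> over
  \<open>A\<close>. This is the uniqueness half of the adjunction.\<close>

lemma proj_hom_eqI:
  assumes U: "left_module univ_ring U"
    and f: "lmod_hom S (PM U) M f" and g: "lmod_hom S (PM U) M g"
    and eq: "\<And>u. u \<in> mcar U \<Longrightarrow> f (tpure AS (BS U) 1 u) = g (tpure AS (BS U) 1 u)"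
    and t: "t \<in> mcar (PM U)"
  shows "f t = g t"
proof (rule additive_on_tspan_eqI[OF _ _ _ t[unfolded proj_module_simps(1)]])
  fix a u assume u: "u \<in> mcar U"
  have 1: "tpure AS (BS U) 1 u \<in> mcar (PM U)" using u by (simp add: tspan_pure)
  have "f (act (PM U) (alpha a) (tpure AS (BS U) 1 u)) = g (act (PM U) (alpha a) (tpure AS (BS U) 1 u))"
    by (simp only: lmod_homD(3)[OF f alpha_carrier 1] lmod_homD(3)[OF g alpha_carrier 1] eq[OF u])
  then show "f (tpure AS (BS U) a u) = g (tpure AS (BS U) a u)"
    by (simp only: proj_pure_one[OF U u, symmetric])
qed (use lmod_homD(4)[OF f] lmod_homD(4)[OF g] in simp_all)

section \<open>The map out of \<open>PM U\<close> induced by an \<open>H\<close>-linear map\<close>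

context
  fixes M :: "(('k, 'a, 'h) tensor, 'm::ab_group_add, 'y) lmod_scheme"
    and U :: "('h, 'u::ab_group_add) lmod" and \<phi> :: "'u \<Rightarrow> 'm"
  assumes M: "left_module S M" and U: "left_module univ_ring U"
    and \<phi>: "lmod_hom univ_ring U (HM M (mcar M)) \<phi>"
begin

lemma induced_bilinear:
  "bilinear_map AS (BS U) (BS (HM M (mcar M))) (\<lambda>a u. act M (alpha a) (\<phi> u))"
proof -
  have 1: "\<phi> u \<in> mcar M" "act U h u \<in> mcar U" "\<phi> (act U h u) = act M (eta h) (\<phi> u)"
    if "u \<in> mcar U" for u h
    using lmod_homD(1,3)[OF \<phi>] that act_U[OF U] by simp_all
  have 2: "\<phi> (u + v) = \<phi> u + \<phi> v" if "u \<in> mcar U" "v \<in> mcar U" for u v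
    using lmod_homD(2)[OF \<phi> that] .
  show ?thesis
  proof (rule bilinear_mapI)
    fix c a u assume u: "u \<in> mcar (BS U)"
    show "act M (alpha (act AS c a)) (\<phi> u) = act (BS (HM M (mcar M))) c (act M (alpha a) (\<phi> u))"
      using mod_mult[OF M eta_carrier alpha_carrier 1(1)] u by (simp add: alpha_scale(2))
    show "act M (alpha a) (\<phi> (act (BS U) c u)) = act (BS (HM M (mcar M))) c (act M (alpha a) (\<phi> u))"
      using mod_mult[OF M eta_carrier alpha_carrier 1(1), of u "hscale H c 1" a]
        mod_mult[OF M alpha_carrier eta_carrier 1(1), of u a "hscale H c 1"] u
      by (simp add: 1 alpha_scale(1)[symmetric] alpha_scale(2)[symmetric])
  qed (use 1 2 mod_closed[OF M alpha_carrier] mod_add_right[OF M alpha_carrier]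
      mod_add_left[OF M alpha_carrier alpha_carrier] in \<open>simp_all add: alpha_add\<close>)
qed

lemma induced_target: "left_module univ_ring (BS (HM M (mcar M)))"
  by (rule base_space_module[OF hmod_full[OF M]])

lemma induced_map_eq: "induced_map H A M U \<phi> = tensor_lift AS (BS U) (\<lambda>a u. act M (alpha a) (\<phi> u))"
  by (simp add: induced_map_def alpha_def)

lemma induced_pure: "u \<in> mcar U \<Longrightarrow> induced_map H A M U \<phi> (tpure AS (BS U) a u) = act M (alpha a) (\<phi> u)"
  unfolding induced_map_eq by (rule tensor_lift_pure[OF induced_target induced_bilinear]) simp_all

lemma induced_pure_one: "u \<in> mcar U \<Longrightarrow> induced_map H A M U \<phi> (tpure AS (BS U) 1 u) = \<phi> u"
  using mod_one[OF M] lmod_homD(1)[OF \<phi>] by (simp add: induced_pure alpha_one)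

lemma induced_additive: "additive_on (mcar (PM U)) (induced_map H A M U \<phi>)"
  unfolding induced_map_eq using tensor_lift_additive_on[OF induced_target induced_bilinear] by simp

lemma induced_closed: "t \<in> mcar (PM U) \<Longrightarrow> induced_map H A M U \<phi> t \<in> mcar M"
  unfolding induced_map_eq using tensor_lift_closed[OF induced_target induced_bilinear] by simp

text \<open>The terms \<open>x h1(a) \<otimes> h2 u\<close> of the action go to
  \<open>x h1(a) # h2\<close> applied to \<open>\<phi> u\<close>, and these ring elements sum to the
  product of \<open>x # h\<close> and \<open>a # 1\<close>. Pure tensors suffice by additivity in
  both arguments.\<close>

lemma induced_hom: "lmod_hom S (PM U) M (induced_map H A M U \<phi>)"
proof (rule lmod_homI)
  let ?G = "induced_map H A M U \<phi>"
  show "?G t \<in> mcar M" if "t \<in> mcar (PM U)" for t by (rule induced_closed[OF that])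
  show "?G (s + t) = ?G s + ?G t" if "s \<in> mcar (PM U)" "t \<in> mcar (PM U)" for s t
    by (rule additive_onD[OF induced_additive that])
  have \<phi>M: "\<phi> u \<in> mcar M" if "u \<in> mcar U" for u using lmod_homD(1)[OF \<phi>] that by simp
  have TS: "add_subgroup (mcar (PM U))" using TU_subgroup[OF U] by simp
  note car = smash_simps(1)
  have pure: "?G (act (PM U) (tpure AS HS x h) (tpure AS (BS U) a u)) =
      act M (tpure AS HS x h) (?G (tpure AS (BS U) a u))" if u: "u \<in> mcar U" for x h a u
  proof -
    have "?G (act (PM U) (tpure AS HS x h) (tpure AS (BS U) a u)) =
        sweedler H h (\<lambda>h1 h2. ?G (tpure AS (BS U) (x * aact A h1 a) (act U h2 u)))"
      unfolding proj_act_pure[OF U u] proj_term_def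
      by (rule sweedler_additive[OF induced_additive TS]) (simp add: tspan_pure act_U[OF U u])
    also have "\<dots> = sweedler H h (\<lambda>h1 h2. act M (tpure AS HS (x * aact A h1 a) (h2 * 1)) (\<phi> u))"
      using lmod_homD(3)[OF \<phi> _ u] act_U[OF U u] mod_mult[OF M alpha_carrier eta_carrier \<phi>M[OF u]]
      by (simp add: induced_pure flip: alpha_eta)
    also have "\<dots> = act M (mult S (tpure AS HS x h) (alpha a)) (\<phi> u)"
      unfolding alpha_def smash_mult_pure
      by (rule sweedler_additive[OF smash_act_additive[OF M \<phi>M[OF u]] smash_subgroup pure_smash, symmetric])
    also have "\<dots> = act M (tpure AS HS x h) (?G (tpure AS (BS U) a u))"
      using mod_mult[OF M pure_smash alpha_carrier \<phi>M[OF u]] u by (simp add: induced_pure)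
    finally show ?thesis .
  qed
  show "?G (act (PM U) z t) = act M z (?G t)" if z: "z \<in> carrier S" and t: "t \<in> mcar (PM U)" for z t
  proof (rule additive_on_tspan_eqI[OF _ _ _ z[unfolded car]])
    show "additive_on (tspan AS HS UNIV UNIV) (\<lambda>z. ?G (act (PM U) z t))"
      unfolding car[symmetric]
      by (rule additive_on_comp[OF induced_additive proj_act_additive_left[OF U t]])
        (use proj_act_closed[OF U _ t] in blast)
    show "additive_on (tspan AS HS UNIV UNIV) (\<lambda>z. act M z (?G t))"
      unfolding car[symmetric] by (rule smash_act_additive[OF M induced_closed[OF t]])
    fix x h
    show "?G (act (PM U) (tpure AS HS x h) t) = act M (tpure AS HS x h) (?G t)"
    proof (rule additive_on_tspan_eqI[OF _ _ _ t[unfolded proj_module_simps(1)]])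
      show "additive_on (tspan AS (BS U) UNIV (mcar U)) (\<lambda>t. ?G (act (PM U) (tpure AS HS x h) t))"
        unfolding proj_module_simps(1)[symmetric]
        by (rule additive_on_comp[OF induced_additive proj_act_additive_right[OF U pure_smash]])
          (use proj_act_closed[OF U pure_smash] in blast)
      show "additive_on (tspan AS (BS U) UNIV (mcar U)) (\<lambda>t. act M (tpure AS HS x h) (?G t))"
        unfolding proj_module_simps(1)[symmetric]
        by (rule additive_on_comp[OF left_module.act_additive[OF M pure_smash] induced_additive])
          (use induced_closed in blast)
    qed (rule pure)
  qed
qed

end

text \<open>Degree \<open>i\<close> of \<open>shift M k\<close> is degree \<open>i + k\<close> of
  \<open>M\<close>. Shifting by \<open>- n\<close> therefore puts the generators
  \<open>1 \<otimes> u\<close> in degree \<open>n\<close>, where \<open>\<phi>\<close> sends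
  them.\<close>

lemma induced_graded:
  assumes M: "graded_module S M" and U: "left_module univ_ring U"
    and \<phi>: "lmod_hom univ_ring U (HM M (mpart M n)) \<phi>"
  shows "lmod_hom univ_ring U (HM M (mcar M)) \<phi>"
    and "graded_hom S (shift (PM U) (- n)) M (induced_map H A M U \<phi>)"
proof -
  note Mm = graded_moduleD(1)[OF M]
  show \<phi>': "lmod_hom univ_ring U (HM M (mcar M)) \<phi>"
    using \<phi> graded_moduleD(4)[OF M] by (auto simp: lmod_hom_def)
  have 1: "induced_map H A M U \<phi> t \<in> mpart M (int k + n)"
    if "t \<in> tspan AS (BS U) (apart A k) (mcar U)" for t k
  proof -
    have sub: "add_subgroup (mpart M (int k + n))"
      by (rule direct_decompositionD(2)[OF graded_moduleD(2)[OF M]])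
    have "tspan AS (BS U) (apart A k) (mcar U) \<subseteq> mcar (PM U)"
      using tspan_mono[of "apart A k" UNIV "mcar U" "mcar U"] by simp
    note in_PM = subsetD[OF this]
    show "induced_map H A M U \<phi> t \<in> mpart M (int k + n)"
      using that
    proof (induction rule: tspan_induct)
      case zero
      have "induced_map H A M U \<phi> 0 = 0"
        by (rule additive_on_zero[OF induced_additive[OF Mm U \<phi>']]) (use TU_subgroup[OF U] in simp)
      then show ?case using add_subgroup_zero[OF sub] by simp
    next
      case (add v w t)
      have "induced_map H A M U \<phi> (tpure AS (BS U) v w + t) =
          act M (alpha v) (\<phi> w) + induced_map H A M U \<phi> t"
        using additive_onD[OF induced_additive[OF Mm U \<phi>'] in_PM in_PM] add
        by (simp add: tspan_pure induced_pure[OF Mm U \<phi>'])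
      moreover have "act M (alpha v) (\<phi> w) \<in> mpart M (int k + n)"
        using graded_moduleD(3)[OF M alpha_part] lmod_homD(1)[OF \<phi>] add by simp
      ultimately show ?case using add add_subgroup_add[OF sub] by simp
    qed
  qed
  have 2: "induced_map H A M U \<phi> 0 \<in> mpart M k" for k
  proof -
    have "induced_map H A M U \<phi> 0 = 0"
      by (rule additive_on_zero[OF induced_additive[OF Mm U \<phi>']]) (use TU_subgroup[OF U] in simp)
    then show ?thesis
      using add_subgroup_zero[OF direct_decompositionD(2)[OF graded_moduleD(2)[OF M]]] by simp
  qed
  have "lmod_hom S (shift (PM U) (- n)) M (induced_map H A M U \<phi>)"
    using induced_hom[OF Mm U \<phi>'] by (simp add: lmod_hom_def shift_def)
  then show "graded_hom S (shift (PM U) (- n)) M (induced_map H A M U \<phi>)"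
    unfolding graded_hom_def
  proof (intro conjI allI ballI)
    fix i t assume t: "t \<in> mpart (shift (PM U) (- n)) i"
    show "induced_map H A M U \<phi> t \<in> mpart M i"
    proof (cases "0 \<le> i - n")
      case True
      then have "t \<in> tspan AS (BS U) (apart A (nat (i - n))) (mcar U)" using t by (simp add: shift_def)
      from 1[OF this] True show ?thesis by simp
    next
      case False
      then have "t = 0" using t by (simp add: shift_def)
      then show ?thesis using 2 by simp
    qed
  qed
qed


section \<open>Graded projective modules generated in one degree\<close>

lemma shift_simps [simp]:
  "mcar (shift M n) = mcar M" "act (shift M n) = act M" "mpart (shift M n) i = mpart M (i + n)"
  by (simp_all add: shift_def)

lemma pure_one_hom:
  assumes U: "left_module univ_ring U"
  shows "lmod_hom univ_ring U (HM (PM U) (mpart (PM U) 0)) (tpure AS (BS U) 1)"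
  by (rule lmod_homI)
    (use act_U[OF U] in \<open>simp_all add: tspan_pure one_part tpure_add_right eta_act_one[OF U]\<close>)

text \<open>As \<open>A\<close> is connected, its degree 0 part consists of scalars, and scalars
  move into the second factor.\<close>

lemma pure_one_surj:
  fixes U :: "('h, 'u::ab_group_add) lmod"
  assumes U: "left_module univ_ring U" and t: "t \<in> tspan AS (BS U) (apart A 0) (mcar U)"
  shows "\<exists>u\<in>mcar U. t = tpure AS (BS U) 1 u"
  using t
proof (induction rule: tspan_induct)
  case zero
  have "tpure AS (BS U) 1 0 = 0"
    by (rule additive_on_zero[OF lmod_homD(4)[OF pure_one_hom[OF U]] mod_subgroup[OF U]])
  then show ?case using left_module.mcar_zero[OF U] by metis
next
  case (add v w t)
  obtain c where v: "v = ascale A c 1" using add(1) by (auto simp: ga.connected)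
  obtain u where u: "u \<in> mcar U" "t = tpure AS (BS U) 1 u" using add by auto
  let ?w = "act U (hscale H c 1) w"
  have w: "?w \<in> mcar U" using act_U[OF U add(2)] .
  have "tpure AS (BS U) v w = tpure AS (BS U) 1 ?w"
    using tpure_scale_left[of 1 AS w "BS U" c] tpure_scale_right[of 1 AS w "BS U" c] add(2) by (simp add: v)
  then have "tpure AS (BS U) v w + t = tpure AS (BS U) 1 (?w + u)"
    using u w by (simp add: tpure_add_right)
  then show ?case using left_module.mcar_add[OF U w u(1)] by blast
qed

text \<open>The map out of a free module that sends the basis vector at \<open>x\<close> to
  \<open>p x\<close>.\<close>

definition eval_map :: "(('k, 'a, 'h) tensor, 't::ab_group_add) glmod \<Rightarrow> ('i \<Rightarrow> 't) \<Rightarrow> ('i \<Rightarrow> ('k, 'a, 'h) tensor) \<Rightarrow> 't"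
  where "eval_map T p f = (\<Sum>x | f x \<noteq> 0. act T (f x) (p x))"

abbreviation "free_gmod I n \<equiv> dsum_gmod I (PM regular_module) n"

lemma free_gmod_graded: "graded_module S (free_gmod I n)"
  by (rule dsum_gmod_graded[OF proj_module_graded[OF regular_module_module]])

lemma free_gmodD:
  assumes "f \<in> mcar (free_gmod I n)"
  shows "finite {x. f x \<noteq> 0}" "f x \<in> carrier S" "f x \<noteq> 0 \<Longrightarrow> x \<in> I"
  using assms add_subgroup_zero[OF smash_subgroup]
  by (auto simp: lmod_dsum_simps proj_regular simp del: proj_module_simps)

lemma eval_map_superset:
  assumes T: "left_module S T" and p: "\<And>x. x \<in> J \<Longrightarrow> p x \<in> mcar T"
    and J: "finite J" "{x. f x \<noteq> 0} \<subseteq> J"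
  shows "eval_map T p f = (\<Sum>x\<in>J. act T (f x) (p x))"
  unfolding eval_map_def
proof (rule sum.mono_neutral_left[OF J])
  show "\<forall>x\<in>J - {x. f x \<noteq> 0}. act T (f x) (p x) = 0"
    using additive_on_zero[OF smash_act_additive[OF T p] smash_subgroup] by auto
qed

lemma eval_map_delta:
  assumes T: "left_module S T" and "p x \<in> mcar T"
  shows "eval_map T p (\<lambda>y. if y = x then one S else 0) = p x"
proof -
  have "eval_map T p (\<lambda>y. if y = x then one S else 0) =
      (\<Sum>y\<in>{x}. act T (if y = x then one S else 0) (p y))"
    by (rule eval_map_superset[OF T]) (use assms(2) in auto)
  then show ?thesis using mod_one[OF T assms(2)] by simp
qed

lemma eval_map_hom:
  assumes T: "graded_module S T" and p: "\<And>x. x \<in> I \<Longrightarrow> p x \<in> mpart T n"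
  shows "graded_hom S (free_gmod I n) T (eval_map T p)"
proof -
  note TL = graded_moduleD(1)[OF T]
  note TS = mod_subgroup[OF TL]
  have pT: "p x \<in> mcar T" if "x \<in> I" for x using graded_moduleD(4)[OF T p[OF that]] .
  note F = free_gmodD
  have supp: "{x. f x \<noteq> 0} \<subseteq> I" if "f \<in> mcar (free_gmod I n)" for f
    using F(3)[OF that] by auto
  have hom: "lmod_hom S (free_gmod I n) T (eval_map T p)"
  proof (rule lmod_homI)
    fix f assume f: "f \<in> mcar (free_gmod I n)"
    show "eval_map T p f \<in> mcar T"
      unfolding eval_map_def
      by (rule add_subgroup_sum[OF TS]) (use F[OF f] pT mod_closed[OF TL] in blast)
    show "eval_map T p (f + g) = eval_map T p f + eval_map T p g"
      if g: "g \<in> mcar (free_gmod I n)" for g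
    proof -
      let ?J = "{x. f x \<noteq> 0} \<union> {x. g x \<noteq> 0}"
      have J: "finite ?J" "?J \<subseteq> I" using F(1)[OF f] F(1)[OF g] supp[OF f] supp[OF g] by auto
      have s: "eval_map T p h = (\<Sum>x\<in>?J. act T (h x) (p x))" if "{x. h x \<noteq> 0} \<subseteq> ?J" for h
        by (rule eval_map_superset[OF TL _ J(1) that]) (use J(2) pT in blast)
      have "eval_map T p (f + g) = (\<Sum>x\<in>?J. act T (f x + g x) (p x))"
        by (subst s) (auto simp: plus_fun_apply)
      also have "\<dots> = (\<Sum>x\<in>?J. act T (f x) (p x) + act T (g x) (p x))"
      proof (rule sum.cong[OF refl])
        fix x assume "x \<in> ?J"
        then have "p x \<in> mcar T" using J(2) pT by blast
        from mod_add_left[OF TL F(2)[OF f] F(2)[OF g] this]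
        show "act T (f x + g x) (p x) = act T (f x) (p x) + act T (g x) (p x)" by simp
      qed
      also have "\<dots> = eval_map T p f + eval_map T p g"
        by (simp add: sum.distrib s)
      finally show ?thesis .
    qed
    show "eval_map T p (act (free_gmod I n) r f) = act T r (eval_map T p f)" if r: "r \<in> carrier S" for r
    proof -
      let ?J = "{x. f x \<noteq> 0}"
      have rf: "act (lmod_dsum I (\<lambda>_. PM regular_module)) r f x = (if x \<in> I then mult S r (f x) else 0)" for x
        by (simp add: lmod_dsum_simps proj_regular)
      have z: "mult S r 0 = 0" by (rule additive_on_zero[OF smash_mult_additive(1)[OF r] smash_subgroup])
      have J: "finite ?J" "{x. act (free_gmod I n) r f x \<noteq> 0} \<subseteq> ?J"
        using F(1)[OF f] z by (auto simp: rf)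
      have pJ: "p x \<in> mcar T" if "x \<in> ?J" for x using that supp[OF f] pT by blast
      have "eval_map T p (act (free_gmod I n) r f) = (\<Sum>x\<in>?J. act T (act (free_gmod I n) r f x) (p x))"
        by (rule eval_map_superset[OF TL pJ J])
      also have "\<dots> = (\<Sum>x\<in>?J. act T r (act T (f x) (p x)))"
        by (rule sum.cong[OF refl])
          (use mod_mult[OF TL r F(2)[OF f] pJ] supp[OF f] in \<open>auto simp: rf\<close>)
      also have "\<dots> = act T r (eval_map T p f)"
        unfolding eval_map_def
        by (rule additive_on_sum[OF left_module.act_additive[OF TL r] TS, symmetric])
          (rule mod_closed[OF TL F(2)[OF f] pJ])
      finally show ?thesis .
    qed
  qed
  moreover have "eval_map T p f \<in> mpart T i" if f: "f \<in> mpart (free_gmod I n) i" for f i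
    unfolding eval_map_def
  proof (rule add_subgroup_sum[OF direct_decompositionD(2)[OF graded_moduleD(2)[OF T]]])
    fix x assume "x \<in> {x. f x \<noteq> 0}"
    then have x: "f x \<noteq> 0" "x \<in> I" using f by (auto simp: lmod_dsum_simps)
    then have "f x \<in> mpart (PM regular_module) (i - n)" using f by (simp del: proj_module_simps)
    \<comment> \<open>The coefficient is nonzero, which excludes the negative degrees, where
      \<open>PM\<close> vanishes.\<close>
    then have "0 \<le> i - n" "f x \<in> rpart S (nat (i - n))"
      using x(1) proj_regular(3)[of "nat (i - n)"] by (auto split: if_splits simp: base_space_regular)
    then show "act T (f x) (p x) \<in> mpart T i"
      using graded_moduleD(3)[OF T _ p[OF x(2)], of "f x" "nat (i - n)"] by simp
  qed
  ultimately show ?thesis unfolding graded_hom_def by blast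
qed

text \<open>The test module against which projectivity is used is free on \<open>mpart Q n\<close>; a section of
  its evaluation onto \<open>Q\<close>, followed by the map with \<open>u \<mapsto> 1 \<otimes> u\<close> on the basis, is the identity on
  the generators \<open>1 \<otimes> u\<close>.\<close>

lemma graded_projective_generated:
  fixes Q :: "(('k, 'a, 'h) tensor, 'q::ab_group_add) glmod"
  defines "U \<equiv> \<lambda>n. HM Q (mpart Q n)"
  assumes Q: "graded_projective S Q"
    and gen: "induced_map H A Q (U n) (\<lambda>u. u) ` mcar (PM (U n)) = mcar Q"
  obtains l where "graded_hom S Q (shift (PM (U n)) (- n)) l"
    "\<And>t. t \<in> mcar (PM (U n)) \<Longrightarrow> l (induced_map H A Q (U n) (\<lambda>u. u) t) = t"
proof -
  have Qg: "graded_module S Q" using Q by (simp add: graded_projective_def)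
  note QL = graded_moduleD(1)[OF Qg]
  have Um: "left_module univ_ring (U n)" unfolding U_def by (rule hmod_part[OF Qg])
  let ?I = "mpart Q n" and ?P = "shift (PM (U n)) (- n)" and ?G = "induced_map H A Q (U n) (\<lambda>u. u)"
  \<comment> \<open>Taking all of \<open>mpart Q n\<close> as the basis gives this free module
    exactly the type of the test modules in \<open>graded_projective\<close>.\<close>
  let ?F = "free_gmod ?I n"
  have id: "lmod_hom univ_ring (U n) (HM Q (mpart Q n)) (\<lambda>u. u)"
    by (simp add: U_def lmod_hom_def)
  note G = induced_graded[OF Qg Um id]
  have Pg: "graded_module S ?P" by (rule graded_module_shift[OF proj_module_graded[OF Um]])
  have ev: "graded_hom S ?F Q (eval_map Q (\<lambda>u. u))" by (rule eval_map_hom[OF Qg])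
  have mU: "mcar (U n) = ?I" by (simp add: U_def)
  have ev': "graded_hom S ?F ?P (eval_map ?P (tpure AS (BS (U n)) 1))"
    by (rule eval_map_hom[OF Pg]) (simp add: tspan_pure one_part mU)
  note evh = lmod_homD[OF graded_homD(1)[OF ev]]
  \<comment> \<open>The image is a submodule containing degree \<open>n\<close> of \<open>Q\<close>,
    which generates \<open>Q\<close> by assumption.\<close>
  have "eval_map Q (\<lambda>u. u) ` mcar ?F = mcar Q"
  proof
    show "eval_map Q (\<lambda>u. u) ` mcar ?F \<subseteq> mcar Q" using evh(1) by blast
    let ?X = "eval_map Q (\<lambda>u. u) ` mcar ?F"
    have X: "submodule S Q ?X"
      using graded_submodule_image[OF free_gmod_graded Qg ev] by (simp add: graded_submodule_def)
    have IX: "u \<in> ?X" if u: "u \<in> ?I" for u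
    proof (rule image_eqI)
      show "u = eval_map Q (\<lambda>u. u) (\<lambda>y. if y = u then one S else 0)"
        using eval_map_delta[OF QL, of "\<lambda>u. u" u] graded_moduleD(4)[OF Qg u] by simp
      show "(\<lambda>y. if y = u then one S else 0) \<in> mcar ?F"
        using delta_dsum[where I = ?I and R = S and M = "\<lambda>_. PM regular_module" and j = u and x = "one S"]
          proj_module_left[OF regular_module_module] u eta_carrier[of 1]
        by (simp add: eta_one proj_regular del: proj_module_simps)
    qed
    have "?G t \<in> ?X" if "t \<in> mcar (PM (U n))" for t
    proof -
      have "t \<in> tspan AS (BS (U n)) UNIV (mcar (U n))" using that by simp
      then show ?thesis
      proof (induction rule: tspan_induct)
        case zero
        have "?G 0 = 0"
          by (rule additive_on_zero[OF induced_additive[OF QL Um G(1)]]) (use TU_subgroup[OF Um] in simp)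
        then show ?case using add_subgroup_zero[OF submoduleD(2)[OF X]] by simp
      next
        case (add v w t)
        have "?G (tpure AS (BS (U n)) v w + t) = act Q (alpha v) w + ?G t"
          using additive_onD[OF induced_additive[OF QL Um G(1)], of "tpure AS (BS (U n)) v w" t] add
          by (simp add: tspan_pure induced_pure[OF QL Um G(1)])
        moreover have "act Q (alpha v) w \<in> ?X"
          using submoduleD(3)[OF X alpha_carrier IX] add by (simp add: mU)
        ultimately show ?case using add add_subgroup_add[OF submoduleD(2)[OF X]] by simp
      qed
    qed
    then show "mcar Q \<subseteq> ?X" unfolding gen[symmetric] by blast
  qed
  moreover have "graded_hom S Q Q (\<lambda>x. x)" by (simp add: graded_hom_def lmod_hom_def)
  ultimately have "graded_module S ?F \<and> graded_module S Q \<and> graded_hom S ?F Q (eval_map Q (\<lambda>u. u)) \<and>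
      eval_map Q (\<lambda>u. u) ` mcar ?F = mcar Q \<and> graded_hom S Q Q (\<lambda>x. x)"
    by (intro conjI free_gmod_graded Qg ev)
  from conjunct2[OF Q[unfolded graded_projective_def], rule_format, OF this]
  obtain \<sigma> where \<sigma>: "graded_hom S Q ?F \<sigma>" "\<forall>x\<in>mcar Q. eval_map Q (\<lambda>u. u) (\<sigma> x) = x"
    by (elim exE conjE) rule
  let ?l = "\<lambda>x. eval_map ?P (tpure AS (BS (U n)) 1) (\<sigma> x)"
  have l: "graded_hom S Q ?P ?l" by (rule graded_hom_comp[OF \<sigma>(1) ev'])
  have l1: "?l u = tpure AS (BS (U n)) 1 u" if u: "u \<in> ?I" for u
  proof -
    define f where "f = \<sigma> u"
    have f: "f \<in> mpart ?F n" unfolding f_def by (rule graded_homD(2)[OF \<sigma>(1) u])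
    \<comment> \<open>The basis sits in degree \<open>n\<close>, so an element of degree
      \<open>n\<close> has coefficients in degree 0 of the ring, which is the copy of
      \<open>H\<close>.\<close>
    have "\<exists>h. f x = eta h" if "x \<in> ?I" for x
    proof -
      have "f x \<in> mpart (PM regular_module) 0" using f that by (simp del: proj_module_simps)
      then have "f x \<in> tspan AS (BS regular_module) (apart A 0) (mcar regular_module)" by simp
      from pure_one_surj[OF regular_module_module this] show ?thesis
        by (auto simp: base_space_regular eta_def)
    qed
    then obtain h where h: "\<And>x. x \<in> ?I \<Longrightarrow> f x = eta (h x)" by metis
    have fF: "f \<in> mcar ?F" using f by simp
    let ?J = "{x. f x \<noteq> 0}"
    have J: "x \<in> ?I" if "x \<in> ?J" for x using free_gmodD(3)[OF fF] that by auto
    note add1 = lmod_homD(4)[OF pure_one_hom[OF Um]]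
    have "?l u = (\<Sum>x\<in>?J. act (PM (U n)) (eta (h x)) (tpure AS (BS (U n)) 1 x))"
      unfolding eval_map_def f_def[symmetric] by (rule sum.cong[OF refl]) (simp only: h[OF J] shift_simps)
    also have "\<dots> = (\<Sum>x\<in>?J. tpure AS (BS (U n)) 1 (act (U n) (h x) x))"
      by (rule sum.cong[OF refl]) (rule eta_act_one[OF Um], unfold mU, rule J)
    also have "\<dots> = tpure AS (BS (U n)) 1 (\<Sum>x\<in>?J. act (U n) (h x) x)"
      by (rule additive_on_sum[OF add1 mod_subgroup[OF Um], symmetric])
        (rule act_U[OF Um], unfold mU, rule J)
    also have "(\<Sum>x\<in>?J. act (U n) (h x) x) = eval_map Q (\<lambda>u. u) f"
      unfolding eval_map_def by (rule sum.cong[OF refl]) (simp only: h[OF J] U_def hmod_simps)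
    also have "\<dots> = u" unfolding f_def by (rule bspec[OF \<sigma>(2) graded_moduleD(4)[OF Qg u]])
    finally show ?thesis .
  qed
  show ?thesis
  proof (rule that[OF l])
    fix t assume t: "t \<in> mcar (PM (U n))"
    have Gh: "lmod_hom S (PM (U n)) Q ?G" by (rule induced_hom[OF QL Um G(1)])
    have lh: "lmod_hom S Q (PM (U n)) ?l"
      using graded_homD(1)[OF l] by (simp add: lmod_hom_def del: proj_module_simps)
    show "?l (?G t) = t"
    proof (rule proj_hom_eqI[OF Um _ _ _ t])
      show "lmod_hom S (PM (U n)) (PM (U n)) (\<lambda>t. ?l (?G t))" by (rule lmod_hom_comp[OF Gh lh])
      show "lmod_hom S (PM (U n)) (PM (U n)) (\<lambda>t. t)" by (simp add: lmod_hom_def)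
      show "?l (?G (tpure AS (BS (U n)) 1 u)) = tpure AS (BS (U n)) 1 u" if "u \<in> mcar (U n)" for u
        using l1 induced_pure_one[OF QL Um G(1) that] that by (simp add: mU)
    qed
  qed
qed

end


section \<open>Semisimple modules\<close>

lemma submodule_self: "left_module R M \<Longrightarrow> submodule R M (mcar M)"
  by (simp add: submodule_def mod_subgroup mod_closed)

lemma submodule_zero: "left_module R M \<Longrightarrow> submodule R M {0}"
  by (simp add: submodule_def add_subgroup_singleton left_module.mcar_zero left_module.act_zero_right)

lemma submodule_plus:
  assumes M: "left_module R M" and X: "submodule R M X" and Y: "submodule R M Y"
  shows "submodule R M {x + y |x y. x \<in> X \<and> y \<in> Y}"
proof -
  note X' = submoduleD[OF X] and Y' = submoduleD[OF Y]
  have "add_subgroup {x + y |x y. x \<in> X \<and> y \<in> Y}" (is "add_subgroup ?Z")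
  proof (rule add_subgroupI)
    show "0 \<in> ?Z"
      using add_subgroup_zero[OF X'(2)] add_subgroup_zero[OF Y'(2)] by (intro CollectI exI[of _ 0]) simp
    show "a + b \<in> ?Z" if ab: "a \<in> ?Z" "b \<in> ?Z" for a b
    proof -
      obtain x y x' y' where "a = x + y" "b = x' + y'" "x \<in> X" "y \<in> Y" "x' \<in> X" "y' \<in> Y"
        using ab by auto
      then show ?thesis
        using add_subgroup_add[OF X'(2), of x x'] add_subgroup_add[OF Y'(2), of y y']
        by (intro CollectI exI[of _ "x + x'"] exI[of _ "y + y'"]) simp
    qed
    show "- a \<in> ?Z" if a: "a \<in> ?Z" for a
    proof -
      obtain x y where "a = x + y" "x \<in> X" "y \<in> Y" using a by auto
      then show ?thesis
        using add_subgroup_minus[OF X'(2), of x] add_subgroup_minus[OF Y'(2), of y]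
        by (intro CollectI exI[of _ "- x"] exI[of _ "- y"]) simp
    qed
  qed
  moreover have "act M r (x + y) \<in> ?Z" if "r \<in> carrier R" "x \<in> X" "y \<in> Y" for r x y
    using that X'(3) Y'(3) mod_add_right[OF M that(1), of x y] subsetD[OF X'(1)] subsetD[OF Y'(1)]
    by blast
  moreover have "?Z \<subseteq> mcar M"
    using subsetD[OF X'(1)] subsetD[OF Y'(1)] left_module.mcar_add[OF M] by blast
  ultimately show ?thesis unfolding submodule_def by blast
qed

lemma submodule_image:
  assumes M: "left_module R M" and f: "lmod_hom R M N f" and X: "submodule R M X"
  shows "submodule R N (f ` X)"
proof -
  note h = lmod_homD[OF f] and X' = submoduleD[OF X]
  have "add_subgroup (f ` X)"
    by (rule add_subgroup_image[OF additive_on_subset[OF h(4) X'(1)] X'(2)])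
  moreover have "act N r (f x) \<in> f ` X" if "r \<in> carrier R" "x \<in> X" for r x
    using h(3)[OF that(1), of x, symmetric] X'(1) X'(3)[OF that] that(2) by auto
  ultimately show ?thesis
    unfolding submodule_def using h(1) X'(1) by blast
qed

text \<open>Schur's lemma.\<close>

lemma simple_hom_zero_or_iso:
  assumes M: "simple_module R M" and N: "simple_module R N" and f: "lmod_hom R M N f"
    and nz: "x \<in> mcar M" "f x \<noteq> 0"
  shows "lmod_iso R M N"
proof -
  have Mm: "left_module R M" and Nm: "left_module R N" using M N by (auto simp: simple_module_def)
  have "mod_ker M f = {0}"
  proof -
    have "mod_ker M f \<noteq> mcar M" using nz by (auto simp: mod_ker_def)
    then show ?thesis using submodule_ker[OF Mm Nm f] M unfolding simple_module_def by blast
  qed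
  then have inj: "inj_on f (mcar M)"
    by (intro inj_on_additive[OF lmod_homD(4)[OF f] mod_subgroup[OF Mm]]) (auto simp: mod_ker_def)
  have "f ` mcar M = mcar N"
    using submodule_image[OF Mm f submodule_self[OF Mm]] N nz unfolding simple_module_def by blast
  then show ?thesis unfolding lmod_iso_def bij_betw_def using f inj by blast
qed

section \<open>Modules over a ring that is its own socle\<close>

abbreviation left_ideal :: "'h::ring_1 set \<Rightarrow> bool" where
  "left_ideal \<equiv> submodule univ_ring regular_module"

definition simple_ideal :: "'h::ring_1 set \<Rightarrow> bool" where
  "simple_ideal L \<longleftrightarrow> left_ideal L \<and> L \<noteq> {0} \<and> (\<forall>X. left_ideal X \<and> X \<subseteq> L \<longrightarrow> X = {0} \<or> X = L)"

lemma left_idealD: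
  assumes "left_ideal I"
  shows "add_subgroup I" "x \<in> I \<Longrightarrow> h * x \<in> I"
  using submoduleD(2,3)[OF assms] by simp_all

lemma left_idealI: "add_subgroup I \<Longrightarrow> (\<And>h x. x \<in> I \<Longrightarrow> h * x \<in> I) \<Longrightarrow> left_ideal I"
  by (simp add: submodule_def)

lemma simple_ideal_module:
  assumes "simple_ideal L"
  shows "simple_module univ_ring \<lparr>mcar = L, act = (*)\<rparr>"
proof -
  have "left_ideal L" using assms by (simp add: simple_ideal_def)
  then have "left_module univ_ring \<lparr>mcar = L, act = (*)\<rparr>"
    by unfold_locales (simp_all add: left_idealD distrib_left distrib_right mult.assoc)
  moreover have "left_ideal X" if "submodule univ_ring \<lparr>mcar = L, act = (*)\<rparr> X" for X
    using that by (auto simp: submodule_def)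
  ultimately show ?thesis
    using assms unfolding simple_module_def simple_ideal_def by (auto simp: submodule_def)
qed

lemma orbit_hom:
  "left_module univ_ring U \<Longrightarrow> x \<in> mcar U \<Longrightarrow> lmod_hom univ_ring regular_module U (\<lambda>h. act U h x)"
  by (rule lmod_homI)
    (simp_all add: mod_closed[of univ_ring] mod_add_left[of univ_ring U, simplified] mod_mult[of univ_ring U, simplified])

text \<open>The form of semisimplicity that transfers to modules of any type: the set of ring
  elements that carry \<open>x\<close> into a submodule is a left ideal, and if it is proper then it
  misses part of some simple left ideal.\<close>

locale socle_ring =
  fixes type_h :: "'h::ring_1 itself"
  assumes socle: "\<And>I :: 'h set. left_ideal I \<Longrightarrow> (\<And>L. simple_ideal L \<Longrightarrow> L \<subseteq> I) \<Longrightarrow> I = UNIV"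
begin

context
  fixes U :: "('h, 'u::ab_group_add) lmod"
  assumes U: "left_module univ_ring U"
begin

lemma act_U_closed: "x \<in> mcar U \<Longrightarrow> act U h x \<in> mcar U"
  using mod_closed[OF U] by simp

lemma transporter_ideal:
  assumes Z: "submodule univ_ring U Z" and x: "x \<in> mcar U"
  shows "left_ideal {h. act U h x \<in> Z}"
proof (rule left_idealI)
  show "add_subgroup {h. act U h x \<in> Z}"
    by (rule add_subgroup_vimage[OF _ submoduleD(2)[OF Z]])
      (use lmod_homD(4)[OF orbit_hom[OF U x]] in simp)
  show "g * h \<in> {h. act U h x \<in> Z}" if "h \<in> {h. act U h x \<in> Z}" for g h
    using that submoduleD(3)[OF Z] mod_mult[OF U _ _ x] by simp
qed

text \<open>Otherwise the elements carrying \<open>x\<close> into \<open>Z\<close> would form a left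
  ideal that contains all simple ones, hence also \<open>1\<close>.\<close>

lemma simple_ideal_escapes:
  assumes Z: "submodule univ_ring U Z" and x: "x \<in> mcar U" "x \<notin> Z"
  obtains L l where "simple_ideal L" "l \<in> L" "act U l x \<notin> Z"
proof -
  have "1 \<notin> {h. act U h x \<in> Z}" using x mod_one[OF U] by simp
  then show ?thesis using socle[OF transporter_ideal[OF Z x(1)]] that by blast
qed

text \<open>The elements of \<open>L\<close> that carry \<open>x\<close> into \<open>Z\<close> form
  a left ideal, which differs from \<open>L\<close> because of \<open>l\<close>. So
  \<open>L x\<close> is a copy of \<open>L\<close> that meets \<open>Z\<close> trivially.\<close>

lemma simple_ideal_avoids:
  assumes L: "simple_ideal L" and Z: "submodule univ_ring U Z" and x: "x \<in> mcar U"
    and l: "l \<in> L" "act U l x \<notin> Z" and k: "k \<in> L" "act U k x \<in> Z"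
  shows "k = 0"
proof -
  let ?K = "L \<inter> {h. act U h x \<in> Z}"
  have LL: "left_ideal L" using L by (simp add: simple_ideal_def)
  have "left_ideal ?K"
    using left_idealD[OF LL] left_idealD[OF transporter_ideal[OF Z x]]
    by (intro left_idealI add_subgroup_Int) auto
  moreover have "?K \<noteq> L" using l by blast
  ultimately have "?K = {0}" using L unfolding simple_ideal_def by blast
  then show ?thesis using k by blast
qed

lemma ideal_orbit_submodule:
  assumes "left_ideal L" "x \<in> mcar U"
  shows "submodule univ_ring U ((\<lambda>l. act U l x) ` L)"
  by (rule submodule_image[OF regular_module_module orbit_hom[OF U assms(2)] assms(1)])

text \<open>By Zorn's lemma choose \<open>Y\<close> maximal among the submodules that meet
  \<open>Z\<close> trivially. If \<open>Z + Y\<close> missed some \<open>x\<close>, a simple left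
  ideal \<open>L\<close> would have an orbit \<open>L x\<close> meeting \<open>Z + Y\<close>
  trivially and not contained in it, and \<open>Y + L x\<close> would contradict maximality.\<close>

lemma submodule_complement:
  assumes Z: "submodule univ_ring U Z"
  shows "\<exists>Y. submodule univ_ring U Y \<and> complementary U Z Y"
proof -
  let ?A = "{Y. submodule univ_ring U Y \<and> Z \<inter> Y = {0}}"
  have Z0: "0 \<in> Z" by (rule add_subgroup_zero[OF submoduleD(2)[OF Z]])
  have "\<exists>Y\<in>?A. \<forall>X\<in>?A. Y \<subseteq> X \<longrightarrow> X = Y"
  proof (rule subset_Zorn_nonempty)
    show "?A \<noteq> {}" using submodule_zero[OF U] Z0 by blast
    fix C assume C: "C \<noteq> {}" "subset.chain ?A C"
    have C_sub: "C \<subseteq> ?A" using C(2) by (simp add: subset_chain_def)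
    have CA: "submodule univ_ring U Y" "Z \<inter> Y = {0}" if "Y \<in> C" for Y
      using subsetD[OF C_sub that] by simp_all
    note CS = submoduleD(2)[OF CA(1)]
    have total: "\<exists>Y\<in>C. x \<in> Y \<and> y \<in> Y" if xy: "x \<in> \<Union>C" "y \<in> \<Union>C" for x y
    proof -
      obtain X Y where XY: "X \<in> C" "Y \<in> C" "x \<in> X" "y \<in> Y" using xy by blast
      then have "X \<subseteq> Y \<or> Y \<subseteq> X" using C(2) by (auto simp: subset_chain_def)
      then show ?thesis using XY by blast
    qed
    have "add_subgroup (\<Union>C)"
    proof (rule add_subgroupI)
      obtain Y where "Y \<in> C" using C(1) by blast
      from UnionI[OF this add_subgroup_zero[OF CS[OF this]]] show "0 \<in> \<Union>C" .
      show "x + y \<in> \<Union>C" if xy: "x \<in> \<Union>C" "y \<in> \<Union>C" for x y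
      proof -
        obtain Y where Y: "Y \<in> C" "x \<in> Y" "y \<in> Y" using total[OF xy] by blast
        then show ?thesis using add_subgroup_add[OF CS[OF Y(1)] Y(2,3)] by blast
      qed
      show "- x \<in> \<Union>C" if x: "x \<in> \<Union>C" for x
      proof -
        obtain Y where Y: "Y \<in> C" "x \<in> Y" using x by blast
        then show ?thesis using add_subgroup_minus[OF CS[OF Y(1)] Y(2)] by blast
      qed
    qed
    then have "submodule univ_ring U (\<Union>C)"
      unfolding submodule_def
    proof (intro conjI ballI)
      show "\<Union>C \<subseteq> mcar U" using submoduleD(1)[OF CA(1)] by blast
      fix r x assume r: "r \<in> carrier (univ_ring :: 'h ring)" and x: "x \<in> \<Union>C"
      obtain Y where Y: "Y \<in> C" "x \<in> Y" using x by blast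
      then show "act U r x \<in> \<Union>C" using submoduleD(3)[OF CA(1)[OF Y(1)] r Y(2)] by blast
    qed
    moreover have "Z \<inter> \<Union>C = {0}" using C(1) CA(2) by blast
    ultimately show "\<Union>C \<in> ?A" by (intro CollectI conjI)
  qed
  then obtain Y where YA: "Y \<in> ?A" and Ymax: "\<forall>X\<in>?A. Y \<subseteq> X \<longrightarrow> X = Y" by (rule bexE)
  have Y: "submodule univ_ring U Y" "Z \<inter> Y = {0}" using YA by simp_all
  have max: "X = Y" if "submodule univ_ring U X" "Z \<inter> X = {0}" "Y \<subseteq> X" for X
    by (rule Ymax[rule_format]) (simp_all add: that)
  let ?T = "{z + y |z y. z \<in> Z \<and> y \<in> Y}"
  have T: "submodule univ_ring U ?T" by (rule submodule_plus[OF U Z Y(1)])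
  have Y0: "0 \<in> Y" using Y(2) by blast
  have "?T = mcar U"
  proof (rule ccontr)
    assume "?T \<noteq> mcar U"
    then obtain x where x: "x \<in> mcar U" "x \<notin> ?T" using submoduleD(1)[OF T] by blast
    obtain L l where L: "simple_ideal L" and l: "l \<in> L" "act U l x \<notin> ?T"
      by (rule simple_ideal_escapes[OF T x])
    have LL: "left_ideal L" using L by (simp add: simple_ideal_def)
    let ?X = "{y + w |y w. y \<in> Y \<and> w \<in> (\<lambda>l. act U l x) ` L}"
    have X: "submodule univ_ring U ?X"
      by (rule submodule_plus[OF U Y(1) ideal_orbit_submodule[OF LL x(1)]])
    have lx0: "act U 0 x = 0"
      by (rule additive_on_zero[OF lmod_homD(4)[OF orbit_hom[OF U x(1)]]]) (simp add: add_subgroup_UNIV)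
    have X0: "0 \<in> ?X" by (rule add_subgroup_zero[OF submoduleD(2)[OF X]])
    \<comment> \<open>If \<open>z = y + k x\<close>, then \<open>k x\<close> lies in
      \<open>Z + Y\<close>, so \<open>k = 0\<close>; what remains is an element of \<open>Z\<close>
      and \<open>Y\<close>.\<close>
    have "z = 0" if z: "z \<in> Z" "z \<in> ?X" for z
    proof -
      obtain y k where k: "y \<in> Y" "k \<in> L" "z = y + act U k x" using z(2) by blast
      have "- y \<in> Y" by (rule add_subgroup_minus[OF submoduleD(2)[OF Y(1)] k(1)])
      moreover have "act U k x = z + - y" using k(3) by simp
      ultimately have "act U k x \<in> ?T" using z(1) by (intro CollectI exI conjI)
      then have "k = 0" by (rule simple_ideal_avoids[OF L T x(1) l k(2)])
      then have "z = y" using k(3) lx0 by simp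
      then have "z \<in> Z \<inter> Y" using z(1) k(1) by simp
      then show ?thesis using Y(2) by simp
    qed
    then have "Z \<inter> ?X = {0}" using Z0 X0 by (intro equalityI subsetI) auto
    moreover have "Y \<subseteq> ?X"
    proof
      fix y assume y: "y \<in> Y"
      have "0 \<in> (\<lambda>l. act U l x) ` L"
        by (rule add_subgroup_zero[OF submoduleD(2)[OF ideal_orbit_submodule[OF LL x(1)]]])
      then show "y \<in> ?X" using y by (intro CollectI exI[of _ y] exI[of _ 0]) simp
    qed
    ultimately have XY: "?X = Y" by (rule max[OF X])
    have "act U l x \<in> ?X"
      using l(1) Y0 by (intro CollectI exI[of _ 0] exI[of _ "act U l x"]) simp
    then have "act U l x \<in> Y" unfolding XY .
    then have "act U l x \<in> ?T" using Z0 by (intro CollectI exI[of _ 0] exI[of _ "act U l x"]) simp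
    then show False using l(2) by simp
  qed
  then show ?thesis unfolding complementary_def using Y by blast
qed

end

end


section \<open>Decomposition into simple modules\<close>

abbreviation simple_sum :: "nat \<Rightarrow> (nat \<Rightarrow> ('h, 'v::ab_group_add) lmod) \<Rightarrow> (nat \<Rightarrow> nat) \<Rightarrow> ('h, nat \<times> nat \<Rightarrow> 'v) lmod"
  where "simple_sum s V n \<equiv> lmod_dsum {(i, l). i \<le> s \<and> l < n i} (\<lambda>(i, l). V i)"

lemma simple_sum_module:
  assumes V: "\<And>i. i \<le> s \<Longrightarrow> left_module univ_ring (V i)"
  shows "left_module univ_ring (simple_sum s V n)"
proof (rule lmod_dsum_left_module)
  fix p assume "p \<in> {(i, l). i \<le> s \<and> l < n i}"
  then have "fst p \<le> s" by auto
  from V[OF this] show "left_module univ_ring (case p of (i, l) \<Rightarrow> V i)" by (simp add: case_prod_unfold)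
qed

lemma finite_simple_index: "finite {(i, l). i \<le> (s::nat) \<and> l < (n i :: nat)}"
proof -
  have "{(i, l). i \<le> s \<and> l < n i} = (SIGMA i:{..s}. {..<n i})" by auto
  then show ?thesis by simp
qed

lemma simple_sum_mem:
  "\<phi> \<in> mcar (simple_sum s V n) \<longleftrightarrow>
    (\<forall>i l. i \<le> s \<and> l < n i \<longrightarrow> \<phi> (i, l) \<in> mcar (V i)) \<and> (\<forall>i l. \<not> (i \<le> s \<and> l < n i) \<longrightarrow> \<phi> (i, l) = 0)"
proof -
  have "finite {p. \<phi> p \<noteq> 0}" if "\<forall>i l. \<not> (i \<le> s \<and> l < n i) \<longrightarrow> \<phi> (i, l) = 0"
    by (rule finite_subset[OF _ finite_simple_index[of s n]]) (use that in auto)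
  then show ?thesis unfolding lmod_dsum_simps by auto
qed

lemma simple_sum_act:
  "act (simple_sum s V n) r \<phi> (i, l) = (if i \<le> s \<and> l < n i then act (V i) r (\<phi> (i, l)) else 0)"
  by (simp add: lmod_dsum_simps)

context socle_ring
begin

context
  fixes U :: "('h, 'u::ab_group_add) lmod" and V :: "nat \<Rightarrow> ('h, 'v::ab_group_add) lmod" and s :: nat
  assumes U: "left_module univ_ring U"
    and V: "\<And>i. i \<le> s \<Longrightarrow> left_module univ_ring (V i)"
    and complete: "\<And>M :: ('h, 'h) lmod. simple_module univ_ring M \<Longrightarrow> \<exists>i\<le>s. lmod_iso univ_ring M (V i)"
begin

text \<open>The multiplicities are existentially quantified so that such a submodule can be enlarged
  by one simple summand at a time.\<close>

definition embedded_sum :: "'u set \<Rightarrow> bool" where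
  "embedded_sum T \<longleftrightarrow> (\<exists>n f. lmod_hom univ_ring (simple_sum s V n) U f \<and>
    inj_on f (mcar (simple_sum s V n)) \<and> f ` mcar (simple_sum s V n) = T)"

lemma embedded_sum_submodule:
  assumes "embedded_sum T"
  shows "submodule univ_ring U T"
proof -
  obtain n f where f: "lmod_hom univ_ring (simple_sum s V n) U f" "f ` mcar (simple_sum s V n) = T"
    using assms unfolding embedded_sum_def by (elim exE conjE)
  show ?thesis
    using submodule_image[OF simple_sum_module[OF V] f(1) submodule_self[OF simple_sum_module[OF V]]] unfolding f(2) .
qed

lemma embedded_sum_zero: "embedded_sum {0}"
proof -
  let ?D = "simple_sum s V (\<lambda>_. 0)"
  have "\<phi> = 0" if "\<phi> \<in> mcar ?D" for \<phi>
    using that unfolding lmod_dsum_simps by (simp add: fun_eq_iff zero_fun_apply)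
  then have D: "mcar ?D = {0}"
    using left_module.mcar_zero[OF simple_sum_module[where n = "\<lambda>_. 0", OF V]] by (intro equalityI subsetI) auto
  have "lmod_hom univ_ring ?D U (\<lambda>_. 0)"
    using left_module.mcar_zero[OF U] left_module.act_zero_right[OF U] by (intro lmod_homI) simp_all
  moreover have "inj_on (\<lambda>_. 0) (mcar ?D)" "(\<lambda>_. 0) ` mcar ?D = {0}" unfolding D by simp_all
  ultimately show ?thesis unfolding embedded_sum_def by (intro exI conjI)
qed

text \<open>If \<open>L\<close> does not already carry \<open>x\<close> into \<open>T\<close>, then
  by \<open>simple_ideal_avoids\<close> the orbit \<open>L x\<close> is a copy of \<open>L\<close>
  independent of \<open>T\<close>, and one more copy of the matching \<open>V i\<close> is
  adjoined.\<close>

lemma embedded_sum_extend: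
  assumes T: "embedded_sum T" and L: "simple_ideal L" and x: "x \<in> mcar U"
  shows "\<exists>T'. embedded_sum T' \<and> T \<subseteq> T' \<and> (\<forall>l\<in>L. act U l x \<in> T')"
proof (cases "\<forall>l\<in>L. act U l x \<in> T")
  case True
  then show ?thesis using T by blast
next
  case False
  then obtain l where l: "l \<in> L" "act U l x \<notin> T" by blast
  note Ts = embedded_sum_submodule[OF T]
  obtain n f where f: "lmod_hom univ_ring (simple_sum s V n) U f"
    "inj_on f (mcar (simple_sum s V n))" "f ` mcar (simple_sum s V n) = T"
    using T by (auto simp: embedded_sum_def)
  let ?L = "\<lparr>mcar = L, act = (*)\<rparr>"
  have Lm: "left_module univ_ring ?L" using simple_ideal_module[OF L] by (simp add: simple_module_def)
  obtain i where i: "i \<le> s" and iso: "lmod_iso univ_ring ?L (V i)"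
    using complete[OF simple_ideal_module[OF L]] by blast
  from lmod_iso_sym[OF mod_subgroup[OF Lm] mod_closed[OF Lm] iso] obtain \<psi> where
    \<psi>: "lmod_hom univ_ring (V i) ?L \<psi>" "bij_betw \<psi> (mcar (V i)) (mcar ?L)"
    by (auto simp: lmod_iso_def)
  \<comment> \<open>The new copy of \<open>V i\<close> takes the first free index
    \<open>(i, n i)\<close>; \<open>cut\<close> erases that coordinate.\<close>
  define m where "m = n(i := Suc (n i))"
  let ?D = "simple_sum s V n" and ?E = "simple_sum s V m" and ?j = "(i, n i)"
  have m: "l < m a \<longleftrightarrow> l < n a \<or> a = i \<and> l = n i" for a l by (auto simp: m_def)
  define cut where "cut \<phi> = \<phi>(?j := 0)" for \<phi> :: "nat \<times> nat \<Rightarrow> 'v"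
  define g where "g \<phi> = f (cut \<phi>) + act U (\<psi> (\<phi> ?j)) x" for \<phi>
  have cut_apply: "cut \<phi> (a, l) = (if a = i \<and> l = n i then 0 else \<phi> (a, l))" for \<phi> a l
    by (simp add: cut_def)
  have cut: "cut \<phi> \<in> mcar ?D" if \<phi>: "\<phi> \<in> mcar ?E" for \<phi>
    using \<phi> unfolding simple_sum_mem by (simp add: cut_apply m)
  have at_j: "\<phi> ?j \<in> mcar (V i)" if "\<phi> \<in> mcar ?E" for \<phi>
    using that i unfolding simple_sum_mem by (simp add: m)
  have \<psi>L: "\<psi> v \<in> L" if "v \<in> mcar (V i)" for v using lmod_homD(1)[OF \<psi>(1) that] by simp
  note fh = lmod_homD[OF f(1)] and \<psi>h = lmod_homD[OF \<psi>(1), simplified]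
  note xh = lmod_homD[OF orbit_hom[OF U x], simplified]
  have act0: "act U 0 x = 0" by (rule additive_on_zero[OF xh(4) add_subgroup_UNIV])
  have \<psi>00: "\<psi> 0 = 0" by (rule additive_on_zero[OF lmod_homD(4)[OF \<psi>(1)] mod_subgroup[OF V[OF i]]])
  have f0: "f 0 = 0" by (rule additive_on_zero[OF fh(4) mod_subgroup[OF simple_sum_module[OF V]]])
  have D0: "0 \<in> mcar ?D" by (rule left_module.mcar_zero[OF simple_sum_module[OF V]])
  have g: "lmod_hom univ_ring ?E U g"
  proof (rule lmod_homI)
    fix \<phi> assume \<phi>: "\<phi> \<in> mcar ?E"
    show "g \<phi> \<in> mcar U"
      unfolding g_def by (rule left_module.mcar_add[OF U fh(1)[OF cut[OF \<phi>]] act_U_closed[OF U x]])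
    show "g (\<phi> + \<chi>) = g \<phi> + g \<chi>" if \<chi>: "\<chi> \<in> mcar ?E" for \<chi>
    proof -
      have "cut (\<phi> + \<chi>) = cut \<phi> + cut \<chi>" by (auto simp: cut_def fun_eq_iff plus_fun_apply)
      then show ?thesis
        unfolding g_def using fh(2)[OF cut[OF \<phi>] cut[OF \<chi>]] \<psi>h(2)[OF at_j[OF \<phi>] at_j[OF \<chi>]]
        by (simp add: plus_fun_apply xh(2))
    qed
    show "g (act ?E r \<phi>) = act U r (g \<phi>)" for r
    proof -
      have "cut (act ?E r \<phi>) = act ?D r (cut \<phi>)"
        unfolding fun_eq_iff split_paired_All simple_sum_act cut_apply by (auto simp: m)
      moreover have "act ?E r \<phi> ?j = act (V i) r (\<phi> ?j)"
        unfolding simple_sum_act using i by (simp add: m)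
      ultimately show ?thesis
        unfolding g_def using fh(3)[OF _ cut[OF \<phi>]] \<psi>h(3)[OF at_j[OF \<phi>]]
          mod_add_right[OF U _ fh(1)[OF cut[OF \<phi>]] act_U_closed[OF U x]]
        by (simp add: xh(3))
    qed
  qed
  \<comment> \<open>On the kernel of \<open>g\<close> the new coordinate carries \<open>x\<close>
    into \<open>T\<close>, so it is 0; the old coordinates then vanish because \<open>f\<close> is
    injective.\<close>
  have "inj_on g (mcar ?E)"
  proof (rule inj_on_additive[OF lmod_homD(4)[OF g] mod_subgroup[OF simple_sum_module[OF V]]])
    fix \<phi> assume \<phi>: "\<phi> \<in> mcar ?E" and 0: "g \<phi> = 0"
    have "act U (\<psi> (\<phi> ?j)) x = - f (cut \<phi>)"
      using 0 unfolding g_def by (simp add: eq_neg_iff_add_eq_0 add.commute)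
    moreover have "- f (cut \<phi>) \<in> T"
      using f(3) cut[OF \<phi>] by (intro add_subgroup_minus[OF submoduleD(2)[OF Ts]]) blast
    ultimately have "act U (\<psi> (\<phi> ?j)) x \<in> T" by simp
    then have \<psi>0: "\<psi> (\<phi> ?j) = 0"
      by (rule simple_ideal_avoids[OF U L Ts x l \<psi>L[OF at_j[OF \<phi>]]])
    have "inj_on \<psi> (mcar (V i))" using \<psi>(2) by (rule bij_betw_imp_inj_on)
    from inj_onD[OF this _ at_j[OF \<phi>] left_module.mcar_zero[OF V[OF i]]]
    have \<phi>j: "\<phi> ?j = 0" using \<psi>0 \<psi>00 by simp
    have "f (cut \<phi>) = 0" using 0 \<psi>0 act0 unfolding g_def by simp
    then have cut0: "cut \<phi> = 0" using inj_onD[OF f(2) _ cut[OF \<phi>] D0] f0 by simp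
    have "\<phi> = (cut \<phi>)(?j := \<phi> ?j)" by (simp add: cut_def)
    then show "\<phi> = 0" unfolding cut0 \<phi>j by (simp add: fun_eq_iff zero_fun_apply)
  qed
  then have emb: "embedded_sum (g ` mcar ?E)" unfolding embedded_sum_def using g by blast
  have in_E: "\<phi>(?j := v) \<in> mcar ?E" if \<phi>: "\<phi> \<in> mcar ?D" and v: "v \<in> mcar (V i)" for \<phi> v
    using \<phi> v i unfolding simple_sum_mem by (auto simp: m)
  have "T \<subseteq> g ` mcar ?E"
  proof
    fix t assume "t \<in> T"
    then obtain \<phi> where \<phi>: "\<phi> \<in> mcar ?D" "t = f \<phi>" using f(3) by blast
    have "\<phi> ?j = 0" using \<phi>(1) unfolding simple_sum_mem by simp
    then have "cut (\<phi>(?j := 0)) = \<phi>" by (auto simp: cut_def)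
    then have "t = g (\<phi>(?j := 0))" using \<phi> by (simp add: g_def \<psi>00 act0)
    then show "t \<in> g ` mcar ?E" using in_E[OF \<phi>(1) left_module.mcar_zero[OF V[OF i]]] by blast
  qed
  moreover have "act U k x \<in> g ` mcar ?E" if k: "k \<in> L" for k
  proof -
    obtain v where v: "v \<in> mcar (V i)" "\<psi> v = k" using k \<psi>(2) unfolding bij_betw_def by auto
    have "cut (0(?j := v)) = 0" by (simp add: fun_eq_iff cut_apply zero_fun_apply)
    then have "act U k x = g (0(?j := v))"
      using f0 v by (simp add: g_def)
    then show ?thesis using in_E[OF D0 v(1)] by blast
  qed
  ultimately show ?thesis using emb by blast
qed

lemma embedded_sum_insert:
  assumes T: "embedded_sum T" and x: "x \<in> mcar U"
  shows "\<exists>T'. embedded_sum T' \<and> T \<subseteq> T' \<and> x \<in> T'"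
proof -
  \<comment> \<open>Quantifying over all \<open>T\<close> makes this set closed under addition:
    enlarge \<open>T\<close> for \<open>g\<close> and then the result for \<open>h\<close>. It
    contains every simple left ideal, hence \<open>1\<close>.\<close>
  let ?I = "{h. \<forall>T. embedded_sum T \<longrightarrow> (\<exists>T'. embedded_sum T' \<and> T \<subseteq> T' \<and> act U h x \<in> T')}"
  note Ts = submoduleD[OF embedded_sum_submodule]
  note xh = lmod_homD[OF orbit_hom[OF U x], simplified]
  have "left_ideal ?I"
  proof (intro left_idealI add_subgroupI)
    show "0 \<in> ?I"
    proof (intro CollectI allI impI)
      fix T assume T: "embedded_sum T"
      have "act U 0 x \<in> T"
        using additive_on_zero[OF xh(4) add_subgroup_UNIV] add_subgroup_zero[OF Ts(2)[OF T]] by simp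
      then show "\<exists>T'. embedded_sum T' \<and> T \<subseteq> T' \<and> act U 0 x \<in> T'" using T by blast
    qed
    show "g + h \<in> ?I" if gh: "g \<in> ?I" "h \<in> ?I" for g h
    proof (intro CollectI allI impI)
      fix T assume "embedded_sum T"
      with gh(1) obtain T1 where T1: "embedded_sum T1" "T \<subseteq> T1" "act U g x \<in> T1" by blast
      with gh(2) obtain T2 where T2: "embedded_sum T2" "T1 \<subseteq> T2" "act U h x \<in> T2" by blast
      have "act U (g + h) x \<in> T2"
        using add_subgroup_add[OF Ts(2)[OF T2(1)], of "act U g x" "act U h x"] T1 T2 xh(2) by auto
      then show "\<exists>T'. embedded_sum T' \<and> T \<subseteq> T' \<and> act U (g + h) x \<in> T'" using T1 T2 by blast
    qed
    show "- h \<in> ?I" if h: "h \<in> ?I" for h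
    proof (intro CollectI allI impI)
      fix T assume "embedded_sum T"
      with h obtain T' where T': "embedded_sum T'" "T \<subseteq> T'" "act U h x \<in> T'" by blast
      have "act U (- h) x \<in> T'"
        using add_subgroup_minus[OF Ts(2)[OF T'(1)] T'(3)] additive_on_minus[OF xh(4) add_subgroup_UNIV, of h]
        by simp
      then show "\<exists>T'. embedded_sum T' \<and> T \<subseteq> T' \<and> act U (- h) x \<in> T'" using T' by blast
    qed
    show "g * h \<in> ?I" if h: "h \<in> ?I" for g h
    proof (intro CollectI allI impI)
      fix T assume "embedded_sum T"
      with h obtain T' where T': "embedded_sum T'" "T \<subseteq> T'" "act U h x \<in> T'" by blast
      have "act U (g * h) x \<in> T'" using Ts(3)[OF T'(1) _ T'(3), of g] xh(3)[of g h] by simp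
      then show "\<exists>T'. embedded_sum T' \<and> T \<subseteq> T' \<and> act U (g * h) x \<in> T'" using T' by blast
    qed
  qed
  moreover have "L \<subseteq> ?I" if "simple_ideal L" for L
    using embedded_sum_extend[OF _ that x] by blast
  ultimately have "1 \<in> ?I" using socle[of ?I] by blast
  then show ?thesis using T mod_one[OF U x] by auto
qed

text \<open>Adjoin the finitely many generators one after another, starting from the zero
  submodule.\<close>

lemma simple_sum_decomposition:
  assumes B: "finite B" "B \<subseteq> mcar U"
    and gen: "\<And>X. submodule univ_ring U X \<Longrightarrow> B \<subseteq> X \<Longrightarrow> X = mcar U"
  shows "\<exists>n. lmod_iso univ_ring (simple_sum s V n) U"
proof -
  have "\<exists>T. embedded_sum T \<and> B \<subseteq> T"
    using B
  proof (induction B rule: finite_induct)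
    case empty
    then show ?case using embedded_sum_zero by blast
  next
    case (insert x B)
    then obtain T where "embedded_sum T" "B \<subseteq> T" by auto
    with embedded_sum_insert[of T x] insert show ?case by blast
  qed
  then have "embedded_sum (mcar U)" using gen embedded_sum_submodule by blast
  then show ?thesis unfolding embedded_sum_def lmod_iso_def bij_betw_def by blast
qed

end

end


section \<open>Counting simple summands\<close>

lemma lmod_power_mem:
  "f \<in> mcar (lmod_dsum {..<m} (\<lambda>_. M)) \<longleftrightarrow> (\<forall>t<m. f t \<in> mcar M) \<and> (\<forall>t. \<not> t < m \<longrightarrow> f t = 0)" for m :: nat
proof -
  have "finite {t. f t \<noteq> 0}" if "\<forall>t. \<not> t < m \<longrightarrow> f t = 0"
    by (rule finite_subset[of _ "{..<m}"]) (use that in auto)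
  then show ?thesis by (auto simp: lmod_dsum_simps)
qed

lemma simple_module_cyclic:
  assumes V: "simple_module univ_ring V" and v: "v \<in> mcar V" "v \<noteq> 0" and w: "w \<in> mcar V"
  shows "\<exists>r. w = act V r v"
proof -
  have L: "left_module univ_ring V" using V by (simp add: simple_module_def)
  let ?X = "(\<lambda>h. act V h v) ` mcar regular_module"
  have X: "submodule univ_ring V ?X"
    by (rule submodule_image[OF regular_module_module orbit_hom[OF L v(1)] submodule_self[OF regular_module_module]])
  have "v = act V 1 v" using mod_one[OF L v(1)] by simp
  then have "v \<in> ?X" by (intro image_eqI[of _ _ 1]) simp_all
  then have "?X \<noteq> {0}" using v(2) by auto
  then have "?X = mcar V" using V X unfolding simple_module_def by metis
  then show ?thesis using w by auto
qed

text \<open>By Gaussian elimination, a strictly larger submodule of a power of a simple module has strictly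
  more pivots.\<close>

definition pivots :: "nat \<Rightarrow> (nat \<Rightarrow> 'v::zero) set \<Rightarrow> nat set" where
  "pivots n X = {t. t < n \<and> (\<exists>f\<in>X. f t \<noteq> 0 \<and> (\<forall>u<t. f u = 0))}"

lemma submodule_pivots:
  fixes V :: "('h::ring_1, 'v::ab_group_add) lmod"
  assumes V: "simple_module univ_ring V"
    and X: "submodule univ_ring (lmod_dsum {..<n} (\<lambda>_. V)) X"
    and Y: "submodule univ_ring (lmod_dsum {..<n} (\<lambda>_. V)) Y"
    and XY: "X \<subseteq> Y" and piv: "pivots n Y \<subseteq> pivots n X"
  shows "Y \<subseteq> X"
proof
  fix y assume y: "y \<in> Y"
  let ?D = "lmod_dsum {..<n} (\<lambda>_. V)"
  note X' = submoduleD[OF X] and Y' = submoduleD[OF Y]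
  have mem: "f t \<in> mcar V" if "f \<in> Y" "t < n" for f t
    using subsetD[OF Y'(1) that(1)] that(2) by (simp add: lmod_dsum_simps)
  have out: "f t = 0" if "f \<in> Y" "\<not> t < n" for f t
    using subsetD[OF Y'(1) that(1)] that(2) by (simp add: lmod_dsum_simps)
  \<comment> \<open>Approximate \<open>y\<close> from \<open>X\<close> coordinate by coordinate. If
    coordinate \<open>k\<close> is wrong, the difference has leading position \<open>k\<close>, so
    some \<open>f\<close> in \<open>X\<close> has it too; as \<open>V\<close> is simple, a multiple
    of \<open>f\<close> corrects this coordinate and leaves the earlier ones alone.\<close>
  have "\<exists>x\<in>X. \<forall>t<k. y t = x t" if "k \<le> n" for k
    using that
  proof (induction k)
    case 0
    then show ?case using add_subgroup_zero[OF X'(2)] by auto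
  next
    case (Suc k)
    then obtain x where x: "x \<in> X" "\<forall>t<k. y t = x t" by auto
    show ?case
    proof (cases "y k = x k")
      case True
      then show ?thesis using x by (auto simp: less_Suc_eq)
    next
      case False
      have xY: "x \<in> Y" using x(1) XY by auto
      define w where "w = y - x"
      have w: "w t = y t - x t" for t by (simp add: w_def)
      have d: "w \<in> Y" unfolding w_def by (rule add_subgroup_diff[OF Y'(2) y xY])
      have k: "k < n" using Suc.prems by simp
      have "w k \<noteq> 0 \<and> (\<forall>u<k. w u = 0)" using False x(2) by (simp add: w)
      then have "k \<in> pivots n Y" using d k unfolding pivots_def by blast
      then have "k \<in> pivots n X" using piv by blast
      then obtain f where f: "f \<in> X" "f k \<noteq> 0" "\<forall>u<k. f u = 0" unfolding pivots_def by blast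
      have fY: "f \<in> Y" using f(1) XY by auto
      obtain r where r: "w k = act V r (f k)"
        using simple_module_cyclic[OF V mem[OF fY k] f(2) mem[OF d k]] by blast
      have V0: "act V r 0 = 0"
        using V left_module.act_zero_right[of univ_ring V r] by (simp add: simple_module_def)
      define z where "z = x + act ?D r f"
      have "z \<in> X" unfolding z_def
        by (rule add_subgroup_add[OF X'(2) x(1)]) (rule X'(3)[OF _ f(1)], simp)
      moreover have "y t = z t" if "t < Suc k" for t
      proof (cases "t = k")
        case True
        then show ?thesis using r k by (simp add: z_def w plus_fun_apply lmod_dsum_simps algebra_simps)
      next
        case False
        then show ?thesis
          using that x(2) f(3) V0 by (simp add: z_def plus_fun_apply lmod_dsum_simps)
      qed
      ultimately show ?thesis by blast
    qed
  qed
  from this[of n] obtain x where x: "x \<in> X" "\<forall>t<n. y t = x t" by auto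
  have "y = x"
  proof
    fix t
    show "y t = x t"
      using x out[OF y, of t] out[of x t] XY by (cases "t < n") auto
  qed
  then show "y \<in> X" using x(1) by simp
qed

text \<open>Filter the source by the vectors that vanish from coordinate \<open>k\<close> on. The
  images form a strictly increasing chain by injectivity, so each of the \<open>m\<close> steps adds
  a pivot, and there are at most \<open>n\<close> pivots.\<close>

lemma power_embedding_le:
  fixes V :: "('h::ring_1, 'v::ab_group_add) lmod" and m n :: nat
  assumes V: "simple_module univ_ring V"
    and f: "lmod_hom univ_ring (lmod_dsum {..<m} (\<lambda>_. V)) (lmod_dsum {..<n} (\<lambda>_. V)) f"
    and inj: "inj_on f (mcar (lmod_dsum {..<m} (\<lambda>_. V)))"
  shows "m \<le> n"
proof -
  let ?D = "lmod_dsum {..<m} (\<lambda>_. V)" and ?E = "lmod_dsum {..<n} (\<lambda>_. V)"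
  have VL: "left_module univ_ring V" using V by (simp add: simple_module_def)
  have DL: "left_module univ_ring ?D" and EL: "left_module univ_ring ?E"
    by (rule lmod_dsum_left_module[OF VL])+
  obtain v where v: "v \<in> mcar V" "v \<noteq> 0"
    using V left_module.mcar_zero[OF VL] unfolding simple_module_def by blast
  define X where "X k = {\<phi> \<in> mcar ?D. \<forall>t. k \<le> t \<longrightarrow> \<phi> t = 0}" for k
  have V0: "act V r 0 = 0" for r using left_module.act_zero_right[OF VL, of r] by simp
  have X: "submodule univ_ring ?D (X k)" for k
  proof -
    have "add_subgroup (X k)"
      by (rule add_subgroupI)
        (use left_module.mcar_zero[OF DL] left_module.mcar_add[OF DL] left_module.mcar_minus[OF DL] in
          \<open>simp_all add: X_def plus_fun_apply zero_fun_apply\<close>)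
    moreover have "act ?D r \<phi> \<in> X k" if "\<phi> \<in> X k" for r \<phi>
      using that mod_closed[OF DL, of r \<phi>] by (simp add: X_def lmod_dsum_simps(2) V0)
    ultimately show ?thesis unfolding submodule_def by (simp add: X_def)
  qed
  have fX: "submodule univ_ring ?E (f ` X k)" for k by (rule submodule_image[OF DL f X])
  have fin: "finite (pivots n Z)" for Z :: "(nat \<Rightarrow> 'v) set"
    by (rule finite_subset[of _ "{..<n}"]) (auto simp: pivots_def)
  have "k \<le> card (pivots n (f ` X k))" if "k \<le> m" for k
    using that
  proof (induction k)
    case (Suc k)
    let ?P = "pivots n (f ` X k)" and ?Q = "pivots n (f ` X (Suc k))"
    have sub: "X k \<subseteq> X (Suc k)" by (auto simp: X_def)
    then have PQ: "?P \<subseteq> ?Q" unfolding pivots_def by blast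
    have "\<not> ?Q \<subseteq> ?P"
    proof
      assume "?Q \<subseteq> ?P"
      then have 1: "f ` X (Suc k) \<subseteq> f ` X k"
        by (rule submodule_pivots[OF V fX fX image_mono[OF sub]])
      let ?\<delta> = "\<lambda>i. if i = k then v else 0"
      have \<delta>: "?\<delta> \<in> mcar ?D"
        by (rule delta_dsum[where R = univ_ring and M = "\<lambda>_. V"]) (use VL v Suc.prems in auto)
      then have "?\<delta> \<in> X (Suc k)" by (simp add: X_def)
      then obtain \<phi> where \<phi>: "\<phi> \<in> X k" "f ?\<delta> = f \<phi>" using 1 by blast
      have "\<phi> \<in> mcar ?D" "\<phi> k = 0" using \<phi>(1) by (simp_all add: X_def)
      moreover from this have "?\<delta> = \<phi>" by (intro inj_onD[OF inj \<phi>(2) \<delta>])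
      ultimately show False using fun_cong[of ?\<delta> \<phi> k] v(2) by simp
    qed
    then have "card ?P < card ?Q" using PQ by (intro psubset_card_mono[OF fin]) blast
    then show ?case using Suc by simp
  qed simp
  from this[of m] have "m \<le> card (pivots n (f ` X m))" by simp
  also have "\<dots> \<le> card {..<n}" by (rule card_mono) (auto simp: pivots_def)
  finally show ?thesis by simp
qed


section \<open>Semisimple Hopf algebras are finite-dimensional\<close>

context hopf_algebra
begin

lemma counit_linear': "counit H (g + h) = counit H g + counit H h" "counit H (hscale H c h) = c * counit H h"
  using counit_linear by (simp_all add: Vector_Spaces.linear_iff)

lemma antipode_linear': "antipode H (g + h) = antipode H g + antipode H h"
    "antipode H (hscale H c h) = hscale H c (antipode H h)"
  using antipode_linear by (simp_all add: Vector_Spaces.linear_iff)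

lemma left_ideal_scale: "left_ideal I \<Longrightarrow> x \<in> I \<Longrightarrow> hscale H c x \<in> I"
  using left_idealD(2)[of I x "hscale H c 1"] by (simp flip: hs.scale_mult_left)

lemma left_ideal_subspace: "left_ideal I \<Longrightarrow> hs.subspace I"
  by (rule hs.subspaceI)
    (use left_idealD(1)[of I] add_subgroup_zero add_subgroup_add left_ideal_scale[of I] in blast)+

text \<open>\<open>\<Lambda>\<close> is the component of \<open>1\<close> in a complement
  \<open>Y\<close> of the kernel of the counit. The difference of the two sides of the integral
  equation lies in \<open>Y\<close> and has counit 0.\<close>

lemma normalized_integral:
  assumes ss: "semisimple_module univ_ring (regular_module :: ('h, 'h) lmod)"
  obtains \<Lambda> where "counit H \<Lambda> = 1" "\<And>h. h * \<Lambda> = hscale H (counit H h) \<Lambda>"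
proof -
  let ?K = "{h. counit H h = 0}"
  have c0: "additive_on UNIV (counit H)" by (simp add: additive_on_def counit_linear')
  have "add_subgroup ?K"
    using add_subgroup_vimage[OF c0 add_subgroup_singleton] by simp
  then have "left_ideal ?K" by (rule left_idealI) (simp add: counit_mult)
  then obtain Y where Y: "left_ideal Y" and c: "complementary regular_module ?K Y"
    using ss unfolding semisimple_module_def by blast
  have int: "?K \<inter> Y = {0}" and sum: "{x + y |x y. x \<in> ?K \<and> y \<in> Y} = UNIV"
    using c by (simp_all add: complementary_def)
  have "1 \<in> {x + y |x y. x \<in> ?K \<and> y \<in> Y}" unfolding sum by simp
  then obtain x \<Lambda> where x: "counit H x = 0" and \<Lambda>: "\<Lambda> \<in> Y" and 1: "1 = x + \<Lambda>" by blast
  have e: "counit H \<Lambda> = 1" using counit_one x unfolding 1 by (simp add: counit_linear')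
  have "h * \<Lambda> = hscale H (counit H h) \<Lambda>" for h
  proof -
    let ?d = "h * \<Lambda> - hscale H (counit H h) \<Lambda>"
    have "?d \<in> Y"
      by (rule add_subgroup_diff[OF left_idealD(1)[OF Y] left_idealD(2)[OF Y \<Lambda>] left_ideal_scale[OF Y \<Lambda>]])
    moreover have "counit H ?d = 0"
      using additive_on_diff[OF c0 add_subgroup_UNIV] by (simp add: counit_mult counit_linear' e)
    ultimately have "?d \<in> ?K \<inter> Y" by simp
    then show ?thesis unfolding int by simp
  qed
  with e show ?thesis by (rule that)
qed

lemma sweedler_counit_right:
  "additive_on UNIV g \<Longrightarrow> sweedler H h (\<lambda>x y. g (hscale H (counit H y) x)) = g h"
  using sweedler_additive[of UNIV g "\<lambda>x y. hscale H (counit H y) x" h] counit_right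
  by (simp add: add_subgroup_UNIV)

text \<open>In \<open>S(h) x \<otimes> y\<close>, with \<open>x \<otimes> y\<close> standing for the
  coproduct of \<open>\<Lambda>\<close>, write \<open>h\<close> as \<open>h1 \<epsilon>(h2)\<close>
  and trade \<open>\<epsilon>(h2) \<Lambda>\<close> for \<open>h2 \<Lambda>\<close>. The left leg
  becomes \<open>S(h1) h2 x\<close>, which the antipode axiom collapses, and the right leg becomes
  \<open>h3 y\<close>.\<close>

lemma integral_shift:
  fixes F :: "'h \<Rightarrow> 'h \<Rightarrow> 'h"
  assumes \<Lambda>: "\<And>h. h * \<Lambda> = hscale H (counit H h) \<Lambda>" and F: "bilinear_map HS HS HS F"
  shows "sweedler H \<Lambda> (\<lambda>x y. F x (h * y)) = sweedler H \<Lambda> (\<lambda>x y. F (antipode H h * x) y)"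
proof -
  have Fl: "F (x + x') y = F x y + F x' y" "F x (y + y') = F x y + F x y'"
    "F (hscale H c x) y = hscale H c (F x y)" "F x (hscale H c y) = hscale H c (F x y)" for x x' y y' c
    using bilinear_mapD(2-5)[OF F] by simp_all
  have Fl': "F (x + x') = (\<lambda>y. F x y + F x' y)" "F (hscale H c x) = (\<lambda>y. hscale H c (F x y))" for x x' c
    by (simp_all add: fun_eq_iff Fl)
  note Sl = antipode_linear' and scl = hs.scale_mult_left[symmetric] hs.scale_mult_right[symmetric]
  have sc: "hscale H c (sweedler H \<Lambda> f) = sweedler H \<Lambda> (\<lambda>x y. hscale H c (f x y))" for c f
    by (rule sweedler_additive[of UNIV]) (simp_all add: additive_on_def hs.scale_right_distrib add_subgroup_UNIV)
  have bF: "bilinear_map HS HS HS (\<lambda>x y. F (a * x) (b * y))" for a b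
    by (rule bilinear_mapI) (simp_all add: Fl distrib_left scl)
  \<comment> \<open>The trilinear function to which coassociativity is applied; its arguments stand
    for the three legs of \<open>h\<close>.\<close>
  define T where "T k h1 h2 = sweedler H \<Lambda> (\<lambda>x y. F (antipode H k * (h1 * x)) (h2 * y))" for k h1 h2
  have T1: "bilinear_map HS HS HS (T k)" for k
    by (rule bilinear_mapI) (simp_all add: T_def sc Fl distrib_left distrib_right scl sweedler_fun_add)
  have T2: "bilinear_map HS HS HS (\<lambda>k h1. T k h1 h2)" for h2
    by (rule bilinear_mapI) (simp_all add: T_def sc Fl Sl distrib_left distrib_right scl sweedler_fun_add)
  have "sweedler H \<Lambda> (\<lambda>x y. F (antipode H h * x) y) =
      sweedler H h (\<lambda>h1 h2. sweedler H \<Lambda> (\<lambda>x y. F (antipode H (hscale H (counit H h2) h1) * x) y))"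
    by (rule sweedler_counit_right[symmetric])
      (simp add: additive_on_def Sl distrib_right Fl' sweedler_fun_add)
  also have "\<dots> = sweedler H h (\<lambda>h1 h2. sweedler H (h2 * \<Lambda>) (\<lambda>x y. F (antipode H h1 * x) y))"
    using sweedler_scale[OF hspace_module bF[of _ 1]] by (simp add: \<Lambda> Sl Fl' scl sc)
  also have "\<dots> = sweedler H h (\<lambda>h1 h2. sweedler H h2 (T h1))"
    using sweedler_mult[OF hspace_module bF[of _ 1]] by (simp add: T_def[abs_def])
  also have "\<dots> = sweedler H h (\<lambda>h1 h2. sweedler H h1 (\<lambda>k1 k2. T k1 k2 h2))"
    using sweedler_coassoc[OF hspace_module T1 T2, of h] by simp
  also have "\<dots> = sweedler H h (\<lambda>h1 h2. sweedler H \<Lambda> (\<lambda>x y. F x (hscale H (counit H h1) h2 * y)))"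
  proof -
    have "sweedler H h1 (\<lambda>k1 k2. T k1 k2 h2) = sweedler H \<Lambda> (\<lambda>x y. F x (hscale H (counit H h1) h2 * y))" for h1 h2
    proof -
      let ?g = "\<lambda>z. sweedler H \<Lambda> (\<lambda>x y. F (z * x) (h2 * y))"
      have "additive_on UNIV ?g" by (simp add: additive_on_def distrib_right Fl sweedler_fun_add)
      from sweedler_additive[OF this add_subgroup_UNIV, of "\<lambda>k1 k2. antipode H k1 * k2" h1]
      have "sweedler H h1 (\<lambda>k1 k2. T k1 k2 h2) = ?g (hscale H (counit H h1) 1)"
        by (simp add: T_def mult.assoc antipode_left)
      also have "\<dots> = sweedler H \<Lambda> (\<lambda>x y. F x (hscale H (counit H h1) h2 * y))"
        by (simp add: Fl scl)
      finally show ?thesis .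
    qed
    then show ?thesis by simp
  qed
  also have "\<dots> = sweedler H \<Lambda> (\<lambda>x y. F x (h * y))"
    by (rule sweedler_counit_left) (simp add: additive_on_def distrib_right Fl sweedler_fun_add)
  finally show ?thesis ..
qed

text \<open>With \<open>\<Delta> \<Lambda> = \<Sum> a \<otimes> b\<close>, the elements \<open>\<Sum> f(a) b\<close> for linear forms \<open>f\<close> form a left ideal inside the
  span of the \<open>b\<close>, and it contains \<open>\<Sum> S(a) b = 1\<close>.\<close>

lemma finite_dimensional:
  assumes ss: "semisimple_module univ_ring (regular_module :: ('h, 'h) lmod)"
  shows "\<exists>B. finite B \<and> hs.span B = UNIV"
proof -
  obtain \<Lambda> where \<Lambda>: "counit H \<Lambda> = 1" "\<And>h. h * \<Lambda> = hscale H (counit H h) \<Lambda>"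
    using normalized_integral[OF ss] by blast
  define r where "r = tensor_rep HS HS (comult H \<Lambda>)"
  have sw: "sweedler H \<Lambda> f = (\<Sum>(a, b)\<leftarrow>r. f a b)" for f :: "'h \<Rightarrow> 'h \<Rightarrow> 'h"
    by (simp add: sweedler_def tensor_lift_rep r_def)
  define lin where "lin f \<longleftrightarrow> Vector_Spaces.linear (hscale H) (*) f" for f
  have linD: "f (x + y) = f x + f y" "f (hscale H c x) = c * f x" if "lin f" for f x y c
    using that by (simp_all add: lin_def Vector_Spaces.linear_iff)
  have kv: "vector_space ((*) :: 'k \<Rightarrow> 'k \<Rightarrow> 'k)" by unfold_locales (simp_all add: algebra_simps)
  have linI: "lin f" if "\<And>x y. f (x + y) = f x + f y" "\<And>c x. f (hscale H c x) = c * f x" for f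
    using that hs.vector_space_axioms kv unfolding lin_def Vector_Spaces.linear_iff by blast
  define ev where "ev f = sweedler H \<Lambda> (\<lambda>a b. hscale H (f a) b)" for f
  define L where "L = ev ` {f. lin f}"
  have ev_add: "ev (\<lambda>x. f x + g x) = ev f + ev g" for f g
    by (simp add: ev_def hs.scale_left_distrib sweedler_fun_add)
  have L_add: "x + y \<in> L" if xy: "x \<in> L" "y \<in> L" for x y
  proof -
    obtain f g where f: "lin f" "lin g" "x = ev f" "y = ev g" using xy by (auto simp: L_def)
    have "lin (\<lambda>x. f x + g x)" using linD f(1,2) by (intro linI) (simp_all add: algebra_simps)
    moreover have "x + y = ev (\<lambda>x. f x + g x)" by (simp add: f ev_add)
    ultimately show ?thesis by (auto simp: L_def)
  qed
  have L_mult: "h * x \<in> L" if x: "x \<in> L" for h x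
  proof -
    obtain f where f: "lin f" "x = ev f" using x by (auto simp: L_def)
    have b: "bilinear_map HS HS HS (\<lambda>a b. hscale H (f a) b)"
      by (rule bilinear_mapI) (simp_all add: linD[OF f(1)] hs.scale_left_distrib hs.scale_right_distrib mult.commute)
    have "h * x = sweedler H \<Lambda> (\<lambda>a b. h * hscale H (f a) b)"
      unfolding f(2) ev_def
      by (rule sweedler_additive[of UNIV]) (simp_all add: additive_on_def distrib_left add_subgroup_UNIV)
    also have "\<dots> = sweedler H \<Lambda> (\<lambda>a b. hscale H (f (antipode H h * a)) b)"
      using integral_shift[OF \<Lambda>(2) b, of h] by (simp add: hs.scale_mult_right)
    finally have "h * x = ev (\<lambda>a. f (antipode H h * a))" by (simp add: ev_def)
    moreover have "lin (\<lambda>a. f (antipode H h * a))"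
      using linD[OF f(1)] by (intro linI) (simp_all add: distrib_left flip: hs.scale_mult_right)
    ultimately show ?thesis by (auto simp: L_def)
  qed
  have L0: "0 \<in> L"
  proof -
    have "lin (\<lambda>_. 0)" by (rule linI) simp_all
    moreover have "ev (\<lambda>_. 0) = 0" by (simp add: ev_def sw case_prod_unfold)
    ultimately show ?thesis by (force simp: L_def)
  qed
  \<comment> \<open>To place the sum of all \<open>S(a) b\<close> in the left ideal
    \<open>L\<close>, expand each \<open>a\<close> in a basis of \<open>H\<close>. The coordinates
    are linear forms, so the sum becomes a combination of elements of \<open>L\<close> with
    coefficients \<open>S(x)\<close>, where \<open>x\<close> ranges over the finite set
    \<open>X0\<close>.\<close>
  define X where "X = hs.extend_basis {}"
  have X: "hs.independent X" "hs.span X = UNIV"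
    unfolding X_def by (simp_all add: hs.independent_extend_basis hs.span_extend_basis hs.independent_empty)
  define X0 where "X0 = (\<Union>(a, b)\<in>set r. {x. hs.representation X a x \<noteq> 0})"
  have X0: "finite X0" unfolding X0_def by (auto intro: hs.finite_representation)
  have a_eq: "antipode H a * b = (\<Sum>x\<in>X0. antipode H x * hscale H (hs.representation X a x) b)"
    if ab: "(a, b) \<in> set r" for a b
  proof -
    have "a = (\<Sum>x | hs.representation X a x \<noteq> 0. hscale H (hs.representation X a x) x)"
      using hs.sum_nonzero_representation_eq[OF X(1), of a] X(2) by simp
    also have "\<dots> = (\<Sum>x\<in>X0. hscale H (hs.representation X a x) x)"
      by (rule sum.mono_neutral_left[OF X0]) (use ab in \<open>auto simp: X0_def\<close>)
    finally have a: "a = (\<Sum>x\<in>X0. hscale H (hs.representation X a x) x)" .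
    have "additive_on UNIV (\<lambda>a. antipode H a * b)" by (simp add: additive_on_def antipode_linear' distrib_right)
    from additive_on_sum[OF this add_subgroup_UNIV, of X0 "\<lambda>x. hscale H (hs.representation X a x) x"]
    show ?thesis
      by (subst a) (simp add: antipode_linear' flip: hs.scale_mult_left hs.scale_mult_right)
  qed
  have "1 = sweedler H \<Lambda> (\<lambda>a b. antipode H a * b)"
    using antipode_left[of \<Lambda>] by (simp add: \<Lambda>(1))
  also have "\<dots> = (\<Sum>(a, b)\<leftarrow>r. \<Sum>x\<in>X0. antipode H x * hscale H (hs.representation X a x) b)"
    unfolding sw by (rule arg_cong[of _ _ sum_list], rule map_cong[OF refl]) (use a_eq in auto)
  also have "\<dots> = (\<Sum>x\<in>X0. antipode H x * ev (\<lambda>a. hs.representation X a x))"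
    unfolding ev_def sw
    by (induction r) (auto simp: sum.distrib distrib_left)
  also have "\<dots> \<in> L"
  proof -
    have "lin (\<lambda>a. hs.representation X a x)" for x
      using X by (intro linI) (simp_all add: hs.representation_add hs.representation_scale)
    then have "antipode H x * ev (\<lambda>a. hs.representation X a x) \<in> L" for x
      by (intro L_mult) (simp add: L_def)
    with X0 show ?thesis by (induction X0 rule: finite_induct) (simp_all add: L0 L_add)
  qed
  finally have "1 \<in> L" .
  have "h \<in> hs.span (snd ` set r)" for h
  proof -
    have "h \<in> L" using L_mult[OF \<open>1 \<in> L\<close>, of h] by simp
    then obtain f where "h = ev f" by (auto simp: L_def)
    then have h: "h = (\<Sum>(a, b)\<leftarrow>r. hscale H (f a) b)" by (simp add: ev_def sw)
    have "(\<Sum>(a, b)\<leftarrow>q. hscale H (f a) b) \<in> hs.span (snd ` set r)" if "set q \<subseteq> set r" for q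
      using that
    proof (induction q)
      case (Cons p q)
      then have "snd p \<in> hs.span (snd ` set r)" by (intro hs.span_base imageI) simp
      then have "hscale H (f (fst p)) (snd p) \<in> hs.span (snd ` set r)" by (rule hs.span_scale)
      moreover have "(\<Sum>(a, b)\<leftarrow>q. hscale H (f a) b) \<in> hs.span (snd ` set r)" using Cons by simp
      ultimately show ?case using hs.span_add by (simp add: case_prod_unfold)
    qed (simp add: hs.span_zero)
    then show ?thesis unfolding h by simp
  qed
  then show ?thesis by (intro exI[of _ "snd ` set r"]) auto
qed

text \<open>In finite dimension every nonzero left ideal contains a simple one, namely one of least
  dimension. A complement of an ideal that contains all simple left ideals contains none of them, so
  it is zero.\<close>

lemma semisimple_socle_ring:
  assumes ss: "semisimple_module univ_ring (regular_module :: ('h, 'h) lmod)"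
  shows "socle_ring TYPE('h)"
proof
  obtain B where B: "finite B" "hs.span B = UNIV" using finite_dimensional[OF ss] by blast
  obtain B' where B': "B' \<subseteq> B" "hs.independent B'" "B \<subseteq> hs.span B'"
    by (rule hs.maximal_independent_subset[of B])
  have "hs.span B' = UNIV" using hs.span_mono[OF B'(3)] B(2) by (simp add: hs.span_span top.extremum_unique)
  then interpret fd: finite_dimensional_vector_space "hscale H" B'
    using finite_subset[OF B'(1) B(1)] B'(2) by unfold_locales auto
  have min: "\<exists>L\<subseteq>I. simple_ideal L" if I: "left_ideal I" "I \<noteq> {0}" for I :: "'h set"
  proof -
    let ?P = "\<lambda>L. left_ideal L \<and> L \<noteq> {0} \<and> L \<subseteq> I"
    have "\<exists>L. ?P L \<and> (\<forall>X. ?P X \<longrightarrow> hs.dim L \<le> hs.dim X)"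
      by (rule ex_has_least_nat[of ?P I]) (simp add: I)
    then obtain L where L: "?P L \<and> (\<forall>X. ?P X \<longrightarrow> hs.dim L \<le> hs.dim X)" by (rule exE)
    note LP = conjunct1[OF L] and Lmin = conjunct2[OF L, rule_format]
    have "X = {0} \<or> X = L" if X: "left_ideal X" "X \<subseteq> L" for X
    proof (cases "X = {0}")
      case False
      then have "hs.dim L \<le> hs.dim X" using LP X by (intro Lmin conjI) (simp_all add: subset_trans[of X L I])
      then have "X = L"
        using LP by (intro fd.subspace_dim_equal left_ideal_subspace X) simp_all
      then show ?thesis ..
    qed simp
    then have "simple_ideal L" using LP unfolding simple_ideal_def by simp
    then show ?thesis using LP by (intro exI[of _ L]) simp
  qed
  fix I :: "'h set" assume I: "left_ideal I" and simp: "\<And>L. simple_ideal L \<Longrightarrow> L \<subseteq> I"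
  obtain C where C: "left_ideal C" and c: "complementary regular_module I C"
    using ss I unfolding semisimple_module_def by blast
  have int: "I \<inter> C = {0}" and sum: "{x + y |x y. x \<in> I \<and> y \<in> C} = UNIV"
    using c by (simp_all add: complementary_def)
  have "C = {0}"
  proof (rule ccontr)
    assume "C \<noteq> {0}"
    then obtain L where L: "L \<subseteq> C" "simple_ideal L" using min[OF C] by blast
    then have "L \<subseteq> {0}" using simp[OF L(2)] int by blast
    moreover have "0 \<in> L" "L \<noteq> {0}"
      using L(2) left_idealD(1)[of L] by (auto simp: simple_ideal_def add_subgroup_zero)
    ultimately show False by blast
  qed
  then show "I = UNIV" using sum by auto
qed

end


section \<open>The degree one part\<close>

text \<open>Keeps degree one in the form \<open>apart A 1\<close> and
  \<open>part_proj 1\<close>.\<close>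

declare One_nat_def [simp del]

context graded_hopf_action
begin

lemma ascale_zero_part: "\<exists>c. part_proj 0 a = ascale A c 1"
  using part_proj_mem[of 0 a] by (auto simp: ga.connected)

text \<open>Products of degree one arise from degrees 0 and 1 alone. The identity is checked on
  homogeneous elements and extended additively in each factor.\<close>

lemma part_proj_one_mult:
  "part_proj 1 (a * b) = part_proj 0 a * part_proj 1 b + part_proj 1 a * part_proj 0 b" (is "?l a b = ?r a b")
proof -
  have hom: "?l x y = ?r x y" if x: "x \<in> apart A i" and y: "y \<in> apart A j" for x y i j
    using part_proj_homogeneous[OF x] part_proj_homogeneous[OF y]
      part_proj_homogeneous[OF ga.part_mult[OF x y]] by auto
  have left: "?l x b = ?r x b" if x: "x \<in> apart A i" for x i
  proof -
    let ?Y = "{y. ?l x y - ?r x y \<in> {0}}"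
    have "add_subgroup ?Y"
      by (rule add_subgroup_vimage[OF _ add_subgroup_singleton])
        (simp add: additive_on_def part_proj_add algebra_simps)
    moreover have "apart A j \<subseteq> ?Y" for j using hom[OF x] by auto
    ultimately have "UNIV \<subseteq> ?Y" by (rule direct_decomposition_generated[OF ga.decomposition])
    then show ?thesis by auto
  qed
  let ?X = "{x. ?l x b - ?r x b \<in> {0}}"
  have "add_subgroup ?X"
    by (rule add_subgroup_vimage[OF _ add_subgroup_singleton])
      (simp add: additive_on_def part_proj_add algebra_simps)
  moreover have "apart A i \<subseteq> ?X" for i using left by auto
  ultimately have "UNIV \<subseteq> ?X" by (rule direct_decomposition_generated[OF ga.decomposition])
  then show ?thesis by auto
qed

lemma generated_UNIV:
  assumes "fin_gen_degree_one A" and "ga.subspace B" "1 \<in> B" "\<And>x y. x \<in> B \<Longrightarrow> y \<in> B \<Longrightarrow> x * y \<in> B"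
    "apart A 1 \<subseteq> B"
  shows "B = UNIV"
proof -
  obtain X where X: "X \<subseteq> apart A 1"
    "\<forall>B. ga.subspace B \<and> 1 \<in> B \<and> (\<forall>x\<in>B. \<forall>y\<in>B. x * y \<in> B) \<and> X \<subseteq> B \<longrightarrow> B = UNIV"
    using assms(1) unfolding fin_gen_degree_one_def by (elim exE conjE) (rule that)
  show ?thesis using X(2)[rule_format, of B] X(1) assms(2-5) by (simp add: subset_trans)
qed

text \<open>By the product rule for \<open>part_proj 1\<close>, the elements whose degree one
  component lies in the span of the generators form a subalgebra. It contains the generators, hence
  everything.\<close>

lemma degree_one_finite_span:
  assumes "fin_gen_degree_one A"
  obtains X where "finite X" "X \<subseteq> apart A 1" "apart A 1 \<subseteq> ga.span X"
proof -
  obtain X where X: "finite X" "X \<subseteq> apart A 1"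
    "\<forall>B. ga.subspace B \<and> 1 \<in> B \<and> (\<forall>x\<in>B. \<forall>y\<in>B. x * y \<in> B) \<and> X \<subseteq> B \<longrightarrow> B = UNIV"
    using assms unfolding fin_gen_degree_one_def by (elim exE conjE) (rule that)
  let ?B = "{a. part_proj 1 a \<in> ga.span X}"
  have sub: "ga.subspace ?B"
  proof (rule ga.subspaceI)
    have "part_proj 1 0 = 0" using part_proj_add[of 1 0 0] by simp
    then show "0 \<in> ?B" by (simp add: ga.span_zero)
  qed (simp_all add: part_proj_add part_proj_scale ga.span_add ga.span_scale)
  have one: "1 \<in> ?B" using part_proj_homogeneous[OF one_part, of 1] by (simp add: ga.span_zero)
  have mult: "a * b \<in> ?B" if "a \<in> ?B" "b \<in> ?B" for a b
  proof -
    obtain c d where "part_proj 0 a = ascale A c 1" "part_proj 0 b = ascale A d 1"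
      using ascale_zero_part by meson
    then have "part_proj 1 (a * b) = ascale A c (part_proj 1 b) + ascale A d (part_proj 1 a)"
      by (simp add: part_proj_one_mult flip: ga.scale_mult_left ga.scale_mult_right)
    then show ?thesis using that by (simp add: ga.span_add ga.span_scale)
  qed
  have XB: "X \<subseteq> ?B"
  proof
    fix x assume x: "x \<in> X"
    then have "part_proj 1 x = x" using part_proj_homogeneous[of x 1 1] X(2) by auto
    then show "x \<in> ?B" using x by (simp add: ga.span_base)
  qed
  have "?B = UNIV" by (rule X(3)[rule_format]) (intro conjI ballI sub one mult XB)
  then have B: "part_proj 1 a \<in> ga.span X" for a by blast
  have "apart A 1 \<subseteq> ga.span X"
  proof
    fix a assume a: "a \<in> apart A 1"
    show "a \<in> ga.span X" using B[of a] part_proj_homogeneous[OF a, of 1] by simp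
  qed
  then show ?thesis by (rule that[OF X(1,2)])
qed

text \<open>\<open>augmentation\<close> is a definite description over sums of terms of positive
  degree. The projection onto degree 0 kills these terms, which forces the scalar.\<close>

lemma augmentation_eq:
  assumes c: "part_proj 0 a = ascale A c 1"
  shows "augmentation A a = c"
  unfolding augmentation_def
proof (rule the_equality)
  let ?g = "component (apart A) a"
  note g = component_props[OF ga.decomposition UNIV_I, of a]
  obtain n where n: "{i. ?g i \<noteq> 0} \<subseteq> {..n}"
    using finite_nat_set_iff_bounded_le[of "{i. ?g i \<noteq> 0}"] g(1) by auto
  have "a = (\<Sum>i\<le>n. ?g i)"
    by (rule component_sum_superset[OF ga.decomposition UNIV_I finite_atMost n])
  also have "\<dots> = ?g 0 + (\<Sum>i=1..n. ?g i)"
  proof -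
    have "{..n} = insert 0 {1..n}" by auto
    then show ?thesis by simp
  qed
  finally have "a = ascale A c 1 + (\<Sum>i=1..n. ?g i)" using c by (simp add: part_proj_def)
  then show "\<exists>f n. (\<forall>i. f i \<in> apart A i) \<and> a = ascale A c 1 + (\<Sum>i=1..n. f i)"
    using g(2) by blast
next
  fix c' assume "\<exists>f n. (\<forall>i. f i \<in> apart A i) \<and> a = ascale A c' 1 + (\<Sum>i=1..n. f i)"
  then obtain f n where f: "\<And>i. f i \<in> apart A i" and a: "a = ascale A c' 1 + (\<Sum>i=1..n. f i)" by auto
  have add: "additive_on UNIV (part_proj 0)" by (simp add: additive_on_def part_proj_add)
  have "part_proj 0 (\<Sum>i=1..n. f i) = (\<Sum>i=1..n. part_proj 0 (f i))"
    by (rule additive_on_sum[OF add add_subgroup_UNIV]) simp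
  also have "\<dots> = 0" by (rule sum.neutral) (simp add: part_proj_homogeneous[OF f])
  finally have "part_proj 0 a = part_proj 0 (ascale A c' 1)" by (simp add: a part_proj_add)
  also have "\<dots> = ascale A c' 1"
    using part_proj_homogeneous[OF part_scale[OF one_part], of 0 c'] by simp
  finally have "ascale A c' 1 = ascale A c 1" using c by simp
  then show "c' = c" by (simp add: ga.scale_cancel_right)
qed

lemma augmentation_simps:
  "augmentation A (a + b) = augmentation A a + augmentation A b"
  "augmentation A (ascale A c a) = c * augmentation A a"
  "augmentation A 1 = 1"
proof -
  have aug: "part_proj 0 a = ascale A (augmentation A a) 1" for a
    using ascale_zero_part[of a] augmentation_eq by metis
  show "augmentation A (a + b) = augmentation A a + augmentation A b"
    by (rule augmentation_eq) (simp add: part_proj_add aug[of a] aug[of b] ga.scale_left_distrib)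
  show "augmentation A (ascale A c a) = c * augmentation A a"
    by (rule augmentation_eq) (simp add: part_proj_scale aug[of a])
  show "augmentation A 1 = 1"
    by (rule augmentation_eq) (simp add: part_proj_homogeneous[OF one_part])
qed

text \<open>Inflating \<open>V\<close> and then restricting along \<open>eta\<close> gives back the
  action on \<open>V\<close>.\<close>

lemma smash_proj_eta: "smash_proj H A (eta h) = h"
proof -
  have "bilinear_map AS HS HS (\<lambda>a h. hscale H (augmentation A a) h)"
    by (rule bilinear_mapI)
      (simp_all add: augmentation_simps hs.scale_left_distrib hs.scale_right_distrib mult.commute)
  from tensor_lift_pure[OF hspace_module this, of 1 h] show ?thesis
    by (simp add: smash_proj_def eta_def augmentation_simps)
qed

text \<open>Mathematically the same module as \<open>hopf_tensor H W V\<close>. It is cut out of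
  \<open>PM V\<close>, so its elements are functionals on bilinear forms on all of \<open>A\<close>
  and \<open>V\<close> instead of \<open>W\<close> and \<open>V\<close>.\<close>

definition degree_one_tensor :: "('h, 'v::ab_group_add) lmod \<Rightarrow> ('h, ('k, 'a, 'v) tensor) lmod" where
  "degree_one_tensor V = HM (PM V) (mpart (PM V) 1)"

lemma degree_one_tensor_simps [simp]:
  "mcar (degree_one_tensor V) = tspan AS (BS V) (apart A 1) (mcar V)"
  "act (degree_one_tensor V) h = act (PM V) (eta h)"
  by (simp_all add: degree_one_tensor_def One_nat_def)

lemma degree_one_module_simps [simp]:
  "mcar (degree_one_module A) = apart A 1" "act (degree_one_module A) h = aact A h"
  by (simp_all add: degree_one_module_def)

context
  fixes V :: "('h, 'v::ab_group_add) lmod"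
  assumes V: "left_module univ_ring V"
begin

lemma degree_one_tensor_module: "left_module univ_ring (degree_one_tensor V)"
  unfolding degree_one_tensor_def by (rule hmod_part[OF proj_module_graded[OF V]])

lemma degree_one_module_module: "left_module univ_ring (degree_one_module A)"
  by unfold_locales
    (simp_all add: part_subgroup action_graded aact_add_left aact_add_right
      aact_mult_left aact_one_left)

abbreviation (input) "WS \<equiv> BS (degree_one_module A)"

lemma WS_simps: "mcar WS = apart A 1" "act WS c w = ascale A c w"
  by (simp_all add: action_scale)

lemma hopf_tensor_mcar: "mcar (hopf_tensor H (degree_one_module A) V) = tspan WS (BS V) (apart A 1) (mcar V)"
  by (simp add: hopf_tensor_def)

lemma hopf_tensor_subgroup: "add_subgroup (mcar (hopf_tensor H (degree_one_module A) V))"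
  using mod_subgroup[OF tensor_space_module[OF base_space_module[OF degree_one_module_module], of "BS V"]]
  by (simp add: hopf_tensor_mcar)

lemma hopf_tensor_pure_mem:
  "w \<in> apart A 1 \<Longrightarrow> v \<in> mcar V \<Longrightarrow>
    tpure WS (BS V) (aact A g w) (act V h v) \<in> mcar (hopf_tensor H (degree_one_module A) V)"
  unfolding hopf_tensor_mcar by (rule tspan_pure) (simp_all add: act_U[OF V] action_graded)

lemma hopf_tensor_act: "act (hopf_tensor H (degree_one_module A) V) h =
    tensor_lift WS (BS V) (\<lambda>w v. sweedler H h (\<lambda>h1 h2. tpure WS (BS V) (aact A h1 w) (act V h2 v)))"
  by (simp add: hopf_tensor_def)

lemma hopf_tensor_act_bilinear: "bilinear_map WS (BS V) (tensor_space WS (BS V))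
    (\<lambda>w v. sweedler H h (\<lambda>h1 h2. tpure WS (BS V) (aact A h1 w) (act V h2 v)))"
proof -
  let ?HT = "hopf_tensor H (degree_one_module A) V" and ?T2 = "tensor_space WS (BS V)" and ?pW = "tpure WS (BS V)"
  let ?q = "\<lambda>w v. sweedler H h (\<lambda>h1 h2. ?pW (aact A h1 w) (act V h2 v))"
  note mem = hopf_tensor_pure_mem and Vc = act_U[OF V] and sgT = hopf_tensor_subgroup
  note T2 = tensor_space_module[OF base_space_module[OF degree_one_module_module], of "BS V"]
  have tsc: "additive_on (mcar ?T2) (tscale c)" for c by (simp add: additive_on_def tscale_simps)
  have T2HT: "mcar ?T2 = mcar ?HT" by (simp add: hopf_tensor_mcar)
  show ?thesis
  proof (rule bilinear_mapI)
    fix c w v assume w: "w \<in> mcar WS" and v: "v \<in> mcar (BS V)"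
    have w': "w \<in> apart A 1" using w by (simp only: WS_simps)
    have v': "v \<in> mcar V" using v by simp
    have aw: "aact A h1 w \<in> mcar WS" for h1 unfolding WS_simps by (rule action_graded[OF w'])
    have av: "act V h2 v \<in> mcar (BS V)" for h2 using Vc[OF v'] by simp
    have sc: "tscale c (?q w v) = sweedler H h (\<lambda>h1 h2. tscale c (?pW (aact A h1 w) (act V h2 v)))"
      by (rule sweedler_additive[OF tsc mod_subgroup[OF T2]]) (use mem[OF w' v'] T2HT in simp)
    show "?q w v \<in> mcar ?T2"
      unfolding T2HT by (rule sweedler_closed[OF sgT mem[OF w' v']])
    show "?q (act WS c w) v = act ?T2 c (?q w v)"
      using tpure_scale_left[OF aw av, of c] sc by (simp add: WS_simps(2) aact_scale(2) del: base_space_simps)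
    show "?q w (act (BS V) c v) = act ?T2 c (?q w v)"
      using tpure_scale_right[OF aw av, of _ c] sc by (simp add: act_hscale(2)[OF V v'])
    show "?q (w + w2) v = ?q w v + ?q w2 v" if w2: "w2 \<in> mcar WS" for w2
    proof -
      have "aact A h1 w2 \<in> mcar WS" for h1
        unfolding WS_simps by (rule action_graded) (use w2 in \<open>simp only: WS_simps\<close>)
      from tpure_add_left[OF aw this av] show ?thesis by (simp add: aact_add_right sweedler_fun_add)
    qed
    show "?q w (v + v2) = ?q w v + ?q w v2" if v2: "v2 \<in> mcar (BS V)" for v2
    proof -
      have "act V h2 v2 \<in> mcar (BS V)" for h2 using Vc v2 by simp
      from tpure_add_right[OF aw av this] show ?thesis
        using mod_add_right[OF V _ v', of _ v2] v2 by (simp add: sweedler_fun_add)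
    qed
  qed
qed

lemma hopf_tensor_closed:
  "t \<in> mcar (hopf_tensor H (degree_one_module A) V) \<Longrightarrow>
    act (hopf_tensor H (degree_one_module A) V) h t \<in> mcar (hopf_tensor H (degree_one_module A) V)"
  using tensor_lift_closed[OF tensor_space_module[OF base_space_module[OF degree_one_module_module], of "BS V"]
      hopf_tensor_act_bilinear, of t h]
  by (simp add: hopf_tensor_mcar hopf_tensor_act)

text \<open>Lifting \<open>tpure\<close> compares the two encodings. The inverse is defined on all
  of \<open>A \<otimes> V\<close> by first projecting \<open>A\<close> onto degree one, which makes
  injectivity a check on pure tensors.\<close>

lemma hopf_tensor_iso: "lmod_iso univ_ring (hopf_tensor H (degree_one_module A) V) (degree_one_tensor V)"
proof -
  let ?HT = "hopf_tensor H (degree_one_module A) V" and ?T1 = "tensor_space AS (BS V)"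
    and ?T2 = "tensor_space WS (BS V)"
  note Wm = base_space_module[OF degree_one_module_module]
  note mHT = hopf_tensor_mcar and sgT = hopf_tensor_subgroup and cH = hopf_tensor_closed
  let ?pA = "tpure AS (BS V)" and ?pW = "tpure WS (BS V)"
  have b1: "bilinear_map WS (BS V) ?T1 ?pA"
    by (rule bilinear_mapI)
      (use tpure_scale_left[of _ AS _ "BS V"] tpure_scale_right[of _ AS _ "BS V"] in
        \<open>simp_all add: action_scale tspan_pure tpure_add_left tpure_add_right\<close>)
  have b2: "bilinear_map AS (BS V) ?T2 (\<lambda>a v. ?pW (part_proj 1 a) v)"
  proof (rule bilinear_mapI)
    fix c a v assume v: "v \<in> mcar (BS V)"
    have m: "part_proj 1 a \<in> mcar WS" for a by (simp add: WS_simps(1) part_proj_mem del: base_space_simps)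
    show "?pW (part_proj 1 a) v \<in> mcar ?T2" using m v by (simp add: tspan_pure del: base_space_simps)
    show "?pW (part_proj 1 (act AS c a)) v = act ?T2 c (?pW (part_proj 1 a) v)"
      using tpure_scale_left[OF m v, of c a] by (simp add: part_proj_scale WS_simps(2) del: base_space_simps)
    show "?pW (part_proj 1 a) (act (BS V) c v) = act ?T2 c (?pW (part_proj 1 a) v)"
      using tpure_scale_right[OF m v, of a c] by (simp del: base_space_simps)
    show "?pW (part_proj 1 (a + b)) v = ?pW (part_proj 1 a) v + ?pW (part_proj 1 b) v" for b
      unfolding part_proj_add by (rule tpure_add_left[OF m m v])
    show "?pW (part_proj 1 a) (v + w) = ?pW (part_proj 1 a) v + ?pW (part_proj 1 a) w"
      if "w \<in> mcar (BS V)" for w by (rule tpure_add_right[OF m v that])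
  qed
  let ?f = "tensor_lift WS (BS V) ?pA" and ?g = "tensor_lift AS (BS V) (\<lambda>a v. ?pW (part_proj 1 a) v)"
  note T1 = tensor_space_module[OF aspace_module, of "BS V"] and T2 = tensor_space_module[OF Wm, of "BS V"]
  have f: "additive_on (mcar ?HT) ?f"
    using tensor_lift_additive_on[OF T1 b1] by (simp add: mHT WS_simps(1) del: base_space_simps(1)) simp
  have fp: "?f (?pW w v) = ?pA w v" if "w \<in> apart A 1" "v \<in> mcar V" for w v
    by (rule tensor_lift_pure[OF T1 b1]) (use that in \<open>simp_all add: WS_simps(1) del: base_space_simps(1)\<close>, simp)
  have g: "additive_on (tspan AS (BS V) UNIV (mcar V)) ?g"
    using tensor_lift_additive_on[OF T2 b2] by simp
  have gp: "?g (?pA a v) = ?pW (part_proj 1 a) v" if "v \<in> mcar V" for a v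
    using tensor_lift_pure[OF T2 b2, of a v] that by simp
  have p1: "part_proj 1 w = w" if "w \<in> apart A 1" for w
    using part_proj_homogeneous[OF that, of 1] by simp
  have sub1: "tspan AS (BS V) (apart A 1) (mcar V) \<subseteq> tspan AS (BS V) UNIV (mcar V)"
    by (rule tspan_mono) simp_all
  have sg1: "add_subgroup (tspan AS (BS V) (apart A 1) (mcar V))"
    by (rule tspan_subgroup) (simp_all add: part_scale)
  have f1: "?f t \<in> tspan AS (BS V) (apart A 1) (mcar V)" if "t \<in> mcar ?HT" for t
    by (rule tensor_lift_fun_closed[OF sg1])
      (use that in \<open>simp_all add: mHT WS_simps(1) tspan_pure del: base_space_simps(1)\<close>, simp_all add: tspan_pure)
  have gf: "?g (?f t) = t" if t: "t \<in> mcar ?HT" for t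
  proof (rule additive_on_tspan_eqI[OF _ _ _ t[unfolded mHT]])
    show "additive_on (tspan WS (BS V) (apart A 1) (mcar V)) (\<lambda>t. ?g (?f t))"
      unfolding mHT[symmetric] by (rule additive_on_comp[OF g f]) (use f1 sub1 in blast)
    show "additive_on (tspan WS (BS V) (apart A 1) (mcar V)) (\<lambda>t. t)" by (simp add: additive_on_def)
    show "?g (?f (?pW w v)) = ?pW w v" if "w \<in> apart A 1" "v \<in> mcar V" for w v
      using that by (simp add: fp gp p1)
  qed
  have "?f ` mcar ?HT = tspan AS (BS V) (apart A 1) (mcar V)"
  proof
    show "?f ` mcar ?HT \<subseteq> tspan AS (BS V) (apart A 1) (mcar V)" using f1 by blast
    have im: "add_subgroup (?f ` mcar ?HT)" by (rule add_subgroup_image[OF f sgT])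
    show "tspan AS (BS V) (apart A 1) (mcar V) \<subseteq> ?f ` mcar ?HT"
    proof
      fix t assume "t \<in> tspan AS (BS V) (apart A 1) (mcar V)"
      then show "t \<in> ?f ` mcar ?HT"
      proof (induction rule: tspan_induct)
        case zero
        show ?case by (rule add_subgroup_zero[OF im])
      next
        case (add w v t)
        have "?pW w v \<in> mcar ?HT" unfolding mHT by (rule tspan_pure[OF add(1,2)])
        then have "?pA w v \<in> ?f ` mcar ?HT" using fp[OF add(1,2)] by (metis imageI)
        then show ?case using add(4) by (rule add_subgroup_add[OF im])
      qed
    qed
  qed
  moreover have "inj_on ?f (mcar ?HT)" by (rule inj_on_inverseI[of _ ?g]) (rule gf)
  moreover have "lmod_hom univ_ring ?HT (degree_one_tensor V) ?f"
  proof (rule lmod_homI)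
    fix t assume t: "t \<in> mcar ?HT"
    show "?f t \<in> mcar (degree_one_tensor V)" using f1[OF t] by simp
    show "?f (t + u) = ?f t + ?f u" if "u \<in> mcar ?HT" for u by (rule additive_onD[OF f t that])
    fix h
    note act_HT = hopf_tensor_act[of h] and q = hopf_tensor_act_bilinear[of h]
    have aH: "additive_on (mcar ?HT) (act ?HT h)"
      unfolding act_HT mHT using tensor_lift_additive_on[OF T2 q] by simp
    note mem = hopf_tensor_pure_mem and Vc = act_U[OF V]
    let ?q = "\<lambda>w v. sweedler H h (\<lambda>h1 h2. ?pW (aact A h1 w) (act V h2 v))"
    have aP: "additive_on (mcar (PM V)) (act (PM V) (eta h))"
      by (rule proj_act_additive_right[OF V eta_carrier])
    have "?f (act ?HT h t) = act (PM V) (eta h) (?f t)"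
    proof (rule additive_on_tspan_eqI[OF _ _ _ t[unfolded mHT]])
      show "additive_on (tspan WS (BS V) (apart A 1) (mcar V)) (\<lambda>t. ?f (act ?HT h t))"
        unfolding mHT[symmetric] by (rule additive_on_comp[OF f aH]) (use cH in blast)
      show "additive_on (tspan WS (BS V) (apart A 1) (mcar V)) (\<lambda>t. act (PM V) (eta h) (?f t))"
        unfolding mHT[symmetric]
        by (rule additive_on_comp[OF aP f]) (use f1 sub1 in auto)
      fix w v assume w: "w \<in> apart A 1" and v: "v \<in> mcar V"
      have "act ?HT h (?pW w v) = ?q w v"
        unfolding act_HT by (rule tensor_lift_pure[OF T2 q]) (use w v in simp_all)
      then have "?f (act ?HT h (?pW w v)) = sweedler H h (\<lambda>h1 h2. ?f (?pW (aact A h1 w) (act V h2 v)))"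
        using sweedler_additive[OF f sgT mem[OF w v], of h] by simp
      also have "\<dots> = sweedler H h (\<lambda>h1 h2. ?pA (aact A h1 w) (act V h2 v))"
        by (simp add: fp action_graded[OF w] Vc[OF v])
      also have "\<dots> = act (PM V) (eta h) (?pA w v)"
        using proj_act_pure[OF V v, of 1 h w] by (simp add: eta_def proj_term_def)
      finally show "?f (act ?HT h (?pW w v)) = act (PM V) (eta h) (?f (?pW w v))"
        by (simp add: fp[OF w v])
    qed
    then show "?f (act ?HT h t) = act (degree_one_tensor V) h (?f t)" by simp
  qed
  ultimately show ?thesis unfolding lmod_iso_def bij_betw_def degree_one_tensor_simps by blast
qed

text \<open>Degree one of \<open>A\<close> has a finite spanning set, and so has \<open>V\<close>,
  being the orbit of one vector under the finite-dimensional \<open>H\<close>. Scalars act through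
  \<open>eta\<close>, so \<open>H\<close>-submodules are subspaces and the tensors of the two
  spanning sets generate.\<close>

lemma degree_one_tensor_generated:
  assumes gen: "fin_gen_degree_one A" and ss: "semisimple_module univ_ring (regular_module :: ('h, 'h) lmod)"
    and simple: "simple_module univ_ring V"
  shows "\<exists>B. finite B \<and> B \<subseteq> mcar (degree_one_tensor V) \<and>
    (\<forall>X. submodule univ_ring (degree_one_tensor V) X \<longrightarrow> B \<subseteq> X \<longrightarrow> X = mcar (degree_one_tensor V))"
proof -
  obtain W where W: "finite W" "W \<subseteq> apart A 1" "apart A 1 \<subseteq> ga.span W"
    by (rule degree_one_finite_span[OF gen])
  obtain G where G: "finite G" "hs.span G = UNIV" using finite_dimensional[OF ss] by blast
  obtain v where v: "v \<in> mcar V" "v \<noteq> 0"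
    using simple left_module.mcar_zero[OF V] unfolding simple_module_def by blast
  let ?p = "tpure AS (BS V)"
  let ?B = "(\<lambda>(w, g). ?p w (act V g v)) ` (W \<times> G)"
  have hv: "act V h v \<in> mcar V" for h by (rule act_U[OF V v(1)])
  have "X = mcar (degree_one_tensor V)"
    if X: "submodule univ_ring (degree_one_tensor V) X" and BX: "?B \<subseteq> X" for X
  proof
    show "X \<subseteq> mcar (degree_one_tensor V)" by (rule submoduleD(1)[OF X])
    note XS = submoduleD(2)[OF X]
    have sc: "?p (ascale A c a) u \<in> X" if "?p a u \<in> X" "u \<in> mcar V" for c a u
    proof -
      have "act (PM V) (eta (hscale H c 1)) (?p a u) = ?p (ascale A c a) u"
        unfolding eta_scalar using alpha_act_pure[OF V that(2), of "ascale A c 1" a]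
        by (simp flip: ga.scale_mult_left)
      then show ?thesis using submoduleD(3)[OF X _ that(1), of "hscale H c 1"] by simp
    qed
    have z: "?p 0 u = 0" "?p a 0 = 0" if "u \<in> mcar V" for a u
      using tpure_add_left[of 0 AS 0 u "BS V"] tpure_add_right[of a AS 0 "BS V" 0] that
        left_module.mcar_zero[OF V] by simp_all
    have 1: "?p a (act V g v) \<in> X" if a: "a \<in> apart A 1" and g: "g \<in> G" for a g
    proof -
      have "ga.subspace {a. ?p a (act V g v) \<in> X}"
        by (rule ga.subspaceI)
          (use z(1)[OF hv] add_subgroup_zero[OF XS] add_subgroup_add[OF XS] sc hv in \<open>simp_all add: tpure_add_left\<close>)
      then have "ga.span W \<subseteq> {a. ?p a (act V g v) \<in> X}"
        using BX g by (intro ga.span_minimal) auto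
      then show ?thesis using a W(3) by blast
    qed
    have 2: "?p a (act V h v) \<in> X" if a: "a \<in> apart A 1" for a h
    proof -
      have "hs.subspace {h. ?p a (act V h v) \<in> X}"
      proof (rule hs.subspaceI)
        have "act V 0 v = 0"
          using additive_on_zero[OF lmod_homD(4)[OF orbit_hom[OF V v(1)]]] by (simp add: add_subgroup_UNIV)
        then show "0 \<in> {h. ?p a (act V h v) \<in> X}"
          using z(2)[OF v(1)] add_subgroup_zero[OF XS] by simp
        show "g + h \<in> {h. ?p a (act V h v) \<in> X}"
          if "g \<in> {h. ?p a (act V h v) \<in> X}" "h \<in> {h. ?p a (act V h v) \<in> X}" for g h
          using that add_subgroup_add[OF XS] mod_add_left[OF V, of g h v] v(1) hv
          by (simp add: tpure_add_right)
        show "hscale H c h \<in> {h. ?p a (act V h v) \<in> X}" if "h \<in> {h. ?p a (act V h v) \<in> X}" for c h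
        proof -
          have "?p a (act V (hscale H c h) v) = ?p (ascale A c a) (act V h v)"
            using tpure_scale_left[of a AS "act V h v" "BS V" c] tpure_scale_right[of a AS "act V h v" "BS V" c]
              hv act_hscale(1)[OF V v(1), of c h] by simp
          then show ?thesis using sc[OF _ hv] that by simp
        qed
      qed
      then have "hs.span G \<subseteq> {h. ?p a (act V h v) \<in> X}"
        using 1[OF a] by (intro hs.span_minimal) auto
      then show ?thesis using G(2) by blast
    qed
    show "mcar (degree_one_tensor V) \<subseteq> X"
    proof
      fix t assume "t \<in> mcar (degree_one_tensor V)"
      then have "t \<in> tspan AS (BS V) (apart A 1) (mcar V)" by simp
      then show "t \<in> X"
      proof (induction rule: tspan_induct)
        case zero
        show ?case by (rule add_subgroup_zero[OF XS])
      next
        case (add w u t)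
        obtain h where "u = act V h v" using simple_module_cyclic[OF simple v add(2)] by blast
        then show ?case using 2[OF add(1)] add(4) add_subgroup_add[OF XS] by simp
      qed
    qed
  qed
  moreover have "finite ?B" using W(1) G(1) by simp
  moreover have "?B \<subseteq> mcar (degree_one_tensor V)"
    using W(2) hv by (auto intro!: tspan_pure)
  ultimately show ?thesis by (intro exI[of _ ?B]) simp
qed

end


section \<open>The first two terms of a minimal resolution\<close>

lemma induced_image_subset:
  assumes M: "left_module S M" and U: "left_module univ_ring U"
    and \<phi>: "lmod_hom univ_ring U (HM M (mcar M)) \<phi>"
    and X: "submodule S M X" and \<phi>X: "\<And>u. u \<in> mcar U \<Longrightarrow> \<phi> u \<in> X"
  shows "induced_map H A M U \<phi> ` mcar (PM U) \<subseteq> X"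
proof
  fix m assume "m \<in> induced_map H A M U \<phi> ` mcar (PM U)"
  then obtain t where t: "t \<in> tspan AS (BS U) UNIV (mcar U)" "m = induced_map H A M U \<phi> t" by auto
  have "induced_map H A M U \<phi> t \<in> X"
    using t(1)
  proof (induction rule: tspan_induct)
    case zero
    have "induced_map H A M U \<phi> 0 = 0"
      by (rule additive_on_zero[OF induced_additive[OF M U \<phi>] mod_subgroup[OF proj_module_left[OF U]]])
    then show ?case using add_subgroup_zero[OF submoduleD(2)[OF X]] by simp
  next
    case (add a u t)
    have "induced_map H A M U \<phi> (tpure AS (BS U) a u + t) = act M (alpha a) (\<phi> u) + induced_map H A M U \<phi> t"
      using additive_onD[OF induced_additive[OF M U \<phi>], of "tpure AS (BS U) a u" t] add
      by (simp add: tspan_pure induced_pure[OF M U \<phi>])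
    moreover have "act M (alpha a) (\<phi> u) \<in> X"
      by (rule submoduleD(3)[OF X alpha_carrier \<phi>X[OF add(2)]])
    ultimately show ?case using add(4) add_subgroup_add[OF submoduleD(2)[OF X]] by simp
  qed
  then show "m \<in> X" using t(2) by simp
qed

text \<open>The counit of the adjunction, restricted to degree \<open>n\<close>. Its image is the
  submodule of \<open>Q\<close> generated by \<open>mpart Q n\<close>.\<close>

definition gen_map :: "(('k, 'a, 'h) tensor, 'q::ab_group_add) glmod \<Rightarrow> int \<Rightarrow> ('k, 'a, 'q) tensor \<Rightarrow> 'q" where
  "gen_map Q n = induced_map H A Q (HM Q (mpart Q n)) (\<lambda>u. u)"

abbreviation "gen_source Q n \<equiv> PM (HM Q (mpart Q n))"

context
  fixes Q :: "(('k, 'a, 'h) tensor, 'q::ab_group_add) glmod" and n :: int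
  assumes Q: "graded_module S Q"
begin

lemma gen_map_id: "lmod_hom univ_ring (HM Q (mpart Q n)) (HM Q (mpart Q n)) (\<lambda>u. u)"
  by (simp add: lmod_hom_def)

lemmas gen_map_graded = induced_graded[OF Q hmod_part[OF Q] gen_map_id, folded gen_map_def]

lemma gen_map_hom: "lmod_hom S (gen_source Q n) Q (gen_map Q n)"
  unfolding gen_map_def by (rule induced_hom[OF graded_moduleD(1)[OF Q] hmod_part[OF Q] gen_map_graded(1)])

lemma gen_map_one: "u \<in> mpart Q n \<Longrightarrow> gen_map Q n (tpure AS (BS (HM Q (mpart Q n))) 1 u) = u"
  unfolding gen_map_def
  using induced_pure_one[OF graded_moduleD(1)[OF Q] hmod_part[OF Q] gen_map_graded(1)] by simp

lemma gen_map_submodule: "graded_submodule S Q (gen_map Q n ` mcar (gen_source Q n))"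
  using graded_submodule_image[OF graded_module_shift[OF proj_module_graded[OF hmod_part[OF Q]]] Q
      gen_map_graded(2)] by simp

lemma gen_map_contains: "u \<in> mpart Q n \<Longrightarrow> u \<in> gen_map Q n ` mcar (gen_source Q n)"
  by (rule image_eqI[where x = "tpure AS (BS (HM Q (mpart Q n))) 1 u"]) (simp_all add: gen_map_one tspan_pure)

lemma gen_map_subset: "submodule S Q X \<Longrightarrow> mpart Q n \<subseteq> X \<Longrightarrow> gen_map Q n ` mcar (gen_source Q n) \<subseteq> X"
  unfolding gen_map_def
  by (rule induced_image_subset[OF graded_moduleD(1)[OF Q] hmod_part[OF Q] gen_map_graded(1)]) auto

end

text \<open>Compose the map from \<open>graded_projective_generated\<close> with the change of
  generators along \<open>\<theta>\<close>. Surjectivity of \<open>gen_map\<close> turns the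
  one-sided inverse obtained there into a two-sided one.\<close>

lemma graded_projective_iso:
  fixes Q :: "(('k, 'a, 'h) tensor, 'q::ab_group_add) glmod" and U :: "('h, 'u::ab_group_add) lmod"
  assumes Q: "graded_projective S Q" and U: "left_module univ_ring U"
    and \<theta>: "lmod_hom univ_ring U (HM Q (mpart Q n)) \<theta>" "bij_betw \<theta> (mcar U) (mpart Q n)"
    and gen: "gen_map Q n ` mcar (gen_source Q n) = mcar Q"
  obtains l where "graded_hom S Q (shift (PM U) (- n)) l"
    "\<And>t. t \<in> mcar (PM U) \<Longrightarrow> l (induced_map H A Q U \<theta> t) = t"
    "\<And>q. q \<in> mcar Q \<Longrightarrow> induced_map H A Q U \<theta> (l q) = q"
proof -
  have Qg: "graded_module S Q" using Q by (simp add: graded_projective_def)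
  note QL = graded_moduleD(1)[OF Qg]
  let ?N = "HM Q (mpart Q n)"
  have N: "left_module univ_ring ?N" by (rule hmod_part[OF Qg])
  obtain l0 where l0: "graded_hom S Q (shift (PM ?N) (- n)) l0"
    "\<And>t. t \<in> mcar (PM ?N) \<Longrightarrow> l0 (gen_map Q n t) = t"
    using graded_projective_generated[OF Q gen[unfolded gen_map_def]] unfolding gen_map_def by blast
  let ?i = "the_inv_into (mcar U) \<theta>"
  have i: "lmod_hom univ_ring ?N U ?i"
    by (rule lmod_hom_inv[OF mod_subgroup[OF U] mod_closed[OF U] \<theta>(1)]) (use \<theta>(2) in simp_all)
  have i_inv: "?i (\<theta> u) = u" if "u \<in> mcar U" for u
    using the_inv_into_f_f[OF bij_betw_imp_inj_on[OF \<theta>(2)] that] .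
  have i_inv': "\<theta> (?i q) = q" if "q \<in> mpart Q n" for q
    using f_the_inv_into_f[OF bij_betw_imp_inj_on[OF \<theta>(2)]] bij_betw_imp_surj_on[OF \<theta>(2)] that by simp
  let ?\<psi> = "\<lambda>q. tpure AS (BS U) 1 (?i q)"
  have \<psi>: "lmod_hom univ_ring ?N (HM (PM U) (mpart (PM U) 0)) ?\<psi>"
    by (rule lmod_hom_comp[OF i pure_one_hom[OF U]])
  let ?I = "induced_map H A (PM U) ?N ?\<psi>"
  note PUg = proj_module_graded[OF U] and PUL = proj_module_left[OF U]
  note I = induced_graded[OF PUg N \<psi>]
  have I': "graded_hom S (shift (PM ?N) (- n)) (shift (PM U) (- n)) ?I"
    using graded_homD[OF I(2)] unfolding graded_hom_def lmod_hom_def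
    by (simp del: proj_module_simps)
  define l where "l q = ?I (l0 q)" for q
  have l: "graded_hom S Q (shift (PM U) (- n)) l"
    unfolding l_def[abs_def] by (rule graded_hom_comp[OF l0(1) I'])
  have lh: "lmod_hom S Q (PM U) l"
    using graded_homD(1)[OF l] by (simp add: lmod_hom_def del: proj_module_simps)
  note \<theta>' = induced_graded[OF Qg U \<theta>(1)]
  let ?G = "induced_map H A Q U \<theta>"
  have Gh: "lmod_hom S (PM U) Q ?G" by (rule induced_hom[OF QL U \<theta>'(1)])
  have l1: "l q = tpure AS (BS U) 1 (?i q)" if q: "q \<in> mpart Q n" for q
  proof -
    have "tpure AS (BS ?N) 1 q \<in> mcar (PM ?N)" using q by (simp add: tspan_pure)
    from l0(2)[OF this] have "l0 q = tpure AS (BS ?N) 1 q" unfolding gen_map_one[OF Qg q] .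
    then show ?thesis unfolding l_def using induced_pure_one[OF PUL N I(1), of q] q by simp
  qed
  show ?thesis
  proof (rule that[OF l])
    fix t assume t: "t \<in> mcar (PM U)"
    show "l (?G t) = t"
    proof (rule proj_hom_eqI[OF U lmod_hom_comp[OF Gh lh] _ _ t])
      show "lmod_hom S (PM U) (PM U) (\<lambda>t. t)" by (simp add: lmod_hom_def)
      show "l (?G (tpure AS (BS U) 1 u)) = tpure AS (BS U) 1 u" if u: "u \<in> mcar U" for u
        using l1[OF bij_betwE[OF \<theta>(2), rule_format, OF u]] induced_pure_one[OF QL U \<theta>'(1) u] i_inv[OF u] by simp
    qed
  next
    fix q assume "q \<in> mcar Q"
    then obtain t where t: "t \<in> mcar (PM ?N)" "q = gen_map Q n t" using gen by blast
    have "?G (l (gen_map Q n t)) = gen_map Q n t"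
    proof (rule proj_hom_eqI[OF N _ gen_map_hom[OF Qg] _ t(1)])
      show "lmod_hom S (PM ?N) Q (\<lambda>t. ?G (l (gen_map Q n t)))"
        by (rule lmod_hom_comp[OF lmod_hom_comp[OF gen_map_hom[OF Qg] lh] Gh])
      fix u assume "u \<in> mcar ?N"
      then have u: "u \<in> mpart Q n" by simp
      have "?i u \<in> mcar U" using lmod_homD(1)[OF i, of u] u by simp
      then show "?G (l (gen_map Q n (tpure AS (BS ?N) 1 u))) = gen_map Q n (tpure AS (BS ?N) 1 u)"
        unfolding gen_map_one[OF Qg u] l1[OF u]
        using induced_pure_one[OF QL U \<theta>'(1)] i_inv'[OF u] by simp
    qed
    then show "?G (l q) = q" using t(2) by simp
  qed
qed

text \<open>A complement \<open>Y\<close> of \<open>ker f\<close> in degree \<open>n\<close> generates a graded submodule which together with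
  \<open>ker f\<close> is all of \<open>Q\<close>; by minimality it is \<open>Q\<close>, so \<open>Y\<close> is the whole degree \<open>n\<close> part.\<close>

lemma minimal_degree_part:
  fixes Q :: "(('k, 'a, 'h) tensor, 'q::ab_group_add) glmod" and N :: "(('k, 'a, 'h) tensor, 'n::ab_group_add) glmod"
  assumes R: "socle_ring TYPE('h)" and Q: "graded_module S Q" and N: "graded_module S N"
    and f: "graded_hom S Q N f" and small: "superfluous S Q (mod_ker Q f)"
    and cover: "\<And>q. q \<in> mcar Q \<Longrightarrow> \<exists>x\<in>gen_map Q n ` mcar (gen_source Q n). f q = f x"
  shows "gen_map Q n ` mcar (gen_source Q n) = mcar Q" and "inj_on f (mpart Q n)"
proof -
  note QL = graded_moduleD(1)[OF Q] and NL = graded_moduleD(1)[OF N]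
  let ?K = "mod_ker Q f" and ?U = "HM Q (mpart Q n)"
  note fh = lmod_homD[OF graded_homD(1)[OF f]]
  note K = submodule_ker[OF QL NL graded_homD(1)[OF f]]
  note Qn = graded_moduleD(4)[OF Q]
  \<comment> \<open>Minimality in the form used twice below, once for the submodule generated by
    degree \<open>n\<close> and once for the one generated by the complement
    \<open>Y\<close>.\<close>
  have full: "X = mcar Q" if X: "graded_submodule S Q X"
    and c: "\<And>q. q \<in> mcar Q \<Longrightarrow> \<exists>x\<in>X. q - x \<in> ?K" for X
  proof -
    have XQ: "submodule S Q X" using X by (simp add: graded_submodule_def)
    have "{k + x |k x. k \<in> ?K \<and> x \<in> X} = mcar Q"
    proof
      show "{k + x |k x. k \<in> ?K \<and> x \<in> X} \<subseteq> mcar Q"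
        by (rule submoduleD(1)[OF submodule_plus[OF QL K XQ]])
      show "mcar Q \<subseteq> {k + x |k x. k \<in> ?K \<and> x \<in> X}"
      proof
        fix q assume "q \<in> mcar Q"
        then obtain x where "x \<in> X" "q - x \<in> ?K" using c by blast
        then show "q \<in> {k + x |k x. k \<in> ?K \<and> x \<in> X}"
          by (intro CollectI exI[of _ "q - x"] exI[of _ x]) simp
      qed
    qed
    then show ?thesis using small X unfolding superfluous_def by blast
  qed
  show gen: "gen_map Q n ` mcar (gen_source Q n) = mcar Q"
  proof (rule full[OF gen_map_submodule[OF Q]])
    fix q assume q: "q \<in> mcar Q"
    obtain x where x: "x \<in> gen_map Q n ` mcar (gen_source Q n)" "f q = f x" using cover[OF q] by blast
    have xQ: "x \<in> mcar Q" using gen_map_submodule[OF Q] x(1) submoduleD(1) unfolding graded_submodule_def by blast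
    have "q - x \<in> ?K"
      using additive_on_diff[OF fh(4) mod_subgroup[OF QL] q xQ] x(2) left_module.mcar_diff[OF QL q xQ]
      by (simp add: mod_ker_def)
    then show "\<exists>x\<in>gen_map Q n ` mcar (gen_source Q n). q - x \<in> ?K" using x(1) by blast
  qed
  have U: "left_module univ_ring ?U" by (rule hmod_part[OF Q])
  have Un: "add_subgroup (mpart Q n)" by (rule direct_decompositionD(2)[OF graded_moduleD(2)[OF Q]])
  let ?U' = "mpart Q n \<inter> ?K"
  have U': "submodule univ_ring ?U ?U'"
    unfolding submodule_def
    using add_subgroup_Int[OF Un submoduleD(2)[OF K]] eta_act_part[OF Q] submoduleD(3)[OF K eta_carrier] by simp
  obtain Y where Y: "submodule univ_ring ?U Y" "complementary ?U ?U' Y"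
    using socle_ring.submodule_complement[OF R U U'] by blast
  have Yn: "Y \<subseteq> mpart Q n" using submoduleD(1)[OF Y(1)] by simp
  let ?Y = "HM Q Y"
  have Ym: "left_module univ_ring ?Y"
    by (rule hmod_module[OF QL submoduleD(2)[OF Y(1)]]) (use Yn Qn submoduleD(3)[OF Y(1)] in auto)
  have inc: "lmod_hom univ_ring ?Y (HM Q (mpart Q n)) (\<lambda>u. u)"
    using Yn by (auto simp: lmod_hom_def)
  note G = induced_graded[OF Q Ym inc]
  let ?G = "induced_map H A Q ?Y (\<lambda>u. u)"
  note Pg = graded_module_shift[OF proj_module_graded[OF Ym], of "- n"]
  have X: "graded_submodule S Q (?G ` mcar (PM ?Y))"
    using graded_submodule_image[OF Pg Q G(2)] by simp
  then have Xs: "submodule S Q (?G ` mcar (PM ?Y))" by (simp add: graded_submodule_def)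
  have G1: "?G (tpure AS (BS ?Y) 1 y) = y" if "y \<in> Y" for y
    using induced_pure_one[OF QL Ym G(1)] that by simp
  have YX: "y \<in> ?G ` mcar (PM ?Y)" if "y \<in> Y" for y
    by (rule image_eqI[where x = "tpure AS (BS ?Y) 1 y"]) (simp_all add: G1 tspan_pure that)
  have "?G ` mcar (PM ?Y) = mcar Q"
  proof (rule full[OF X])
    fix q assume q: "q \<in> mcar Q"
    let ?Z = "{k + x |k x. k \<in> ?K \<and> x \<in> ?G ` mcar (PM ?Y)}"
    have Z: "submodule S Q ?Z" by (rule submodule_plus[OF QL K Xs])
    have "mpart Q n \<subseteq> ?Z"
    proof
      fix u assume "u \<in> mpart Q n"
      then have "u \<in> {x + y |x y. x \<in> ?U' \<and> y \<in> Y}" using Y(2) by (simp add: complementary_def)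
      then obtain x y where "x \<in> ?U'" "y \<in> Y" "u = x + y" by blast
      then show "u \<in> ?Z" using YX by (intro CollectI exI[of _ x] exI[of _ y]) simp
    qed
    from gen_map_subset[OF Q Z this] have "mcar Q \<subseteq> ?Z" unfolding gen .
    then obtain k x where "k \<in> ?K" "x \<in> ?G ` mcar (PM ?Y)" "q = k + x" using q by blast
    then show "\<exists>x\<in>?G ` mcar (PM ?Y). q - x \<in> ?K" by (intro bexI[of _ x]) simp_all
  qed
  then have onto: "mcar Q \<subseteq> ?G ` mcar (PM ?Y)" by simp
  \<comment> \<open>An element of degree \<open>n\<close> has a preimage in degree \<open>n\<close>
    of the shifted \<open>A \<otimes> Y\<close>. That degree consists of the tensors
    \<open>1 \<otimes> y\<close>, and these are sent to \<open>y\<close>.\<close>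
  have nY: "mpart Q n \<subseteq> Y"
  proof
    fix u assume u: "u \<in> mpart Q n"
    obtain t where t: "t \<in> mcar (PM ?Y)" "u = ?G t" using onto Qn[OF u] by blast
    let ?P = "shift (PM ?Y) (- n)"
    have tP: "t \<in> mcar ?P" using t(1) by simp
    have "u = component (mpart Q) u n"
      using component_homogeneous[OF graded_moduleD(2)[OF Q] u, of n] by simp
    also have "\<dots> = ?G (component (mpart ?P) t n)"
      unfolding t(2) by (rule graded_hom_component[OF Pg Q G(2) tP])
    finally have u': "u = ?G (component (mpart ?P) t n)" .
    have "component (mpart ?P) t n \<in> mpart ?P n"
      by (rule component_props(2)[OF graded_moduleD(2)[OF Pg] tP])
    then have "component (mpart ?P) t n \<in> tspan AS (BS ?Y) (apart A 0) (mcar ?Y)" by simp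
    from pure_one_surj[OF Ym this] obtain y where "y \<in> Y" "component (mpart ?P) t n = tpure AS (BS ?Y) 1 y"
      by auto
    then show "u \<in> Y" using u' G1 by simp
  qed
  show "inj_on f (mpart Q n)"
  proof (rule inj_on_additive[OF additive_on_subset[OF fh(4)] Un])
    show "mpart Q n \<subseteq> mcar Q" using Qn by blast
    fix u assume u: "u \<in> mpart Q n" "f u = 0"
    then have "u \<in> ?U' \<inter> Y" using Qn[OF u(1)] nY by (auto simp: mod_ker_def)
    moreover have "?U' \<inter> Y = {0}" using Y(2) unfolding complementary_def by (rule conjunct1)
    ultimately show "u = 0" by (simp only: singleton_iff)
  qed
qed

text \<open>The isomorphism passes through degree one of \<open>Q 0\<close>: the first half comes
  from identifying \<open>Q 0\<close> with \<open>A \<otimes> V\<close>, the second is the inverse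
  of \<open>d 0\<close> in degree one.\<close>

lemma degree_one_iso:
  fixes V :: "('h, 'v::ab_group_add) lmod" and Q :: "nat \<Rightarrow> (('k, 'a, 'h) tensor, 'q::ab_group_add) glmod"
  assumes R: "socle_ring TYPE('h)" and gen: "fin_gen_degree_one A" and V: "left_module univ_ring V"
    and res: "minimal_graded_resolution S (inflated_module H A V) Q d e"
  shows "gen_map (Q 1) 1 ` mcar (gen_source (Q 1) 1) = mcar (Q 1)"
    and "lmod_iso univ_ring (degree_one_tensor V) (HM (Q 1) (mpart (Q 1) 1))"
proof -
  let ?M = "inflated_module H A V"
  have Mg: "graded_module S ?M" and Q0p: "graded_projective S (Q 0)" and Q1p: "graded_projective S (Q 1)"
    and e: "graded_hom S (Q 0) ?M e" and d: "graded_hom S (Q 1) (Q 0) (d 0)"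
    and e_onto: "e ` mcar (Q 0) = mcar ?M" and exact: "d 0 ` mcar (Q 1) = mod_ker (Q 0) e"
    and small0: "superfluous S (Q 0) (mod_ker (Q 0) e)"
    using res by (simp_all add: minimal_graded_resolution_def One_nat_def)
  have small1: "superfluous S (Q 1) (mod_ker (Q 1) (d 0))"
    using res unfolding minimal_graded_resolution_def One_nat_def by blast
  have Q0: "graded_module S (Q 0)" and Q1: "graded_module S (Q 1)"
    using Q0p Q1p by (simp_all add: graded_projective_def)
  note Q0L = graded_moduleD(1)[OF Q0] and Q1L = graded_moduleD(1)[OF Q1]
  note Q0d = graded_moduleD(2)[OF Q0] and Q1d = graded_moduleD(2)[OF Q1] and Md = graded_moduleD(2)[OF Mg]
  have M: "mcar ?M = mcar V" "act ?M z = act V (smash_proj H A z)" "mpart ?M i = (if i = 0 then mcar V else {0})" for z i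
    by (simp_all add: inflated_module_def)
  note eh = lmod_homD[OF graded_homD(1)[OF e]] and dh = lmod_homD[OF graded_homD(1)[OF d]]
  \<comment> \<open>The inflated module lives in degree 0, so \<open>e\<close> sees the degree 0
    component alone. Hence degree 0 of \<open>Q 0\<close> covers the target, and
    \<open>minimal_degree_part\<close> applies with \<open>n = 0\<close>.\<close>
  have e0: "e (component (mpart (Q 0)) q 0) = e q" if q: "q \<in> mcar (Q 0)" for q
  proof -
    have "e q \<in> mpart ?M 0" using eh(1)[OF q] by (simp add: M)
    then show ?thesis
      using graded_hom_component[OF Q0 Mg e q, of 0] component_homogeneous[OF Md, of "e q" 0 0] by simp
  qed
  have c0: "component (mpart (Q 0)) q 0 \<in> mpart (Q 0) 0" if "q \<in> mcar (Q 0)" for q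
    by (rule component_props(2)[OF Q0d that])
  have "\<exists>x\<in>gen_map (Q 0) 0 ` mcar (gen_source (Q 0) 0). e q = e x" if q: "q \<in> mcar (Q 0)" for q
    using e0[OF q] gen_map_contains[OF Q0 c0[OF q]] by (intro bexI[of _ "component (mpart (Q 0)) q 0"]) simp_all
  note min0 = minimal_degree_part[OF R Q0 Mg e small0 this]
  let ?U0 = "HM (Q 0) (mpart (Q 0) 0)"
  have U0: "left_module univ_ring ?U0" by (rule hmod_part[OF Q0])
  have eU0: "lmod_hom univ_ring ?U0 V e"
    using eh(1-3) graded_moduleD(4)[OF Q0] eta_carrier
    by (intro lmod_homI) (simp_all add: M smash_proj_eta)
  have bij_e: "bij_betw e (mcar ?U0) (mcar V)"
    unfolding bij_betw_def
  proof
    show "inj_on e (mcar ?U0)" using min0(2) by simp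
    show "e ` mcar ?U0 = mcar V"
    proof
      show "e ` mcar ?U0 \<subseteq> mcar V" using lmod_homD(1)[OF eU0] by blast
      show "mcar V \<subseteq> e ` mcar ?U0"
      proof
        fix v assume "v \<in> mcar V"
        then obtain q where q: "q \<in> mcar (Q 0)" "v = e q" using e_onto by (auto simp: M)
        have "v = e (component (mpart (Q 0)) q 0)" using e0[OF q(1)] q(2) by simp
        then show "v \<in> e ` mcar ?U0" using c0[OF q(1)] by auto
      qed
    qed
  qed
  let ?\<theta> = "the_inv_into (mcar ?U0) e"
  have \<theta>: "lmod_hom univ_ring V ?U0 ?\<theta>" "bij_betw ?\<theta> (mcar V) (mpart (Q 0) 0)"
    using lmod_hom_inv[OF mod_subgroup[OF U0] mod_closed[OF U0] eU0 bij_e] bij_betw_the_inv_into[OF bij_e] by simp_all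
  let ?G = "induced_map H A (Q 0) V ?\<theta>"
  obtain l where l: "graded_hom S (Q 0) (shift (PM V) (- 0)) l"
    "\<And>t. t \<in> mcar (PM V) \<Longrightarrow> l (?G t) = t" "\<And>q. q \<in> mcar (Q 0) \<Longrightarrow> ?G (l q) = q"
    using graded_projective_iso[OF Q0p V \<theta> min0(1)] by blast
  note G = induced_graded[OF Q0 V \<theta>(1)]
  have Gh: "lmod_hom S (PM V) (Q 0) ?G" by (rule induced_hom[OF Q0L V G(1)])
  have iso0: "lmod_iso univ_ring (degree_one_tensor V) (HM (Q 0) (mpart (Q 0) 1))"
    unfolding lmod_iso_def
  proof (intro exI[of _ ?G] conjI)
    have part: "mcar (degree_one_tensor V) = mpart (PM V) 1" by (simp add: degree_one_tensor_def)
    have G_part: "?G t \<in> mpart (Q 0) 1" if "t \<in> mpart (PM V) 1" for t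
      using graded_homD(2)[OF G(2), of t 1] that by (simp del: proj_module_simps)
    have l_part: "l q \<in> mpart (PM V) 1" if "q \<in> mpart (Q 0) 1" for q
      using graded_homD(2)[OF l(1) that] by (simp del: proj_module_simps)
    note PMmem = graded_moduleD(4)[OF proj_module_graded[OF V]]
    show "lmod_hom univ_ring (degree_one_tensor V) (HM (Q 0) (mpart (Q 0) 1)) ?G"
      using lmod_homD(2)[OF Gh PMmem PMmem] lmod_homD(3)[OF Gh eta_carrier PMmem] G_part
      by (intro lmod_homI) (simp_all add: degree_one_tensor_def del: proj_module_simps degree_one_tensor_simps)
    have "bij_betw ?G (mpart (PM V) 1) (mpart (Q 0) 1)"
      by (rule bij_betw_byWitness[of _ l])
        (use l(2)[OF PMmem] l(3)[OF graded_moduleD(4)[OF Q0]] G_part l_part in \<open>blast+\<close>)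
    then show "bij_betw ?G (mcar (degree_one_tensor V)) (mcar (HM (Q 0) (mpart (Q 0) 1)))"
      unfolding part by simp
  qed
  let ?X1 = "gen_map (Q 1) 1 ` mcar (gen_source (Q 1) 1)" and ?K = "mod_ker (Q 0) e"
  have X1: "submodule S (Q 1) ?X1" using gen_map_submodule[OF Q1] by (simp add: graded_submodule_def)
  \<comment> \<open>The aim is that \<open>?Z\<close> is the whole kernel of \<open>e\<close>. Then
    degree one of \<open>Q 1\<close> generates \<open>Q 1\<close> up to the kernel of
    \<open>d 0\<close>, and minimality applies again.\<close>
  let ?Z = "d 0 ` ?X1"
  have Z: "submodule S (Q 0) ?Z" by (rule submodule_image[OF Q1L graded_homD(1)[OF d] X1])
  note ZS = submoduleD(2)[OF Z]
  have ZK: "?Z \<subseteq> ?K" using exact submoduleD(1)[OF X1] by blast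
  note c1 = component_props(2)[OF Q1d, of _ 1]
  \<comment> \<open>\<open>e\<close> kills degree one of \<open>Q 0\<close>, as its target has
    nothing there. A preimage under \<open>d 0\<close> can be replaced by its degree one
    component.\<close>
  have lift: "\<exists>q\<in>mpart (Q 1) 1. z = d 0 q" if z: "z \<in> mpart (Q 0) 1" for z
  proof -
    have "e z = 0" using graded_homD(2)[OF e z] by (simp add: M)
    then have "z \<in> ?K" using graded_moduleD(4)[OF Q0 z] by (simp add: mod_ker_def)
    then obtain q where q: "q \<in> mcar (Q 1)" "z = d 0 q" using exact by blast
    have "z = d 0 (component (mpart (Q 1)) q 1)"
      using graded_hom_component[OF Q1 Q0 d q(1), of 1] component_homogeneous[OF Q0d z, of 1] q(2) by simp
    then show ?thesis using c1[OF q(1)] by blast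
  qed
  have part1_Z: "z \<in> ?Z" if z: "z \<in> mpart (Q 0) 1" for z
  proof -
    obtain q where "q \<in> mpart (Q 1) 1" "z = d 0 q" using lift[OF z] by blast
    then show ?thesis using gen_map_contains[OF Q1] by simp
  qed
  have U0m: "u \<in> mcar (Q 0)" if "u \<in> mpart (Q 0) 0" for u by (rule graded_moduleD(4)[OF Q0 that])
  note U0S = direct_decompositionD(2)[OF Q0d, of 0]
  \<comment> \<open>The elements mapping \<open>Q\<^sub>0\<close> in degree 0 into its sum with \<open>Z\<close> form a subalgebra containing \<open>A\<^sub>1\<close>.\<close>
  let ?B = "{a. \<forall>u\<in>mpart (Q 0) 0. \<exists>u'\<in>mpart (Q 0) 0. act (Q 0) (alpha a) u - u' \<in> ?Z}"
  have "?B = UNIV"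
  proof (rule generated_UNIV[OF gen])
    have alpha0: "act (Q 0) (alpha 0) u = 0" if "u \<in> mpart (Q 0) 0" for u
    proof -
      have "alpha 0 = 0" using alpha_add[of 0 0] by simp
      then show ?thesis
        using additive_on_zero[OF smash_act_additive[OF Q0L U0m[OF that]] smash_subgroup] by simp
    qed
    show "ga.subspace ?B"
    proof (rule ga.subspaceI)
      show "0 \<in> ?B"
        using alpha0 add_subgroup_zero[OF U0S] add_subgroup_zero[OF ZS]
        by (intro CollectI ballI bexI[of _ 0]) simp_all
    next
      fix a b assume a: "a \<in> ?B" and b: "b \<in> ?B"
      show "a + b \<in> ?B"
      proof (intro CollectI ballI)
        fix u assume u: "u \<in> mpart (Q 0) 0"
        obtain u1 where u1: "u1 \<in> mpart (Q 0) 0" "act (Q 0) (alpha a) u - u1 \<in> ?Z" using a u by blast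
        obtain u2 where u2: "u2 \<in> mpart (Q 0) 0" "act (Q 0) (alpha b) u - u2 \<in> ?Z" using b u by blast
        have eq: "act (Q 0) (alpha (a + b)) u - (u1 + u2) =
            (act (Q 0) (alpha a) u - u1) + (act (Q 0) (alpha b) u - u2)"
          using mod_add_left[OF Q0L alpha_carrier[of a] alpha_carrier[of b] U0m[OF u]] by (simp add: alpha_add)
        have "act (Q 0) (alpha (a + b)) u - (u1 + u2) \<in> ?Z"
          unfolding eq by (rule add_subgroup_add[OF ZS u1(2) u2(2)])
        then show "\<exists>u'\<in>mpart (Q 0) 0. act (Q 0) (alpha (a + b)) u - u' \<in> ?Z"
          using add_subgroup_add[OF U0S u1(1) u2(1)] by (rule bexI)
      qed
    next
      fix c a assume a: "a \<in> ?B"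
      show "ascale A c a \<in> ?B"
      proof (intro CollectI ballI)
        fix u assume u: "u \<in> mpart (Q 0) 0"
        obtain u1 where u1: "u1 \<in> mpart (Q 0) 0" "act (Q 0) (alpha a) u - u1 \<in> ?Z" using a u by blast
        let ?c = "eta (hscale H c 1)"
        have au: "act (Q 0) (alpha a) u \<in> mcar (Q 0)" by (rule mod_closed[OF Q0L alpha_carrier U0m[OF u]])
        have "act (Q 0) (alpha (ascale A c a)) u - act (Q 0) ?c u1 = act (Q 0) ?c (act (Q 0) (alpha a) u - u1)"
          using mod_mult[OF Q0L eta_carrier alpha_carrier U0m[OF u]]
            left_module.act_diff_right[OF Q0L eta_carrier au U0m[OF u1(1)]] by (simp add: alpha_scale(2))
        then have "act (Q 0) (alpha (ascale A c a)) u - act (Q 0) ?c u1 \<in> ?Z"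
          using submoduleD(3)[OF Z eta_carrier u1(2)] by simp
        then show "\<exists>u'\<in>mpart (Q 0) 0. act (Q 0) (alpha (ascale A c a)) u - u' \<in> ?Z"
          using eta_act_part[OF Q0 u1(1)] by (rule bexI)
      qed
    qed
    show "1 \<in> ?B"
    proof (intro CollectI ballI)
      fix u assume u: "u \<in> mpart (Q 0) 0"
      have "act (Q 0) (alpha 1) u - u = 0" unfolding alpha_one using mod_one[OF Q0L U0m[OF u]] by simp
      then have "act (Q 0) (alpha 1) u - u \<in> ?Z" using add_subgroup_zero[OF ZS] by (simp only:)
      then show "\<exists>u'\<in>mpart (Q 0) 0. act (Q 0) (alpha 1) u - u' \<in> ?Z" using u by (rule bexI)
    qed
    show "a * b \<in> ?B" if a: "a \<in> ?B" and b: "b \<in> ?B" for a b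
    proof (intro CollectI ballI)
      fix u assume u: "u \<in> mpart (Q 0) 0"
      obtain u1 where u1: "u1 \<in> mpart (Q 0) 0" "act (Q 0) (alpha b) u - u1 \<in> ?Z" using b u by blast
      obtain u2 where u2: "u2 \<in> mpart (Q 0) 0" "act (Q 0) (alpha a) u1 - u2 \<in> ?Z" using a u1(1) by blast
      have bu: "act (Q 0) (alpha b) u \<in> mcar (Q 0)" by (rule mod_closed[OF Q0L alpha_carrier U0m[OF u]])
      have eq: "act (Q 0) (alpha (a * b)) u - u2 =
          act (Q 0) (alpha a) (act (Q 0) (alpha b) u - u1) + (act (Q 0) (alpha a) u1 - u2)"
        using mod_mult[OF Q0L alpha_carrier[of a] alpha_carrier[of b] U0m[OF u]]
          left_module.act_diff_right[OF Q0L alpha_carrier bu U0m[OF u1(1)]] by (simp add: alpha_mult)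
      have "act (Q 0) (alpha (a * b)) u - u2 \<in> ?Z"
        unfolding eq by (rule add_subgroup_add[OF ZS submoduleD(3)[OF Z alpha_carrier u1(2)] u2(2)])
      then show "\<exists>u'\<in>mpart (Q 0) 0. act (Q 0) (alpha (a * b)) u - u' \<in> ?Z" using u2(1) by (rule bexI)
    qed
    show "apart A 1 \<subseteq> ?B"
    proof (intro subsetI CollectI ballI)
      fix a u assume a: "a \<in> apart A 1" and u: "u \<in> mpart (Q 0) 0"
      have "act (Q 0) (alpha a) u \<in> mpart (Q 0) 1"
        using graded_moduleD(3)[OF Q0 alpha_part[OF a] u] by simp
      then show "\<exists>u'\<in>mpart (Q 0) 0. act (Q 0) (alpha a) u - u' \<in> ?Z"
        using part1_Z add_subgroup_zero[OF U0S] by (intro bexI[of _ 0]) simp_all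
    qed
  qed
  then have B: "\<exists>u'\<in>mpart (Q 0) 0. act (Q 0) (alpha a) u - u' \<in> ?Z" if "u \<in> mpart (Q 0) 0" for a u
    using that by blast
  \<comment> \<open>Every element of \<open>Q 0\<close> agrees modulo \<open>?Z\<close> with some
    \<open>u\<close> of degree 0. For an element of the kernel also \<open>e u = 0\<close>, and
    \<open>e\<close> is injective in degree 0, so \<open>u = 0\<close>.\<close>
  have KZ: "?K \<subseteq> ?Z"
  proof
    fix z assume z: "z \<in> ?K"
    have gm: "\<exists>u\<in>mpart (Q 0) 0. gen_map (Q 0) 0 t - u \<in> ?Z" if "t \<in> tspan AS (BS ?U0) UNIV (mcar ?U0)" for t
      using that
    proof (induction rule: tspan_induct)
      case zero
      have "gen_map (Q 0) 0 0 = 0"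
        by (rule additive_on_zero[OF lmod_homD(4)[OF gen_map_hom[OF Q0]] mod_subgroup[OF proj_module_left[OF U0]]])
      then show ?case
        using add_subgroup_zero[OF U0S] add_subgroup_zero[OF ZS] by (intro bexI[of _ 0]) simp_all
    next
      case (add a w t)
      have w: "w \<in> mpart (Q 0) 0" using add(2) by simp
      obtain u1 where u1: "u1 \<in> mpart (Q 0) 0" "act (Q 0) (alpha a) w - u1 \<in> ?Z" using B[OF w] by blast
      obtain u2 where u2: "u2 \<in> mpart (Q 0) 0" "gen_map (Q 0) 0 t - u2 \<in> ?Z" using add(4) by blast
      have "gen_map (Q 0) 0 (tpure AS (BS ?U0) a w) = act (Q 0) (alpha a) w"
        unfolding gen_map_def by (rule induced_pure[OF Q0L U0 gen_map_graded(1)[OF Q0] add(2)])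
      moreover have "gen_map (Q 0) 0 (tpure AS (BS ?U0) a w + t) =
          gen_map (Q 0) 0 (tpure AS (BS ?U0) a w) + gen_map (Q 0) 0 t"
        by (rule lmod_homD(2)[OF gen_map_hom[OF Q0]]) (use add in \<open>simp_all add: tspan_pure\<close>)
      ultimately have eq: "gen_map (Q 0) 0 (tpure AS (BS ?U0) a w + t) - (u1 + u2) =
          (act (Q 0) (alpha a) w - u1) + (gen_map (Q 0) 0 t - u2)" by simp
      have "gen_map (Q 0) 0 (tpure AS (BS ?U0) a w + t) - (u1 + u2) \<in> ?Z"
        unfolding eq by (rule add_subgroup_add[OF ZS u1(2) u2(2)])
      then show ?case using add_subgroup_add[OF U0S u1(1) u2(1)] by (rule bexI)
    qed
    have zQ: "z \<in> mcar (Q 0)" "e z = 0" using z by (simp_all add: mod_ker_def)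
    then have "z \<in> gen_map (Q 0) 0 ` mcar (gen_source (Q 0) 0)" using min0(1) by simp
    then obtain t where t: "t \<in> mcar (gen_source (Q 0) 0)" "z = gen_map (Q 0) 0 t" by (rule imageE)
    obtain u where u: "u \<in> mpart (Q 0) 0" "z - u \<in> ?Z"
      using gm[OF t(1)[unfolded proj_module_simps(1)]] unfolding t(2) by (rule bexE)
    have "e (z - u) = 0" using u(2) ZK by (auto simp: mod_ker_def)
    then have "e u = 0"
      using additive_on_diff[OF eh(4) mod_subgroup[OF Q0L] zQ(1) U0m[OF u(1)]] zQ(2) by simp
    moreover have "e 0 = 0" by (rule additive_on_zero[OF eh(4) mod_subgroup[OF Q0L]])
    ultimately have "u = 0" using inj_onD[OF min0(2) _ u(1) add_subgroup_zero[OF U0S]] by simp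
    then show "z \<in> ?Z" using u(2) by simp
  qed
  have "\<exists>x\<in>?X1. d 0 q = d 0 x" if q: "q \<in> mcar (Q 1)" for q
    using q KZ exact by blast
  note min1 = minimal_degree_part[OF R Q1 Q0 d small1 this]
  show "?X1 = mcar (Q 1)" by (rule min1(1))
  let ?U1 = "HM (Q 1) (mpart (Q 1) 1)"
  have U1: "left_module univ_ring ?U1" by (rule hmod_part[OF Q1])
  have "lmod_hom univ_ring ?U1 (HM (Q 0) (mpart (Q 0) 1)) (d 0)"
    using dh(2,3) graded_homD(2)[OF d] graded_moduleD(4)[OF Q1] eta_carrier by (intro lmod_homI) simp_all
  moreover have "bij_betw (d 0) (mpart (Q 1) 1) (mpart (Q 0) 1)"
    unfolding bij_betw_def using min1(2) lift graded_homD(2)[OF d] by blast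
  ultimately have "lmod_iso univ_ring ?U1 (HM (Q 0) (mpart (Q 0) 1))"
    unfolding lmod_iso_def by auto
  from lmod_iso_sym[OF mod_subgroup[OF U1] mod_closed[OF U1] this]
  show "lmod_iso univ_ring (degree_one_tensor V) ?U1" by (rule lmod_iso_trans[OF iso0])
qed

end


section \<open>Multiplicities\<close>

lemma gmod_power_eq: "gmod_power P m = dsum_gmod {..<m} P 0"
  by (simp add: gmod_power_def dsum_gmod_def Let_def Ball_def)

lemma restrict_gmod_simps [simp]:
  "mcar (restrict_gmod M X) = X" "act (restrict_gmod M X) = act M" "mpart (restrict_gmod M X) i = X \<inter> mpart M i"
  by (simp_all add: restrict_gmod_def)

text \<open>\<open>\<Phi>\<close> adds up the maps \<open>\<phi> t\<close> and \<open>\<Psi>\<close>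
  collects the maps \<open>\<rho> t\<close>. As \<open>\<Psi>\<close> is a left inverse of
  \<open>\<Phi>\<close>, the image of \<open>\<Phi>\<close> is a copy of the power with complement
  the kernel of \<open>\<Psi>\<close>.\<close>

lemma retraction_summand:
  fixes P :: "('r, 'p::ab_group_add) glmod" and Q :: "('r, 'q::ab_group_add) glmod"
  assumes P: "graded_module R P" and Q: "graded_module R Q"
    and \<phi>: "\<And>t. t < m \<Longrightarrow> graded_hom R P Q (\<phi> t)" and \<rho>: "\<And>t. t < m \<Longrightarrow> graded_hom R Q P (\<rho> t)"
    and inv: "\<And>t u x. t < m \<Longrightarrow> u < m \<Longrightarrow> x \<in> mcar P \<Longrightarrow> \<rho> t (\<phi> u x) = (if t = u then x else 0)"
  shows "\<exists>X Y. graded_submodule R Q X \<and> graded_submodule R Q Y \<and> complementary Q X Y \<and>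
    graded_iso R (gmod_power P m) (restrict_gmod Q X)"
proof -
  let ?D = "dsum_gmod {..<m} P 0"
  have D: "graded_module R ?D" by (rule dsum_gmod_graded[OF P])
  note PL = graded_moduleD(1)[OF P] and QL = graded_moduleD(1)[OF Q]
  note \<phi>h = lmod_homD[OF graded_homD(1)[OF \<phi>]] and \<rho>h = lmod_homD[OF graded_homD(1)[OF \<rho>]]
  have mem: "f \<in> mcar ?D \<longleftrightarrow> (\<forall>t<m. f t \<in> mcar P) \<and> (\<forall>t. \<not> t < m \<longrightarrow> f t = 0)" for f
    unfolding dsum_gmod_simps by (rule lmod_power_mem)
  have fP: "f t \<in> mcar P" if "f \<in> mcar ?D" "t < m" for f t using that unfolding mem by blast
  define \<Phi> where "\<Phi> f = (\<Sum>t<m. \<phi> t (f t))" for f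
  define \<Psi> where "\<Psi> q = (\<lambda>t. if t < m then \<rho> t q else 0)" for q
  have \<Phi>_graded: "graded_hom R ?D Q \<Phi>"
    unfolding graded_hom_def
  proof (intro conjI allI ballI lmod_homI)
    fix f assume f: "f \<in> mcar ?D"
    show "\<Phi> f \<in> mcar Q"
      unfolding \<Phi>_def by (rule add_subgroup_sum[OF mod_subgroup[OF QL]]) (use \<phi>h(1) fP[OF f] in auto)
    show "\<Phi> (f + g) = \<Phi> f + \<Phi> g" if g: "g \<in> mcar ?D" for g
      unfolding \<Phi>_def sum.distrib[symmetric]
      by (rule sum.cong) (use \<phi>h(2) fP[OF f] fP[OF g] in \<open>auto simp: plus_fun_apply\<close>)
    show "\<Phi> (act ?D r f) = act Q r (\<Phi> f)" if r: "r \<in> carrier R" for r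
    proof -
      have "act Q r (\<Phi> f) = (\<Sum>t<m. act Q r (\<phi> t (f t)))"
        unfolding \<Phi>_def
        by (rule additive_on_sum[OF left_module.act_additive[OF QL r] mod_subgroup[OF QL]])
          (use \<phi>h(1) fP[OF f] in auto)
      also have "\<dots> = \<Phi> (act ?D r f)"
        unfolding \<Phi>_def
        by (rule sum.cong) (use \<phi>h(3)[OF _ r] fP[OF f] in \<open>auto simp: lmod_dsum_simps\<close>)
      finally show ?thesis by simp
    qed
  next
    fix i f assume f: "f \<in> mpart ?D i"
    show "\<Phi> f \<in> mpart Q i"
      unfolding \<Phi>_def
      by (rule add_subgroup_sum[OF direct_decompositionD(2)[OF graded_moduleD(2)[OF Q]]])
        (use graded_homD(2)[OF \<phi>] f in auto)
  qed
  have \<Psi>_graded: "graded_hom R Q ?D \<Psi>"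
    unfolding graded_hom_def
  proof (intro conjI allI ballI lmod_homI)
    fix q assume q: "q \<in> mcar Q"
    show "\<Psi> q \<in> mcar ?D" unfolding mem \<Psi>_def using \<rho>h(1)[OF _ q] by simp
    show "\<Psi> (q + q') = \<Psi> q + \<Psi> q'" if "q' \<in> mcar Q" for q'
      using \<rho>h(2)[OF _ q that] by (simp add: \<Psi>_def fun_eq_iff plus_fun_apply)
    show "\<Psi> (act Q r q) = act ?D r (\<Psi> q)" if "r \<in> carrier R" for r
      using \<rho>h(3)[OF _ that q] by (simp add: \<Psi>_def fun_eq_iff lmod_dsum_simps)
  next
    fix i q assume q: "q \<in> mpart Q i"
    have "\<Psi> q \<in> mcar ?D"
      unfolding mem \<Psi>_def using \<rho>h(1)[OF _ graded_moduleD(4)[OF Q q]] by simp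
    then show "\<Psi> q \<in> mpart ?D i" using graded_homD(2)[OF \<rho> q] by (simp add: \<Psi>_def)
  qed
  have \<Psi>\<Phi>: "\<Psi> (\<Phi> f) = f" if f: "f \<in> mcar ?D" for f
  proof
    fix t
    show "\<Psi> (\<Phi> f) t = f t"
    proof (cases "t < m")
      case True
      have "\<rho> t (\<Phi> f) = (\<Sum>u<m. \<rho> t (\<phi> u (f u)))"
        unfolding \<Phi>_def
        by (rule additive_on_sum[OF \<rho>h(4)[OF True] mod_subgroup[OF QL]]) (use \<phi>h(1) fP[OF f] in auto)
      also have "\<dots> = (\<Sum>u<m. if t = u then f u else 0)"
        by (rule sum.cong) (use inv[OF True] fP[OF f] in auto)
      also have "\<dots> = f t" using True by simp
      finally show ?thesis using True by (simp add: \<Psi>_def)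
    next
      case False
      then show ?thesis using f unfolding mem by (simp add: \<Psi>_def)
    qed
  qed
  let ?X = "\<Phi> ` mcar ?D" and ?Y = "mod_ker Q \<Psi>"
  note \<Phi>h = lmod_homD[OF graded_homD(1)[OF \<Phi>_graded]] and \<Psi>h = lmod_homD[OF graded_homD(1)[OF \<Psi>_graded]]
  have X: "graded_submodule R Q ?X" by (rule graded_submodule_image[OF D Q \<Phi>_graded])
  have Y: "graded_submodule R Q ?Y" by (rule graded_submodule_ker[OF Q D \<Psi>_graded])
  have Xs: "submodule R Q ?X" and Ys: "submodule R Q ?Y" using X Y by (simp_all add: graded_submodule_def)
  have "complementary Q ?X ?Y"
    unfolding complementary_def
  proof
    have "x = 0" if "x \<in> ?X" "x \<in> ?Y" for x
    proof -
      obtain f where f: "f \<in> mcar ?D" "x = \<Phi> f" using \<open>x \<in> ?X\<close> by (rule imageE)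
      have "f = 0" using \<open>x \<in> ?Y\<close> \<Psi>\<Phi>[OF f(1)] f(2) by (simp add: mod_ker_def)
      then show ?thesis
        using f(2) additive_on_zero[OF \<Phi>h(4) mod_subgroup[OF graded_moduleD(1)[OF D]]] by simp
    qed
    then show "?X \<inter> ?Y = {0}"
      using add_subgroup_zero[OF submoduleD(2)[OF Xs]] add_subgroup_zero[OF submoduleD(2)[OF Ys]] by auto
    show "{x + y |x y. x \<in> ?X \<and> y \<in> ?Y} = mcar Q"
    proof
      show "{x + y |x y. x \<in> ?X \<and> y \<in> ?Y} \<subseteq> mcar Q"
        by (rule submoduleD(1)[OF submodule_plus[OF QL Xs Ys]])
      show "mcar Q \<subseteq> {x + y |x y. x \<in> ?X \<and> y \<in> ?Y}"
      proof
        fix q assume q: "q \<in> mcar Q"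
        have x: "\<Phi> (\<Psi> q) \<in> ?X" using \<Psi>h(1)[OF q] by (rule imageI)
        have xQ: "\<Phi> (\<Psi> q) \<in> mcar Q" by (rule \<Phi>h(1)[OF \<Psi>h(1)[OF q]])
        have "\<Psi> (q - \<Phi> (\<Psi> q)) = 0"
          using additive_on_diff[OF \<Psi>h(4) mod_subgroup[OF QL] q xQ] \<Psi>\<Phi>[OF \<Psi>h(1)[OF q]] by simp
        then have "q - \<Phi> (\<Psi> q) \<in> ?Y"
          using left_module.mcar_diff[OF QL q xQ] by (simp add: mod_ker_def)
        then show "q \<in> {x + y |x y. x \<in> ?X \<and> y \<in> ?Y}"
          using x by (intro CollectI exI[of _ "\<Phi> (\<Psi> q)"] exI[of _ "q - \<Phi> (\<Psi> q)"]) simp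
      qed
    qed
  qed
  moreover have "graded_iso R (gmod_power P m) (restrict_gmod Q ?X)"
    unfolding graded_iso_def gmod_power_eq
  proof (intro exI[of _ \<Phi>] conjI)
    have "\<Phi> f \<in> mpart Q i \<and> \<Phi> f \<in> ?X" if f: "f \<in> mpart ?D i" for f i
      using graded_homD(2)[OF \<Phi>_graded f] graded_moduleD(4)[OF D f] by blast
    then show "graded_hom R ?D (restrict_gmod Q ?X) \<Phi>"
      using \<Phi>h unfolding graded_hom_def lmod_hom_def by (auto simp del: dsum_gmod_simps)
    show "bij_betw \<Phi> (mcar ?D) (mcar (restrict_gmod Q ?X))"
      unfolding bij_betw_def using inj_on_inverseI[of "mcar ?D" \<Psi> \<Phi>] \<Psi>\<Phi> by simp
  qed
  ultimately show ?thesis using X Y by blast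
qed

context graded_hopf_action
begin

text \<open>The augmentation of \<open>A\<close>, tensored with \<open>V\<close>, provides a left
  inverse.\<close>

lemma pure_one_inj:
  assumes V: "left_module univ_ring V"
  shows "inj_on (tpure AS (BS V) 1) (mcar V)"
proof -
  note B = base_space_module[OF V]
  have b: "bilinear_map AS (BS V) (BS V) (\<lambda>a v. act (BS V) (augmentation A a) v)"
    using mod_closed[OF B] mod_add_left[OF B] mod_add_right[OF B]
      mod_mult[OF B, unfolded univ_ring_simps, OF UNIV_I UNIV_I, symmetric]
    by (intro bilinear_mapI) (simp_all add: augmentation_simps mult.commute del: base_space_simps)
  show ?thesis
  proof (rule inj_on_inverseI)
    fix v assume v: "v \<in> mcar V"
    then show "tensor_lift AS (BS V) (\<lambda>a v. act (BS V) (augmentation A a) v) (tpure AS (BS V) 1 v) = v"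
      using tensor_lift_pure[OF B b, of 1 v] mod_one[OF B, of v] by (simp add: augmentation_simps)
  qed
qed

lemma degree_zero_iso:
  assumes V: "left_module univ_ring V"
  shows "lmod_iso univ_ring V (HM (PM V) (mpart (PM V) 0))"
  unfolding lmod_iso_def
proof (intro exI conjI)
  show "lmod_hom univ_ring V (HM (PM V) (mpart (PM V) 0)) (tpure AS (BS V) 1)"
    by (rule pure_one_hom[OF V])
  have "tpure AS (BS V) 1 ` mcar V = tspan AS (BS V) (apart A 0) (mcar V)"
    using pure_one_surj[OF V] one_part by (auto intro: tspan_pure)
  then show "bij_betw (tpure AS (BS V) 1) (mcar V) (mcar (HM (PM V) (mpart (PM V) 0)))"
    unfolding bij_betw_def using pure_one_inj[OF V] by simp
qed

section \<open>Recovering multiplicities from the degree one part\<close>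

context
  fixes Q :: "(('k, 'a, 'h) tensor, 'q::ab_group_add) glmod"
    and V :: "nat \<Rightarrow> ('h, 'v::ab_group_add) lmod" and s i :: nat and n :: "nat \<Rightarrow> nat" and \<theta>
  assumes V: "\<And>i. i \<le> s \<Longrightarrow> simple_module univ_ring (V i)" and i: "i \<le> s"
    and Q: "graded_projective S Q" and gen: "gen_map Q 1 ` mcar (gen_source Q 1) = mcar Q"
    and \<theta>: "lmod_hom univ_ring (simple_sum s V n) (HM Q (mpart Q 1)) \<theta>"
      "bij_betw \<theta> (mcar (simple_sum s V n)) (mpart Q 1)"
begin

private lemma VL: "j \<le> s \<Longrightarrow> left_module univ_ring (V j)"
  using V by (simp add: simple_module_def)

private lemma Qg: "graded_module S Q"
  using Q by (simp add: graded_projective_def)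

private lemma DL: "left_module univ_ring (simple_sum s V n)"
  by (rule simple_sum_module) (rule VL)

text \<open>The inclusions and projections of the \<open>n i\<close> copies of \<open>V i\<close> in
  the simple sum induce maps between the shifted \<open>PM (V i)\<close> and \<open>Q\<close>. The
  retraction identities need to be checked on the tensors \<open>1 \<otimes> v\<close>
  alone.\<close>

lemma simple_summand_exists:
  "\<exists>X Y. graded_submodule S Q X \<and> graded_submodule S Q Y \<and> complementary Q X Y \<and>
    graded_iso S (gmod_power (shift (PM (V i)) (- 1)) (n i)) (restrict_gmod Q X)"
proof -
  let ?D = "simple_sum s V n" and ?P = "PM (V i)"
  note Vi = VL[OF i] and QL = graded_moduleD(1)[OF Qg]
  note Pg = proj_module_graded[OF Vi] and PL = proj_module_left[OF Vi]
  define \<iota> where "\<iota> t v = (\<lambda>p. if p = (i, t) then v else 0)" for t :: nat and v :: 'v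
  have \<iota>: "lmod_hom univ_ring (V i) ?D (\<iota> t)" if t: "t < n i" for t
  proof (rule lmod_homI)
    show "\<iota> t v \<in> mcar ?D" if "v \<in> mcar (V i)" for v
      using that t i VL left_module.mcar_zero[OF VL] unfolding simple_sum_mem by (simp add: \<iota>_def)
    show "\<iota> t (v + w) = \<iota> t v + \<iota> t w" for v w by (auto simp: \<iota>_def fun_eq_iff plus_fun_apply)
    have "act (V j) r 0 = 0" if "j \<le> s" for j r using left_module.act_zero_right[OF VL[OF that], of r] by simp
    then show "\<iota> t (act (V i) r v) = act ?D r (\<iota> t v)" for r v
      unfolding fun_eq_iff split_paired_All simple_sum_act using t i by (auto simp: \<iota>_def)
  qed
  have \<pi>: "lmod_hom univ_ring ?D (V i) (\<lambda>\<phi>. \<phi> (i, t))" if t: "t < n i" for t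
    by (rule lmod_homI) (use t i in \<open>simp_all only: simple_sum_mem simple_sum_act plus_fun_apply, simp_all\<close>)
  let ?G = "induced_map H A Q ?D \<theta>"
  obtain l where l: "graded_hom S Q (shift (PM ?D) (- 1)) l" "\<And>t. t \<in> mcar (PM ?D) \<Longrightarrow> l (?G t) = t"
    by (rule graded_projective_iso[OF Q DL \<theta> gen]) (rule that)
  note \<theta>' = induced_graded[OF Qg DL \<theta>(1)]
  define \<phi> where "\<phi> t = induced_map H A Q (V i) (\<lambda>v. \<theta> (\<iota> t v))" for t
  have \<theta>\<iota>: "lmod_hom univ_ring (V i) (HM Q (mpart Q 1)) (\<lambda>v. \<theta> (\<iota> t v))" if "t < n i" for t
    by (rule lmod_hom_comp[OF \<iota>[OF that] \<theta>(1)])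
  note \<phi>' = induced_graded[OF Qg Vi \<theta>\<iota>, folded \<phi>_def]
  have \<phi>1: "\<phi> t (tpure AS (BS (V i)) 1 v) = \<theta> (\<iota> t v)" if "t < n i" "v \<in> mcar (V i)" for t v
    unfolding \<phi>_def by (rule induced_pure_one[OF QL Vi \<phi>'(1)[OF that(1)] that(2)])
  define \<psi> where "\<psi> t = induced_map H A ?P ?D (\<lambda>\<chi>. tpure AS (BS (V i)) 1 (\<chi> (i, t)))" for t
  have \<pi>': "lmod_hom univ_ring ?D (HM ?P (mpart ?P 0)) (\<lambda>\<chi>. tpure AS (BS (V i)) 1 (\<chi> (i, t)))" if "t < n i" for t
    by (rule lmod_hom_comp[OF \<pi>[OF that] pure_one_hom[OF Vi]])
  note \<psi>' = induced_graded[OF Pg DL \<pi>', folded \<psi>_def]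
  have \<psi>g: "graded_hom S (shift (PM ?D) (- 1)) (shift ?P (- 1)) (\<psi> t)" if "t < n i" for t
    using graded_homD[OF \<psi>'(2)[OF that]] unfolding graded_hom_def lmod_hom_def
    by (simp del: proj_module_simps)
  define \<rho> where "\<rho> t q = \<psi> t (l q)" for t q
  have \<rho>: "graded_hom S Q (shift ?P (- 1)) (\<rho> t)" if "t < n i" for t
    unfolding \<rho>_def[abs_def] by (rule graded_hom_comp[OF l(1) \<psi>g[OF that]])
  have unshift: "lmod_hom S M ?P f" if "lmod_hom S M (shift ?P (- 1)) f"
    for M :: "(('k, 'a, 'h) tensor, 'q) glmod" and f
    using that by (simp add: lmod_hom_def del: proj_module_simps)
  have unshift': "lmod_hom S ?P Q f" if "lmod_hom S (shift ?P (- 1)) Q f" for f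
    using that by (simp add: lmod_hom_def del: proj_module_simps)
  have z: "tpure AS (BS (V i)) 1 0 = 0"
    by (rule additive_on_zero[OF lmod_homD(4)[OF pure_one_hom[OF Vi]] mod_subgroup[OF Vi]])
  have inv: "\<rho> t (\<phi> u x) = (if t = u then x else 0)" if t: "t < n i" and u: "u < n i" and x: "x \<in> mcar ?P" for t u x
  proof -
    have "lmod_hom S ?P ?P (\<lambda>x. \<rho> t (\<phi> u x))"
      by (rule lmod_hom_comp[OF unshift'[OF graded_homD(1)[OF \<phi>'(2)[OF u]]] unshift[OF graded_homD(1)[OF \<rho>[OF t]]]])
    moreover have "lmod_hom S ?P ?P (\<lambda>x. if t = u then x else 0)"
      using left_module.mcar_zero[OF PL] left_module.act_zero_right[OF PL]
      by (intro lmod_homI) (simp_all del: proj_module_simps)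
    ultimately show ?thesis
    proof (rule proj_hom_eqI[OF Vi _ _ _ x])
      fix v assume v: "v \<in> mcar (V i)"
      have d: "\<iota> u v \<in> mcar ?D" by (rule lmod_homD(1)[OF \<iota>[OF u] v])
      have dP: "tpure AS (BS ?D) 1 (\<iota> u v) \<in> mcar (PM ?D)"
        unfolding proj_module_simps(1) by (rule tspan_pure[OF UNIV_I d])
      have "\<rho> t (\<phi> u (tpure AS (BS (V i)) 1 v)) = \<psi> t (l (?G (tpure AS (BS ?D) 1 (\<iota> u v))))"
        unfolding \<rho>_def \<phi>1[OF u v] induced_pure_one[OF QL DL \<theta>'(1) d] ..
      also have "\<dots> = \<psi> t (tpure AS (BS ?D) 1 (\<iota> u v))" unfolding l(2)[OF dP] ..
      also have "\<dots> = tpure AS (BS (V i)) 1 (\<iota> u v (i, t))"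
        unfolding \<psi>_def by (rule induced_pure_one[OF PL DL \<psi>'(1)[OF t] d])
      also have "\<dots> = (if t = u then tpure AS (BS (V i)) 1 v else 0)" by (simp add: \<iota>_def z)
      finally show "\<rho> t (\<phi> u (tpure AS (BS (V i)) 1 v)) = (if t = u then tpure AS (BS (V i)) 1 v else 0)" .
    qed
  qed
  show ?thesis
    by (rule retraction_summand[where m = "n i" and \<phi> = \<phi> and \<rho> = \<rho>, OF graded_module_shift[OF Pg] Qg])
      (use \<phi>'(2) \<rho> inv in simp_all)
qed

text \<open>Degree one of a summand isomorphic to the \<open>m\<close>-th power contains the
  \<open>m\<close>-th power of \<open>V i\<close>, which therefore embeds in the simple sum. By
  Schur's lemma the embedding lands in the \<open>n i\<close> copies of \<open>V i\<close>, and
  \<open>power_embedding_le\<close> bounds \<open>m\<close>.\<close>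

lemma simple_summand_le:
  assumes noniso: "\<And>j. j \<le> s \<Longrightarrow> lmod_iso univ_ring (V i) (V j) \<Longrightarrow> i = j"
    and X: "graded_iso S (gmod_power (shift (PM (V i)) (- 1)) m) (restrict_gmod Q X)"
  shows "m \<le> n i"
proof -
  let ?D = "simple_sum s V n" and ?P = "shift (PM (V i)) (- 1)" and ?E = "lmod_dsum {..<m} (\<lambda>_. V i)"
  note Vi = VL[OF i]
  have EL: "left_module univ_ring ?E" by (rule lmod_dsum_left_module[OF Vi])
  obtain g where g: "graded_hom S (dsum_gmod {..<m} ?P 0) (restrict_gmod Q X) g"
    and g_bij: "bij_betw g (mcar (dsum_gmod {..<m} ?P 0)) X"
    using X unfolding graded_iso_def gmod_power_eq by auto
  let ?DP = "dsum_gmod {..<m} ?P 0"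
  note memE = lmod_power_mem
  \<comment> \<open>The degree one part of the power of the shifted module, written as tuples of
    tensors \<open>1 \<otimes> v\<close>.\<close>
  define p where "p v = (\<lambda>t. if t < m then tpure AS (BS (V i)) 1 (v t) else 0)" for v
  note ph = lmod_homD[OF pure_one_hom[OF Vi], simplified]
  have p1: "p v \<in> mpart ?DP 1" if v: "v \<in> mcar ?E" for v
  proof -
    have "finite {t. p v t \<noteq> 0}" by (rule finite_subset[of _ "{..<m}"]) (auto simp: p_def)
    moreover have "tpure AS (BS (V i)) 1 (v t) \<in> tspan AS (BS (V i)) (apart A 0) (mcar (V i))" if "t < m" for t
      using v that unfolding memE by (intro tspan_pure one_part) blast
    moreover have "tpure AS (BS (V i)) 1 (v t) \<in> tspan AS (BS (V i)) UNIV (mcar (V i))" if "t < m" for t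
      using v that unfolding memE by (intro tspan_pure UNIV_I) blast
    ultimately show ?thesis by (simp add: lmod_dsum_simps p_def)
  qed
  have pD: "p v \<in> mcar ?DP" if "v \<in> mcar ?E" for v using p1[OF that] by simp
  note gh = lmod_homD[OF graded_homD(1)[OF g]]
  have p_add: "p (v + w) = p v + p w" if "v \<in> mcar ?E" "w \<in> mcar ?E" for v w
  proof
    fix t
    show "p (v + w) t = (p v + p w) t"
      using that unfolding memE by (cases "t < m") (simp_all add: p_def plus_fun_apply tpure_add_right)
  qed
  have p_act: "p (act ?E h v) = act ?DP (eta h) (p v)" if "v \<in> mcar ?E" for h v
    using that eta_act_one[OF Vi] unfolding memE by (auto simp: p_def fun_eq_iff lmod_dsum_simps)
  let ?i = "the_inv_into (mcar ?D) \<theta>"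
  have i': "lmod_hom univ_ring (HM Q (mpart Q 1)) ?D ?i"
    by (rule lmod_hom_inv[OF mod_subgroup[OF DL] mod_closed[OF DL] \<theta>(1)]) (use \<theta>(2) in simp_all)
  define K where "K v = ?i (g (p v))" for v
  have gp: "g (p v) \<in> mpart Q 1" if "v \<in> mcar ?E" for v
    using graded_homD(2)[OF g p1[OF that]] by simp
  have "lmod_hom univ_ring ?E (HM Q (mpart Q 1)) (\<lambda>v. g (p v))"
  proof (rule lmod_homI)
    fix v assume v: "v \<in> mcar ?E"
    show "g (p v) \<in> mcar (HM Q (mpart Q 1))" using gp[OF v] by simp
    show "g (p (v + w)) = g (p v) + g (p w)" if "w \<in> mcar ?E" for w
      unfolding p_add[OF v that] by (rule gh(2)[OF pD[OF v] pD[OF that]])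
    show "g (p (act ?E h v)) = act (HM Q (mpart Q 1)) h (g (p v))" for h
      unfolding p_act[OF v] using gh(3)[OF eta_carrier pD[OF v]] by simp
  qed
  then have K: "lmod_hom univ_ring ?E ?D K"
    unfolding K_def[abs_def] by (rule lmod_hom_comp[OF _ i'])
  note Kh = lmod_homD[OF K]
  have K_inj: "inj_on K (mcar ?E)"
  proof (rule inj_onI)
    fix v w assume v: "v \<in> mcar ?E" and w: "w \<in> mcar ?E" and eq: "K v = K w"
    have "inj_on ?i (mpart Q 1)"
      using bij_betw_the_inv_into[OF \<theta>(2)] by (rule bij_betw_imp_inj_on)
    from inj_onD[OF this eq[unfolded K_def] gp[OF v] gp[OF w]] have "g (p v) = g (p w)" .
    from inj_onD[OF bij_betw_imp_inj_on[OF g_bij] this pD[OF v] pD[OF w]] have pvw: "p v = p w" .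
    show "v = w"
    proof
      fix t
      show "v t = w t"
      proof (cases "t < m")
        case True
        then have "tpure AS (BS (V i)) 1 (v t) = tpure AS (BS (V i)) 1 (w t)"
          using fun_cong[OF pvw, of t] by (simp add: p_def)
        then show ?thesis
          using inj_onD[OF pure_one_inj[OF Vi]] v w True unfolding memE by blast
      next
        case False
        then show ?thesis using v w unfolding memE by simp
      qed
    qed
  qed
  \<comment> \<open>Each copy of \<open>V i\<close> maps to 0 in a coordinate belonging to a
    different \<open>V a\<close> by Schur's lemma; a general \<open>v\<close> is a finite sum of
    vectors supported on one copy.\<close>
  have other: "K v (a, b) = 0" if v: "v \<in> mcar ?E" and a: "a \<le> s" "a \<noteq> i" "b < n a" for v a b
  proof -
    have delta: "(\<lambda>u. if u = t then x else 0) \<in> mcar ?E" if "t < m" "x \<in> mcar (V i)" for t x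
      by (rule delta_dsum[where R = univ_ring]) (use Vi that in simp_all)
    have dz: "K (\<lambda>u. if u = t then x else 0) (a, b) = 0" if t: "t < m" and x: "x \<in> mcar (V i)" for t x
    proof (rule ccontr)
      assume nz: "K (\<lambda>u. if u = t then x else 0) (a, b) \<noteq> 0"
      have "lmod_hom univ_ring (V i) (V a) (\<lambda>x. K (\<lambda>u. if u = t then x else 0) (a, b))"
      proof (rule lmod_homI)
        fix x assume x: "x \<in> mcar (V i)"
        show "K (\<lambda>u. if u = t then x else 0) (a, b) \<in> mcar (V a)"
          using Kh(1)[OF delta[OF t x]] a unfolding simple_sum_mem by blast
        show "K (\<lambda>u. if u = t then x + y else 0) (a, b) =
            K (\<lambda>u. if u = t then x else 0) (a, b) + K (\<lambda>u. if u = t then y else 0) (a, b)" if y: "y \<in> mcar (V i)" for y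
        proof -
          have "(\<lambda>u. if u = t then x + y else 0) = (\<lambda>u. if u = t then x else 0) + (\<lambda>u. if u = t then y else 0)"
            by (auto simp: fun_eq_iff plus_fun_apply)
          then show ?thesis using Kh(2)[OF delta[OF t x] delta[OF t y]] by (simp add: plus_fun_apply)
        qed
        show "K (\<lambda>u. if u = t then act (V i) r x else 0) (a, b) = act (V a) r (K (\<lambda>u. if u = t then x else 0) (a, b))" for r
        proof -
          have "act (V i) r 0 = 0" using left_module.act_zero_right[OF Vi, of r] by simp
          then have "(\<lambda>u. if u = t then act (V i) r x else 0) = act ?E r (\<lambda>u. if u = t then x else 0)"
            using t by (auto simp: fun_eq_iff lmod_dsum_simps)
          moreover have "act ?D r (K (\<lambda>u. if u = t then x else 0)) (a, b) = act (V a) r (K (\<lambda>u. if u = t then x else 0) (a, b))"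
            unfolding simple_sum_act using a by simp
          ultimately show ?thesis using Kh(3)[OF _ delta[OF t x], of r] by simp
        qed
      qed
      from simple_hom_zero_or_iso[OF V[OF i] V[OF a(1)] this x nz] show False
        using noniso[OF a(1)] a(2) by blast
    qed
    let ?J = "{u. v u \<noteq> 0}"
    have J: "finite ?J" using v by (simp add: lmod_dsum_simps)
    have Jm: "u < m" "v u \<in> mcar (V i)" if "u \<in> ?J" for u using v that unfolding memE by auto
    have "K v = (\<Sum>j\<in>?J. K (\<lambda>u. if u = j then v j else 0))"
      by (subst finite_support_decompose[OF J], rule additive_on_sum[OF Kh(4) mod_subgroup[OF EL]])
        (rule delta[OF Jm])
    then have "K v (a, b) = (\<Sum>j\<in>?J. K (\<lambda>u. if u = j then v j else 0) (a, b))" by (simp add: sum_fun_apply)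
    also have "\<dots> = 0" by (rule sum.neutral) (use dz Jm in blast)
    finally show ?thesis .
  qed
  let ?F = "lmod_dsum {..<n i} (\<lambda>_. V i)"
  \<comment> \<open>The discarded coordinates vanish on the image of \<open>K\<close>, so
    \<open>?L\<close> inherits the injectivity of \<open>K\<close>.\<close>
  let ?L = "\<lambda>v t. if t < n i then K v (i, t) else 0"
  have "lmod_hom univ_ring ?E ?F ?L"
  proof (rule lmod_homI)
    fix v assume v: "v \<in> mcar ?E"
    show "?L v \<in> mcar ?F"
    proof -
      have "K v (i, t) \<in> mcar (V i)" if "t < n i" for t
        using Kh(1)[OF v] that i unfolding simple_sum_mem by blast
      then show ?thesis unfolding lmod_power_mem by simp
    qed
    show "?L (v + w) = ?L v + ?L w" if "w \<in> mcar ?E" for w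
      unfolding Kh(2)[OF v that] by (simp add: fun_eq_iff plus_fun_apply)
    show "?L (act ?E r v) = act ?F r (?L v)" for r
    proof -
      have "K (act ?E r v) (i, t) = act (V i) r (K v (i, t))" if "t < n i" for t
        using Kh(3)[OF _ v, of r] i that by (simp only: simple_sum_act univ_ring_simps UNIV_I if_True simp_thms)
      then show ?thesis by (simp add: fun_eq_iff lmod_dsum_simps(2))
    qed
  qed
  moreover have "inj_on ?L (mcar ?E)"
  proof (rule inj_onI)
    fix v w assume v: "v \<in> mcar ?E" and w: "w \<in> mcar ?E" and eq: "?L v = ?L w"
    have "K v = K w"
    proof
      fix q :: "nat \<times> nat"
      obtain a b where q: "q = (a, b)" by (cases q)
      show "K v q = K w q"
      proof (cases "a \<le> s \<and> b < n a")
        case True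
        show ?thesis
        proof (cases "a = i")
          case True
          then show ?thesis using fun_cong[OF eq, of b] \<open>a \<le> s \<and> b < n a\<close> by (simp add: q)
        next
          case False
          then show ?thesis using other[OF v] other[OF w] True by (simp add: q)
        qed
      next
        case False
        then show ?thesis using Kh(1)[OF v] Kh(1)[OF w] unfolding simple_sum_mem q by metis
      qed
    qed
    then show "v = w" by (rule inj_onD[OF K_inj _ v w])
  qed
  ultimately show ?thesis by (rule power_embedding_le[OF V[OF i]])
qed

lemma summand_multiplicity_eq:
  assumes noniso: "\<And>j. j \<le> s \<Longrightarrow> lmod_iso univ_ring (V i) (V j) \<Longrightarrow> i = j"
  shows "summand_multiplicity S (shift (PM (V i)) (- 1)) Q = n i"
  unfolding summand_multiplicity_def
  by (rule Greatest_equality) (use simple_summand_exists simple_summand_le[OF noniso] in blast)+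

end

lemma multiplicities_agree:
  fixes V :: "nat \<Rightarrow> ('h, 'v::ab_group_add) lmod" and Q :: "nat \<Rightarrow> (('k, 'a, 'h) tensor, 'q::ab_group_add) glmod"
  assumes ss: "semisimple_hopf_algebra H" and gen: "fin_gen_degree_one A" and V: "complete_simples H s V"
    and i: "i \<le> s" and j: "j \<le> s"
    and res: "minimal_graded_resolution S (inflated_module H A (V j)) Q d e"
  shows "summand_multiplicity S (shift (PM (V i)) (- 1)) (Q 1) =
    decomposition_multiplicities s V (hopf_tensor H (degree_one_module A) (V j)) i"
proof -
  have reg: "semisimple_module univ_ring (regular_module :: ('h, 'h) lmod)"
    using ss by (simp add: semisimple_hopf_algebra_def)
  note R = semisimple_socle_ring[OF reg]
  have simple: "simple_module univ_ring (V i)" if "i \<le> s" for i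
    using V that by (simp add: complete_simples_def)
  have noniso: "i = j" if "i \<le> s" "j \<le> s" "lmod_iso univ_ring (V i) (V j)" for i j
    using V that by (simp add: complete_simples_def)
  have complete: "\<exists>i\<le>s. lmod_iso univ_ring M (V i)" if "simple_module univ_ring M" for M :: "('h, 'h) lmod"
    using V that by (simp add: complete_simples_def)
  have VL: "left_module univ_ring (V i)" if "i \<le> s" for i
    using simple[OF that] by (simp add: simple_module_def)
  note Vj = VL[OF j]
  let ?HT = "hopf_tensor H (degree_one_module A) (V j)" and ?N = "degree_one_tensor (V j)"
  have N: "left_module univ_ring ?N" by (rule degree_one_tensor_module[OF Vj])
  obtain B where B: "finite B" "B \<subseteq> mcar ?N"
    "\<forall>X. submodule univ_ring ?N X \<longrightarrow> B \<subseteq> X \<longrightarrow> X = mcar ?N"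
    using degree_one_tensor_generated[OF Vj gen reg simple[OF j]] by (elim exE conjE) (rule that)
  have SL: "left_module univ_ring (simple_sum s V n)" for n
    by (rule simple_sum_module[OF VL])
  \<comment> \<open>\<open>decomposition_multiplicities\<close> is a choice, so the existence of a
    decomposition comes first. The chosen multiplicities are then themselves the ones counted in
    \<open>Q 1\<close>.\<close>
  have "\<exists>n. lmod_iso univ_ring (simple_sum s V n) ?N"
    by (rule socle_ring.simple_sum_decomposition[OF R N VL complete B(1,2)]) (use B(3) in blast)+
  then obtain n0 where "lmod_iso univ_ring (simple_sum s V n0) ?N" by (rule exE)
  from lmod_iso_sym[OF mod_subgroup[OF SL] mod_closed[OF SL] this]
  have "lmod_iso univ_ring ?HT (simple_sum s V n0)" by (rule lmod_iso_trans[OF hopf_tensor_iso[OF Vj]])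
  then have "\<exists>n. lmod_iso univ_ring ?HT (simple_sum s V n)" by (intro exI)
  then have HT: "lmod_iso univ_ring ?HT (simple_sum s V (decomposition_multiplicities s V ?HT))"
    unfolding decomposition_multiplicities_def by (rule someI_ex)
  define n where "n = decomposition_multiplicities s V ?HT"
  have "lmod_iso univ_ring (simple_sum s V n) ?HT"
    unfolding n_def by (rule lmod_iso_sym[OF hopf_tensor_subgroup[OF Vj] hopf_tensor_closed[OF Vj] HT])
  from lmod_iso_trans[OF this hopf_tensor_iso[OF Vj]]
  have "lmod_iso univ_ring (simple_sum s V n) ?N" .
  from lmod_iso_trans[OF this degree_one_iso(2)[OF R gen Vj res]]
  obtain \<theta> where \<theta>: "lmod_hom univ_ring (simple_sum s V n) (HM (Q 1) (mpart (Q 1) 1)) \<theta>"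
    "bij_betw \<theta> (mcar (simple_sum s V n)) (mpart (Q 1) 1)"
    unfolding lmod_iso_def hmod_simps by (elim exE conjE) (rule that)
  have Q: "graded_projective S (Q 1)" using res by (simp add: minimal_graded_resolution_def)
  show ?thesis
    unfolding n_def[symmetric]
    by (rule summand_multiplicity_eq[OF simple i Q degree_one_iso(1)[OF R gen Vj res] \<theta> noniso[OF i]])
qed

text \<open>The degree 0 part recovers \<open>V i\<close> up to isomorphism. The vertices of the
  Gabriel quiver form an image set, so distinct indices have to give distinct modules.\<close>

lemma proj_module_inj:
  assumes V: "complete_simples H s V" and ij: "i \<le> s" "j \<le> s" and eq: "PM (V i) = PM (V j)"
  shows "i = j"
proof -
  have L: "left_module univ_ring (V i)" if "i \<le> s" for i
    using V that by (simp add: complete_simples_def simple_module_def)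
  have "lmod_iso univ_ring (V i) (HM (PM (V j)) (mpart (PM (V j)) 0))"
    using degree_zero_iso[OF L[OF ij(1)]] unfolding eq .
  moreover have "lmod_iso univ_ring (HM (PM (V j)) (mpart (PM (V j)) 0)) (V j)"
    by (rule lmod_iso_sym[OF mod_subgroup[OF L[OF ij(2)]] mod_closed[OF L[OF ij(2)]] degree_zero_iso[OF L[OF ij(2)]]])
  ultimately have "lmod_iso univ_ring (V i) (V j)" by (rule lmod_iso_trans)
  then show ?thesis using V ij by (simp add: complete_simples_def)
qed

end

text \<open>Arcs are index triples and stay as they are; only vertices are relabelled. Injectivity
  of \<open>X\<close> lets a vertex determine its index, and injectivity of \<open>Y\<close> makes
  the relabelling injective.\<close>

lemma quiver_iso:
  assumes m: "\<And>i j. i \<le> s \<Longrightarrow> j \<le> s \<Longrightarrow> m i j = m' i j" and X: "inj_on X {..s}" and Y: "inj_on Y {..s}"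
  shows "digraph_iso (quiver s X m) (quiver s Y m')"
proof -
  let ?G = "quiver s X m" and ?H = "quiver s Y m'"
  let ?f = "\<lparr>iso_verts = \<lambda>x. Y (the_inv_into {..s} X x), iso_arcs = \<lambda>a. a, iso_head = head ?H, iso_tail = tail ?H\<rparr>"
  have inv: "the_inv_into {..s} X (X i) = i" if "i \<le> s" for i
    using the_inv_into_f_f[OF X] that by simp
  have "wf_digraph ?G" by unfold_locales (auto simp: quiver_def)
  moreover have "inj_on (iso_verts ?f) (verts ?G)"
    using Y by (auto simp: inj_on_def quiver_def inv)
  ultimately have "pre_digraph.digraph_isomorphism ?G ?f"
    unfolding pre_digraph.digraph_isomorphism_def by (auto simp: quiver_def inv)
  moreover have "?H = app_iso ?f ?G"
    unfolding app_iso_def by (auto simp: quiver_def inv m image_iff)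
  ultimately show ?thesis unfolding digraph_iso_def by blast
qed

theorem theoremB:
  fixes H :: "('k::{alg_closed_field, field_char_0}, 'h::ring_1) hopf_data"
    and A :: "('k, 'h, 'a::ring_1) action_data"
    and s :: nat
    and V :: "nat \<Rightarrow> ('h, 'v::ab_group_add) lmod"
    and Q :: "nat \<Rightarrow> nat \<Rightarrow> (('k, 'a, 'h) tensor, 'q::ab_group_add) glmod"
    and d :: "nat \<Rightarrow> nat \<Rightarrow> 'q \<Rightarrow> 'q"
    and e :: "nat \<Rightarrow> 'q \<Rightarrow> 'v"
  assumes "semisimple_hopf_algebra H"
    and "graded_hopf_action H A"
    and "fin_gen_degree_one A"
    and "complete_simples H s V"
    and "\<And>j. j \<le> s \<Longrightarrow>
      minimal_graded_resolution (smash H A) (inflated_module H A (V j)) (Q j) (d j) (e j)"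
  shows "digraph_iso (gabriel_quiver H A s V Q) (mckay_quiver H (degree_one_module A) s V)"
proof -
  interpret graded_hopf_action H A by (rule assms(2))
  show ?thesis
    unfolding gabriel_quiver_def mckay_quiver_def
  proof (rule quiver_iso)
    fix i j assume ij: "i \<le> s" "j \<le> s"
    show "summand_multiplicity S (shift (PM (V i)) (- 1)) (Q j 1) =
        decomposition_multiplicities s V (hopf_tensor H (degree_one_module A) (V j)) i"
      by (rule multiplicities_agree[OF assms(1,3,4) ij assms(5)[OF ij(2)]])
  next
    show "inj_on (\<lambda>i. proj_module H A (V i)) {..s}"
      by (rule inj_onI) (use proj_module_inj[OF assms(4)] in simp)
    \<comment> \<open>Equal modules are isomorphic, so the pairwise non-isomorphic
      \<open>V i\<close> are distinct.\<close>
    have "lmod_iso univ_ring M M" for M :: "('h, 'v) lmod"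
      unfolding lmod_iso_def by (rule exI[of _ "\<lambda>x. x"]) (simp add: lmod_hom_def bij_betw_def)
    then show "inj_on V {..s}"
      using assms(4) unfolding complete_simples_def inj_on_def by (metis atMost_iff)
  qed
qed


end
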